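(* Let $1\le p<2$, let $v\in L^p([0,\pi])$ be a complex-valued potential, let $bc\in\{Per^+,Per^-,Dir\}$, and let $1<a\le 2$. Define $r$ by $\frac1r=\frac12\left(\frac1p+\frac1a\right)$. Then $1/r>1/2$, and there exist $N_*=N_*(\|v\|_p)$ and a constant $C>0$ independent of $N$ such that $$\|S_N-S_N^0: L^a\to\mathcal{C}\|\le C\,N^{-\delta}\quad\text{for all } N\ge N_*,\qquad \delta=\left(1-\frac1p\right)+\left(1-\frac1a\right).$$
   Context: $L^a=L^a([0,\pi])$ with normalized Lebesgue measure: $\|f\|_a=\left(\frac1\pi\int_0^\pi|f(x)|^a\,dx\right)^{1/a}$; $\mathcal{C}=C([0,\pi])$ with the sup norm. For complex-valued $v\in L^1([0,\pi])$ and $bc\in\{Per^+,Per^-,Dir\}$, $L=L_{bc}(v)$ is the closed operator in $L^2([0,\pi])$ given by $Ly=-y''+v\,y$ on the domain of all $y$ such that $y,y'$ are absolutely continuous on $[0,\pi]$, $-y''+vy\in L^2([0,\pi])$, and the boundary conditions hold: $Per^{\pm}$: $y(\pi)=\pm y(0)$, $y'(\pi)=\pm y'(0)$; $Dir$: $y(0)=y(\pi)=0$. $L^0=L_{bc}(0)$ is the free operator. Their spectra are discrete. Let $R_\lambda=(\lambda-L)^{-1}$, $R^0_\lambda=(\lambda-L^0)^{-1}$. For $\omega,h>0$ let $\Pi_N=\{x+iy:\ -\omega\le x\le N^2+N,\ |y|\le h\}$ and $$S_N=\frac1{2\pi i}\int_{\partial\Pi_N}R_\lambda\,d\lambda,\qquad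 S_N^0=\frac1{2\pi i}\int_{\partial\Pi_N}R^0_\lambda\,d\lambda,$$ where $\omega,h$ are taken large enough that the interior of $\Pi_N$ contains all eigenvalues of $L$ and $L^0$ with real part at most $N^2+N$, and $N$ is large enough that no eigenvalue lies on the line $\mathrm{Re}\,\lambda=N^2+N$ ($S_N$, $S_N^0$ do not depend on the choice of such $\omega,h$). Operators defined on $L^2$ are regarded as operators from $L^a$, $a<2$, by extension by continuity from the dense subspace $L^2$. *)

theory Defs
  imports "HOL-Analysis.Analysis"
begin

subsection \<open>Function spaces on [0, pi]\<close>

text \<open>
  Elements of the spaces are represented by functions; equality in them is equality almost
  everywhere on [0, pi], and values outside [0, pi] never matter. An operator is a map on
  representatives.
\<close>

abbreviation M_pi :: "real measure" where
  "M_pi \<equiv> lebesgue_on {0..pi}"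

definition Lp :: "real \<Rightarrow> (real \<Rightarrow> complex) set" where
  "Lp a = {f. f \<in> borel_measurable M_pi \<and> integrable M_pi (\<lambda>x. norm (f x) powr a)}"

definition Lp_norm :: "real \<Rightarrow> (real \<Rightarrow> complex) \<Rightarrow> real" where
  "Lp_norm a f = (1 / pi * (LINT x|M_pi. norm (f x) powr a)) powr (1 / a)"

definition C_norm :: "(real \<Rightarrow> complex) \<Rightarrow> real" where
  "C_norm f = (SUP x\<in>{0..pi}. norm (f x))"

text \<open>The usual epsilon-delta notion, for finite families of non-overlapping subintervals.\<close>

definition absolutely_continuous_on_interval ::
    "real \<Rightarrow> real \<Rightarrow> (real \<Rightarrow> complex) \<Rightarrow> bool" where
  "absolutely_continuous_on_interval a b f \<longleftrightarrow>
     (\<forall>\<epsilon>>0. \<exists>\<delta>>0. \<forall>D. D division_of \<Union>D \<and> \<Union>D \<subseteq> {a..b} \<and> (\<Sum>k\<in>D. Sup k - Inf k) < \<delta> \<longrightarrow>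
        (\<Sum>k\<in>D. norm (f (Sup k) - f (Inf k))) < \<epsilon>)"


subsection \<open>The operators L and their resolvents\<close>

datatype bc = Per_plus | Per_minus | Dir

definition D_pi :: "(real \<Rightarrow> complex) \<Rightarrow> real \<Rightarrow> complex" where
  "D_pi y x = vector_derivative y (at x within {0..pi})"

fun boundary_cond :: "bc \<Rightarrow> (real \<Rightarrow> complex) \<Rightarrow> bool" where
  "boundary_cond Per_plus y \<longleftrightarrow> y pi = y 0 \<and> D_pi y pi = D_pi y 0"
| "boundary_cond Per_minus y \<longleftrightarrow> y pi = - y 0 \<and> D_pi y pi = - D_pi y 0"
| "boundary_cond Dir y \<longleftrightarrow> y 0 = 0 \<and> y pi = 0"

definition L_op :: "(real \<Rightarrow> complex) \<Rightarrow> (real \<Rightarrow> complex) \<Rightarrow> real \<Rightarrow> complex" where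
  "L_op v y x = - D_pi (D_pi y) x + v x * y x"

text \<open>
  The almost everywhere differentiability of y' is automatic from its absolute continuity; it is
  listed because \<^const>\<open>vector_derivative\<close> is a total function.
\<close>

definition L_dom :: "bc \<Rightarrow> (real \<Rightarrow> complex) \<Rightarrow> (real \<Rightarrow> complex) set" where
  "L_dom bc v = {y. y differentiable_on {0..pi}
      \<and> absolutely_continuous_on_interval 0 pi y
      \<and> absolutely_continuous_on_interval 0 pi (D_pi y)
      \<and> (AE x in M_pi. D_pi y differentiable (at x within {0..pi}))
      \<and> L_op v y \<in> Lp 2
      \<and> boundary_cond bc y}"

definition L_eigenvalue :: "bc \<Rightarrow> (real \<Rightarrow> complex) \<Rightarrow> complex \<Rightarrow> bool" where
  "L_eigenvalue bc v z \<longleftrightarrow>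
     (\<exists>y\<in>L_dom bc v. \<not> (AE x in M_pi. y x = 0) \<and> (AE x in M_pi. L_op v y x = z * y x))"

text \<open>
  The inverse of \<open>z - L\<close>. As elements of the domain are continuous on [0, pi], normalizing the
  solution to vanish outside [0, pi] makes it unique as a function.
\<close>

definition resolvent ::
    "bc \<Rightarrow> (real \<Rightarrow> complex) \<Rightarrow> complex \<Rightarrow> (real \<Rightarrow> complex) \<Rightarrow> (real \<Rightarrow> complex)" where
  "resolvent bc v z f = (THE y. y \<in> L_dom bc v \<and> (\<forall>x. x \<notin> {0..pi} \<longrightarrow> y x = 0)
      \<and> (AE x in M_pi. z * y x - L_op v y x = f x))"


subsection \<open>Integrals of operator-valued functions\<close>

definition L2_opnorm_le :: "((real \<Rightarrow> complex) \<Rightarrow> (real \<Rightarrow> complex)) \<Rightarrow> real \<Rightarrow> bool" where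
  "L2_opnorm_le T K \<longleftrightarrow> (\<forall>f\<in>Lp 2. T f \<in> Lp 2 \<and> Lp_norm 2 (T f) \<le> K * Lp_norm 2 f)"

text \<open>
  This is what \<open>has_contour_integral\<close> unfolds to (convergence of the Riemann sums of
  \<open>F (g t) * g' t\<close> along \<^const>\<open>division_filter\<close>, as in the definition of \<open>has_integral\<close>),
  with complex numbers replaced by operators on the square integrable functions and their
  operator norm.
\<close>

definition has_operator_contour_integral ::
    "(complex \<Rightarrow> (real \<Rightarrow> complex) \<Rightarrow> (real \<Rightarrow> complex)) \<Rightarrow>
     ((real \<Rightarrow> complex) \<Rightarrow> (real \<Rightarrow> complex)) \<Rightarrow> (real \<Rightarrow> complex) \<Rightarrow> bool" where
  "has_operator_contour_integral F T g \<longleftrightarrow>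
     (\<forall>\<epsilon>>0. eventually
        (\<lambda>p. L2_opnorm_le
           (\<lambda>f x. (\<Sum>(t,k)\<in>p. measure lborel k *\<^sub>R
                        (F (g t) f x * vector_derivative g (at t within {0..1})))
                   - T f x) \<epsilon>)
        (division_filter {0..1::real}))"


subsection \<open>The spectral projections\<close>

definition Pi_box :: "real \<Rightarrow> real \<Rightarrow> nat \<Rightarrow> complex set" where
  "Pi_box \<omega> h N = {z. - \<omega> \<le> Re z \<and> Re z \<le> real N ^ 2 + real N \<and> \<bar>Im z\<bar> \<le> h}"

text \<open>The boundary of \<^const>\<open>Pi_box\<close>, traversed counterclockwise.\<close>

definition Pi_boundary :: "real \<Rightarrow> real \<Rightarrow> nat \<Rightarrow> real \<Rightarrow> complex" where
  "Pi_boundary \<omega> h N = rectpath (Complex (- \<omega>) (- h)) (Complex (real N ^ 2 + real N) h)"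

text \<open>
  For potentials v and 0. The last condition in particular excludes eigenvalues on the line
  \<open>Re z = N\<^sup>2 + N\<close>, as points of this line are not interior.
\<close>

definition admissible :: "bc \<Rightarrow> (real \<Rightarrow> complex) \<Rightarrow> nat \<Rightarrow> real \<Rightarrow> real \<Rightarrow> bool" where
  "admissible bc v N \<omega> h \<longleftrightarrow> \<omega> > 0 \<and> h > 0 \<and>
     (\<forall>z. (L_eigenvalue bc v z \<or> L_eigenvalue bc (\<lambda>x. 0) z) \<and> Re z \<le> real N ^ 2 + real N
          \<longrightarrow> z \<in> interior (Pi_box \<omega> h N))"

text \<open>
  \<open>S\<close> is \<open>1/(2 pi i)\<close> times the integral of the resolvent; this determines \<open>S f\<close> almost
  everywhere, for each square integrable \<open>f\<close>.
\<close>

definition is_S ::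
    "bc \<Rightarrow> (real \<Rightarrow> complex) \<Rightarrow> nat \<Rightarrow> real \<Rightarrow> real \<Rightarrow>
     ((real \<Rightarrow> complex) \<Rightarrow> (real \<Rightarrow> complex)) \<Rightarrow> bool" where
  "is_S bc v N \<omega> h S \<longleftrightarrow>
     has_operator_contour_integral (resolvent bc v)
       (\<lambda>f x. 2 * of_real pi * \<i> * S f x) (Pi_boundary \<omega> h N)"

text \<open>
  The operator \<open>T\<close> on square integrable functions extends to a linear operator from \<^term>\<open>Lp a\<close>
  to the continuous functions, of norm at most \<open>K\<close>. For \<open>a \<le> 2\<close> the extension is unique, by density.
\<close>

definition La_C_norm_le :: "real \<Rightarrow> ((real \<Rightarrow> complex) \<Rightarrow> (real \<Rightarrow> complex)) \<Rightarrow> real \<Rightarrow> bool" where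
  "La_C_norm_le a T K \<longleftrightarrow>
     (\<exists>T'. (\<forall>f\<in>Lp a. \<forall>g\<in>Lp a. \<forall>x\<in>{0..pi}. T' (\<lambda>t. f t + g t) x = T' f x + T' g x)
         \<and> (\<forall>c. \<forall>f\<in>Lp a. \<forall>x\<in>{0..pi}. T' (\<lambda>t. c * f t) x = c * T' f x)
         \<and> (\<forall>f\<in>Lp 2. AE x in M_pi. T' f x = T f x)
         \<and> (\<forall>f\<in>Lp a. continuous_on {0..pi} (T' f) \<and> C_norm (T' f) \<le> K * Lp_norm a f))"

end

theory Submission
  imports Defs "HOL-Complex_Analysis.Complex_Analysis" "HOL-Probability.Discrete_Topology"
begin

text \<open>
  The estimate rests on an a priori bound for the free equation in which no Green function
  occurs. Write \<open>z = \<mu>\<^sup>2\<close> with \<open>\<tau> = Im \<mu> \<ge> 0\<close>. If \<open>u'' = - z u + g\<close>, then \<open>q = u' + \<i> \<mu> u\<close> and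
  \<open>p = u' - \<i> \<mu> u\<close> satisfy the first-order equations \<open>q' = \<i> \<mu> q + g\<close> and \<open>p' = - \<i> \<mu> p + g\<close>.
  Solving the first one from 0 and the second one from pi, only decaying exponentials appear,
  and the boundary conditions express \<open>q 0\<close> and \<open>p pi\<close> through integrals of g, up to a factor
  that is bounded as soon as \<open>1 - exp (2 pi \<i> \<mu>)\<close> stays away from 0. This holds on the line
  \<open>Re z = N\<^sup>2 + N\<close> and for \<open>\<tau> \<ge> 1/4\<close>. Hence \<open>\<bar>u\<bar> \<le> 5 A / \<bar>\<mu>\<bar>\<close>, where A bounds the averages of
  \<open>\<bar>g\<bar>\<close> with the weights \<open>exp (- \<tau> \<bar>x - t\<bar>)\<close> (\<open>free_apriori_estimate\<close>). By Hoelder's inequality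
  these averages are at most \<open>2 \<parallel>g\<parallel>\<^sub>a \<tau> powr (- (1 - 1/a))\<close>.

  A solution of the equation with potential v and right-hand side f solves the free equation
  with \<open>g = f + v u\<close>. If \<open>10 \<parallel>v\<parallel>\<^sub>1 \<le> \<bar>\<mu>\<bar>\<close>, the term \<open>v u\<close> is absorbed and u obeys the same bound
  with twice the constant; in particular z is no eigenvalue, which gives the threshold for N in
  terms of \<open>\<parallel>v\<parallel>\<^sub>p\<close> alone. The difference of the two resolvents applied to f solves the free
  equation with \<open>g = v u\<close>, so both bounds combine to
  \<open>\<bar>R f - R\<^sup>0 f\<bar> \<le> 200 \<parallel>v\<parallel>\<^sub>p \<parallel>f\<parallel>\<^sub>a \<tau> powr (- \<delta>) / \<bar>z\<bar>\<close> (\<open>weak_resolvent_diff_estimate\<close>, with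
  unnormalized norms). On the line \<open>\<tau> \<ge> \<bar>Im z\<bar> / (2 sqrt \<bar>z\<bar>)\<close>, and for \<open>Re z \<le> \<bar>Im z\<bar>\<close> one has
  \<open>\<tau> \<ge> sqrt \<bar>z\<bar> / 3\<close>. Integrating over the line, the part \<open>\<bar>Im z\<bar> \<le> N\<^sup>2\<close> converges at the real
  axis because \<open>\<delta> < 1\<close>, the rest at infinity because \<open>\<delta> > 0\<close>, and each contributes a multiple of
  \<open>N powr (- \<delta>)\<close>; the other sides of a large box contribute no more than that.

  The sides of an admissible box, however, may come arbitrarily close to eigenvalues. So the
  integrand must be understood at every z that is not an eigenvalue. There the resolvent exists
  on all of \<open>L\<^sup>1\<close>: the initial value problem is solvable, and the boundary conditions become a
  linear system of two equations whose determinant vanishes only at eigenvalues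
  (\<open>solves_bvp_exists\<close>). The resolvent identity makes it locally bounded and holomorphic in z,
  and Cauchy's theorem moves the contour to a large box with the same right side
  (\<open>deform_rectangle\<close>). The same identity makes the resolvent Lipschitz along the contour,
  uniformly in x and in f with \<open>\<parallel>f\<parallel>\<^sub>1 \<le> 1\<close>, so the Riemann sums of the pointwise contour
  integrals converge in operator norm (\<open>is_S_spectral_op\<close>).

  The link between the domain of L and these integral equations is the theory of absolutely
  continuous functions on an interval: integrals of \<open>L\<^sup>1\<close> functions are almost everywhere
  differentiable, and an absolutely continuous function is the integral of its derivative.
\<close>

section \<open>Lebesgue differentiation and absolute continuity on an interval\<close>

text \<open>
  Let \<open>E n\<close> be the set of points at which arbitrarily short intervals with this endpoint have a
  difference quotient that is off by more than \<open>1 / Suc n\<close>. By the Vitali covering lemma,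
  disjoint such intervals can be selected whose fivefold enlargements cover \<open>E n\<close>. They form a
  tagged partial division, and by Henstock's lemma the errors over it add up to an arbitrarily
  small number; so their total length, hence the outer measure of \<open>E n\<close>, is arbitrarily small.
\<close>

lemma negligible_not_deriv_indefinite_integral:
  fixes f :: "real \<Rightarrow> complex"
  assumes f: "f integrable_on {a..b}"
  shows "negligible {x\<in>{a..b}. \<not> ((\<lambda>x. integral {a..x} f) has_vector_derivative f x) (at x within {a..b})}"
proof -
  define F where "F = (\<lambda>x. integral {a..x} f)"
  have Fdiff: "F y - F x = integral {x..y} f" if "a \<le> x" "x \<le> y" "y \<le> b" for x y
  proof -
    have "f integrable_on {a..y}" using f that by (auto intro: integrable_subinterval_real)
    then show ?thesis
      using Henstock_Kurzweil_Integration.integral_combine[of a x y f] that by (simp add: F_def algebra_simps)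
  qed
  define E where "E n = {x\<in>{a..b}. \<forall>d>0. \<exists>y\<in>{a..b}. 0 < \<bar>y-x\<bar> \<and> \<bar>y-x\<bar> < d \<and>
      norm (F y - F x - (y-x) *\<^sub>R f x) > \<bar>y-x\<bar> / real (Suc n)}" for n :: nat
  have sub: "{x\<in>{a..b}. \<not> (F has_vector_derivative f x) (at x within {a..b})} \<subseteq> (\<Union>n. E n)"
  proof safe
    fix x assume x: "x \<in> {a..b}" "\<not> (F has_vector_derivative f x) (at x within {a..b})"
    then have "\<not> (\<forall>e>0. \<exists>d>0. \<forall>y\<in>{a..b}. norm (y - x) < d \<longrightarrow> norm (F y - F x - (y - x) *\<^sub>R f x) \<le> e * norm (y - x))"
      unfolding has_vector_derivative_def has_derivative_within_alt
      by (auto simp: bounded_linear_scaleR_left)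
    then obtain e where e: "e > 0" and ne: "\<And>d. d > 0 \<Longrightarrow> \<exists>y\<in>{a..b}. norm (y - x) < d \<and> norm (F y - F x - (y - x) *\<^sub>R f x) > e * norm (y - x)"
      by (auto simp: not_le)
    obtain n where n: "inverse (real (Suc n)) < e" using reals_Archimedean[OF e] by auto
    have "x \<in> E n" unfolding E_def
    proof (intro CollectI conjI allI impI)
      show "x \<in> {a..b}" by (rule x)
    next
      fix d :: real assume "d > 0"
      from ne[OF this] obtain y where y: "y\<in>{a..b}" "norm (y-x) < d" "norm (F y - F x - (y - x) *\<^sub>R f x) > e * norm (y - x)" by auto
      have "y \<noteq> x" using y by auto
      moreover have "\<bar>y-x\<bar> / real (Suc n) \<le> e * norm (y - x)"
        using mult_right_mono[of "inverse (real (Suc n))" e "\<bar>y-x\<bar>"] n by (simp add: divide_inverse mult.commute del: of_nat_Suc)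
      ultimately show "\<exists>y\<in>{a..b}. 0 < \<bar>y-x\<bar> \<and> \<bar>y-x\<bar> < d \<and> norm (F y - F x - (y-x) *\<^sub>R f x) > \<bar>y-x\<bar> / real (Suc n)"
        using y by (intro bexI[of _ y]) auto
    qed
    then show "x \<in> (\<Union>n. E n)" by blast
  qed
  have "negligible (E n)" for n
    unfolding negligible_outer_le
  proof (intro allI impI)
    fix e :: real assume e: "e > 0"
    define \<eta> where "\<eta> = 1 / real (Suc n)"
    have \<eta>: "\<eta> > 0" by (simp add: \<eta>_def)
    have e': "e * \<eta> / 5 > 0" using e \<eta> by simp
    have fc: "f integrable_on cbox a b" using f by simp
    obtain \<gamma> where \<gamma>: "gauge \<gamma>" "\<And>p. \<lbrakk>p tagged_partial_division_of (cbox a b); \<gamma> fine p\<rbrakk> \<Longrightarrow>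
             sum (\<lambda>(x,k). norm(measure lborel k *\<^sub>R f x - integral k f)) p < e * \<eta> / 5"
      using Henstock_lemma[OF fc e'] by blast
    have "\<exists>y\<in>{a..b}. y \<noteq> x \<and> cbox (min x y) (max x y) \<subseteq> \<gamma> x \<and> norm (F y - F x - (y-x) *\<^sub>R f x) > \<bar>y-x\<bar> * \<eta>"
      if x: "x \<in> E n" for x
    proof -
      obtain d where d: "d > 0" "ball x d \<subseteq> \<gamma> x"
        using \<gamma>(1) by (meson gauge_def open_contains_ball)
      from x d(1) obtain y where "y\<in>{a..b}" "0 < \<bar>y-x\<bar>" "\<bar>y-x\<bar> < d" "norm (F y - F x - (y-x) *\<^sub>R f x) > \<bar>y-x\<bar> / real (Suc n)"
        unfolding E_def by blast
      moreover have "cbox (min x y) (max x y) \<subseteq> ball x d"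
        using \<open>\<bar>y-x\<bar> < d\<close> \<open>d>0\<close> by (auto simp: dist_real_def)
      ultimately show ?thesis using d by (intro bexI[of _ y]) (auto simp: \<eta>_def)
    qed
    then obtain y where y: "\<And>x. x \<in> E n \<Longrightarrow> y x \<in> {a..b}" "\<And>x. x \<in> E n \<Longrightarrow> y x \<noteq> x"
       "\<And>x. x \<in> E n \<Longrightarrow> cbox (min x (y x)) (max x (y x)) \<subseteq> \<gamma> x" 
       "\<And>x. x \<in> E n \<Longrightarrow> norm (F (y x) - F x - (y x-x) *\<^sub>R f x) > \<bar>y x-x\<bar> * \<eta>"
      by metis
    define c r where "c x = (x + y x) / 2" and "r x = \<bar>y x - x\<bar> / 2" for x
    have cb: "cball (c x) (r x) = cbox (min x (y x)) (max x (y x))" for x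
      unfolding cball_eq_atLeastAtMost c_def r_def cbox_interval by (auto simp: field_simps abs_if min_def max_def split: if_splits)
    have En: "x \<in> {a..b}" if "x \<in> E n" for x using that by (simp add: E_def)
    have "E n \<subseteq> (\<Union>x\<in>E n. cball (c x) (r x))" unfolding cb by force
    moreover have "0 < r x \<and> r x \<le> b - a" if "x \<in> E n" for x
      using y(1,2)[OF that] En[OF that] unfolding r_def by auto
    ultimately obtain C where C: "countable C" "C \<subseteq> E n"
       "pairwise (\<lambda>i j. disjnt (cball (c i) (r i)) (cball (c j) (r j))) C"
       "E n \<subseteq> (\<Union>i\<in>C. cball (c i) (5 * r i))"
      by (rule Vitali_covering_lemma_cballs)
    have fin: "measure lebesgue (\<Union>i\<in>I. cball (c i) (5 * r i)) \<le> e" if I: "I \<subseteq> C" "finite I" for I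
    proof -
      define p where "p = (\<lambda>x. (x, cbox (min x (y x)) (max x (y x)))) ` I"
      have IE: "x \<in> E n" if "x \<in> I" for x using that I C by auto
      have "p tagged_partial_division_of (cbox a b)"
        unfolding tagged_partial_division_of_def
      proof (intro conjI allI impI)
        show "finite p" using I by (simp add: p_def)
        fix x K assume "(x,K) \<in> p"
        then have K: "x \<in> I" "K = cbox (min x (y x)) (max x (y x))" by (auto simp: p_def)
        then show "x \<in> K" "\<exists>a b. K = cbox a b" by auto
        show "K \<subseteq> cbox a b" using K En[OF IE] y(1)[OF IE] by auto
      next
        fix x1 K1 x2 K2 assume "(x1, K1) \<in> p \<and> (x2, K2) \<in> p \<and> (x1, K1) \<noteq> (x2, K2)"
        then have "x1 \<in> I" "x2 \<in> I" "x1 \<noteq> x2" "K1 = cball (c x1) (r x1)" "K2 = cball (c x2) (r x2)"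
          by (auto simp: p_def cb)
        then have "disjnt K1 K2" using C(3) I by (auto simp: pairwise_def)
        then show "interior K1 \<inter> interior K2 = {}"
          using interior_subset by (fastforce simp: disjnt_def)
      qed
      moreover have "\<gamma> fine p" using y(3) IE by (auto simp: p_def fine_def)
      ultimately have lt: "sum (\<lambda>(x,k). norm(measure lborel k *\<^sub>R f x - integral k f)) p < e * \<eta> / 5" by (rule \<gamma>(2))
      have eq: "sum (\<lambda>(x,k). norm(measure lborel k *\<^sub>R f x - integral k f)) p =
        (\<Sum>x\<in>I. norm(measure lborel (cbox (min x (y x)) (max x (y x))) *\<^sub>R f x - integral (cbox (min x (y x)) (max x (y x))) f))"
        unfolding p_def by (subst sum.reindex) (auto simp: inj_on_def)
      have "(\<Sum>x\<in>I. 2 * r x * \<eta>) \<le> (\<Sum>x\<in>I. norm(measure lborel (cbox (min x (y x)) (max x (y x))) *\<^sub>R f x - integral (cbox (min x (y x)) (max x (y x))) f))"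
      proof (rule sum_mono)
        fix x assume x: "x \<in> I"
        have "norm(measure lborel (cbox (min x (y x)) (max x (y x))) *\<^sub>R f x - integral (cbox (min x (y x)) (max x (y x))) f)
          = norm (F (y x) - F x - (y x-x) *\<^sub>R f x)"
        proof (cases "x \<le> y x")
          case True
          then show ?thesis using Fdiff[of x "y x"] En[OF IE[OF x]] y(1)[OF IE[OF x]] by (simp add: norm_minus_commute)
        next
          case False
          then have "measure lborel (cbox (min x (y x)) (max x (y x))) *\<^sub>R f x - integral (cbox (min x (y x)) (max x (y x))) f = (x - y x) *\<^sub>R f x - (F x - F (y x))"
            using Fdiff[of "y x" x] En[OF IE[OF x]] y(1)[OF IE[OF x]] by simp
          also have "\<dots> = F (y x) - F x - (y x-x) *\<^sub>R f x" by (simp add: algebra_simps)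
          finally show ?thesis by simp
        qed
        then show "2 * r x * \<eta> \<le> norm(measure lborel (cbox (min x (y x)) (max x (y x))) *\<^sub>R f x - integral (cbox (min x (y x)) (max x (y x))) f)"
          using y(4)[OF IE[OF x]] by (simp add: r_def)
      qed
      also have "\<dots> < e * \<eta> / 5" using lt unfolding eq .
      finally have "(\<Sum>x\<in>I. 2 * r x) * \<eta> < e / 5 * \<eta>" by (simp add: sum_distrib_right)
      then have s: "(\<Sum>x\<in>I. 2 * r x) < e / 5" using \<eta> by simp
      have "measure lebesgue (\<Union>i\<in>I. cball (c i) (5 * r i)) \<le> (\<Sum>i\<in>I. measure lebesgue (cball (c i) (5 * r i)))"
        using I by (intro measure_UNION_le) auto
      also have "\<dots> = (\<Sum>i\<in>I. 5 * (2 * r i))"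
        by (intro sum.cong refl) (auto simp: cball_eq_atLeastAtMost r_def)
      also have "\<dots> = 5 * (\<Sum>x\<in>I. 2 * r x)" by (simp add: sum_distrib_left)
      finally show ?thesis using s by simp
    qed
    show "\<exists>T. E n \<subseteq> T \<and> T \<in> lmeasurable \<and> measure lebesgue T \<le> e"
    proof (intro exI conjI)
      show "E n \<subseteq> (\<Union>i\<in>C. cball (c i) (5 * r i))" by (rule C(4))
      show "(\<Union>i\<in>C. cball (c i) (5 * r i)) \<in> lmeasurable" by (rule fmeasurable_UN_bound[OF C(1) _ fin]) auto
      show "measure lebesgue (\<Union>i\<in>C. cball (c i) (5 * r i)) \<le> e" by (rule measure_UN_bound[OF C(1) _ fin]) auto
    qed
  qed
  then have "negligible (\<Union>n. E n)" by (intro negligible_countable_Union) auto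
  then show ?thesis using sub negligible_subset unfolding F_def by blast
qed

abbreviation small_variation :: "(real \<Rightarrow> complex) \<Rightarrow> real \<Rightarrow> real \<Rightarrow> real \<Rightarrow> real \<Rightarrow> bool" where
  "small_variation F a b \<delta> e \<equiv> \<forall>D. D division_of \<Union>D \<and> \<Union>D \<subseteq> {a..b} \<and> (\<Sum>k\<in>D. Sup k - Inf k) < \<delta> \<longrightarrow>
     (\<Sum>k\<in>D. norm (F (Sup k) - F (Inf k))) < e"

text \<open>
  The inner statement is kept as a closed formula, so that the rule can be applied by
  resolution.
\<close>

lemma absolutely_continuousE:
  assumes "absolutely_continuous_on_interval a b F" "e > 0"
  obtains \<delta> where "\<delta> > 0" "small_variation F a b \<delta> e"
proof -
  from assms(1)[unfolded absolutely_continuous_on_interval_def, rule_format, OF assms(2)]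
  obtain \<delta> where "\<delta> > 0 \<and> (small_variation F a b \<delta> e)" by (rule exE)
  then show thesis using that[of \<delta>] by blast
qed

text \<open>
  The gauge integral yields this directly. At points of differentiability the gauge makes
  increments of F agree with \<open>f x * length\<close>. At the exceptional points the gauge confines the
  intervals to an open set of small measure, where absolute continuity makes the sum of the
  increments small.
\<close>

lemma has_integral_of_absolutely_continuous:
  assumes "a \<le> b"
    and AC: "absolutely_continuous_on_interval a b F"
    and N: "negligible {x\<in>{a..b}. \<not> (F has_vector_derivative f x) (at x within {a..b})}"
  shows "(f has_integral (F b - F a)) {a..b}"
proof -
  define N where "N = {x\<in>{a..b}. \<not> (F has_vector_derivative f x) (at x within {a..b})}"
  define g where "g x = (if x \<in> N then 0 else f x)" for x
  have "(g has_integral (F b - F a)) (cbox a b)"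
    unfolding has_integral
  proof (intro allI impI)
    fix e :: real assume e: "e > 0"
    define e1 where "e1 = e / 2 / (b - a + 1)"
    have e1: "e1 > 0" "e1 * (b - a) < e / 2" using e \<open>a\<le>b\<close> by (auto simp: e1_def field_simps)
    obtain \<delta> where \<delta>: "\<delta> > 0" "small_variation F a b \<delta> (e / 2)"
      by (rule absolutely_continuousE[OF AC half_gt_zero[OF e]])
    obtain U where U: "open U" "N \<subseteq> U" "U \<in> lmeasurable" "measure lebesgue U < \<delta>"
    proof -
      have N0: "N \<in> lmeasurable" "measure lebesgue N = 0" using N unfolding N_def[symmetric]
        by (auto simp: negligible_iff_measure)
      obtain T where T: "open T" "N \<subseteq> T" "T - N \<in> lmeasurable" "emeasure lebesgue (T - N) < ennreal \<delta>"
        using sets_lebesgue_outer_open[OF fmeasurableD[OF N0(1)] \<delta>(1)] by metis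
      have "T = N \<union> (T - N)" using T by auto
      then have "T \<in> lmeasurable" "measure lebesgue T \<le> measure lebesgue N + measure lebesgue (T - N)"
        using fmeasurable.Un[OF N0(1) T(3)] measure_Un_le[of N lebesgue "T - N"] N0 T(3) by (auto dest: fmeasurableD)
      moreover have "measure lebesgue (T - N) < \<delta>"
        using T(3,4) \<delta>(1) by (simp add: emeasure_eq_measure2 ennreal_less_iff)
      ultimately show ?thesis using that T N0 by auto
    qed
    have "\<exists>d>0. \<forall>y\<in>{a..b}. norm (y - x) < d \<longrightarrow> norm (F y - F x - (y - x) *\<^sub>R f x) \<le> e1 * norm (y - x)"
      if "x \<in> {a..b}" "x \<notin> N" for x
    proof -
      have "(F has_vector_derivative f x) (at x within {a..b})" using that by (auto simp: N_def)
      then show ?thesis unfolding has_vector_derivative_def has_derivative_within_alt using e1 by blast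
    qed
    then obtain d where d: "\<And>x. x \<in> {a..b} \<Longrightarrow> x \<notin> N \<Longrightarrow> d x > 0"
      "\<And>x y. x \<in> {a..b} \<Longrightarrow> x \<notin> N \<Longrightarrow> y\<in>{a..b} \<Longrightarrow> norm (y - x) < d x \<Longrightarrow> norm (F y - F x - (y - x) *\<^sub>R f x) \<le> e1 * norm (y - x)"
      by metis
    define \<gamma> where "\<gamma> x = (if x \<in> N then U else if x \<in> {a..b} then ball x (d x) else UNIV)" for x
    have "gauge \<gamma>" unfolding gauge_def \<gamma>_def using U d(1) by auto
    moreover have "norm ((\<Sum>(x,k)\<in>p. measure lborel k *\<^sub>R g x) - (F b - F a)) < e"
      if p: "p tagged_division_of cbox a b" "\<gamma> fine p" for p
    proof -
      note pD = tagged_division_ofD[OF p(1)]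
      have kk: "\<exists>u v. k = {u..v} \<and> u \<le> v \<and> x \<in> {u..v} \<and> a \<le> u \<and> v \<le> b" if "(x,k) \<in> p" for x k
      proof -
        obtain u v where "k = cbox u v" using pD(4)[OF \<open>(x,k) \<in> p\<close>] by blast
        with pD(2,3)[OF \<open>(x,k) \<in> p\<close>] show ?thesis by (intro exI[of _ u] exI[of _ v]) (auto simp: subset_iff)
      qed
      have tel: "(\<Sum>(x,k)\<in>p. F (Sup k) - F (Inf k)) = F b - F a"
        using additive_tagged_division_1[OF \<open>a\<le>b\<close>, of p F] p(1) by simp
      define p1 where "p1 = {z\<in>p. fst z \<in> N}"
      define p2 where "p2 = {z\<in>p. fst z \<notin> N}"
      have fin: "finite p" "finite p1" "finite p2" using pD(1) by (auto simp: p1_def p2_def)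
      have split: "sum h p = sum h p1 + sum h p2" for h :: "real \<times> real set \<Rightarrow> complex"
      proof -
        have "p = p1 \<union> p2" "p1 \<inter> p2 = {}" by (auto simp: p1_def p2_def)
        then show ?thesis using sum.union_disjoint[of p1 p2 h] fin by simp
      qed
      have A: "norm (\<Sum>(x,k)\<in>p2. measure lborel k *\<^sub>R g x - (F (Sup k) - F (Inf k))) \<le> e1 * (b - a)"
      proof -
        have "norm (\<Sum>(x,k)\<in>p2. measure lborel k *\<^sub>R g x - (F (Sup k) - F (Inf k))) \<le> (\<Sum>(x,k)\<in>p2. e1 * measure lborel k)"
        proof (rule sum_norm_le, safe)
          fix x k assume "(x,k) \<in> p2"
          then have xk: "(x,k) \<in> p" "x \<notin> N" by (auto simp: p2_def)
          obtain u v where uv: "k = {u..v}" "u \<le> v" "x \<in> {u..v}" "a \<le> u" "v \<le> b" using kk[OF xk(1)] by blast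
          have xab: "x \<in> {a..b}" using uv by auto
          have "k \<subseteq> ball x (d x)" using p(2) xk xab by (fastforce simp: fine_def \<gamma>_def)
          then have "u \<in> ball x (d x)" "v \<in> ball x (d x)" using uv(1,2) by (metis atLeastAtMost_iff order_refl subsetD)+
          then have "norm (F u - F x - (u - x) *\<^sub>R f x) \<le> e1 * norm (u - x)" "norm (F v - F x - (v - x) *\<^sub>R f x) \<le> e1 * norm (v - x)"
            by (intro d(2)[OF xab xk(2)]; use uv in \<open>auto simp: dist_real_def\<close>)+
          then have "norm (F u - F x - (u - x) *\<^sub>R f x) + norm (F v - F x - (v - x) *\<^sub>R f x) \<le> e1 * (x-u) + e1 * (v - x)"
            using uv by auto
          moreover have "e1 * (x-u) + e1 * (v - x) = e1 * measure lborel k" using uv by (simp add: algebra_simps)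
          moreover have eq: "measure lborel k *\<^sub>R g x - (F (Sup k) - F (Inf k)) = (F u - F x - (u - x) *\<^sub>R f x) - (F v - F x - (v - x) *\<^sub>R f x)"
            using uv xk by (simp add: g_def algebra_simps)
          moreover have "norm (measure lborel k *\<^sub>R g x - (F (Sup k) - F (Inf k))) \<le> norm (F u - F x - (u - x) *\<^sub>R f x) + norm (F v - F x - (v - x) *\<^sub>R f x)"
            unfolding eq by (rule norm_triangle_ineq4)
          ultimately show "norm (measure lborel k *\<^sub>R g x - (F (Sup k) - F (Inf k))) \<le> e1 * measure lborel k"
            by linarith
        qed
        also have "\<dots> \<le> (\<Sum>(x,k)\<in>p. e1 * measure lborel k)"
          using fin e1 by (intro sum_mono2) (auto simp: p2_def)
        also have "\<dots> = e1 * (\<Sum>(x,k)\<in>p. measure lborel k)" by (simp add: sum_distrib_left case_prod_unfold)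
        also have "\<dots> = e1 * (b - a)" using additive_content_tagged_division[OF p(1)] \<open>a\<le>b\<close> by simp
        finally show ?thesis .
      qed
      have B: "norm (\<Sum>(x,k)\<in>p1. measure lborel k *\<^sub>R g x - (F (Sup k) - F (Inf k))) < e / 2"
      proof -
        define D where "D = snd ` p1"
        have tp: "p1 tagged_partial_division_of cbox a b"
          using p(1) unfolding tagged_division_of_def by (auto intro: tagged_partial_division_subset simp: p1_def)
        have td: "p1 tagged_division_of \<Union>D"
          using tagged_partial_division_of_Union_self[OF tp] by (simp add: D_def)
        then have Dd: "D division_of \<Union>D" using division_of_tagged_division unfolding D_def by blast
        have red: "(\<Sum>(x,k)\<in>p1. h k) = sum h D" if "\<And>u v. box u v = {} \<Longrightarrow> h (cbox u v) = 0" for h :: "real set \<Rightarrow> real"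
          using sum.over_tagged_division_lemma[OF td, of h] that unfolding D_def by simp
        have DU: "k \<subseteq> U" "k \<subseteq> {a..b}" if "k \<in> D" for k
        proof -
          obtain x where "(x,k) \<in> p" "x \<in> N" using \<open>k \<in> D\<close> unfolding D_def p1_def by force
          then show "k \<subseteq> U" using p(2) by (fastforce simp: fine_def \<gamma>_def)
          show "k \<subseteq> {a..b}" using pD(3)[OF \<open>(x,k)\<in>p\<close>] by simp
        qed
        have Dk: "\<exists>u v. k = {u..v} \<and> u \<le> v" if "k \<in> D" for k
          using that kk unfolding D_def p1_def by force
        have "(\<Sum>k\<in>D. Sup k - Inf k) = sum (measure lebesgue) D" by (rule sum.cong[OF refl]) (use Dk in force)
        also have "\<dots> = measure lebesgue (\<Union>D)" using content_division[OF Dd] by simp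
        also have "\<dots> \<le> measure lebesgue U"
          using DU(1) U(3) fmeasurableD[OF lmeasurable_division[OF Dd]] by (intro measure_mono_fmeasurable) auto
        finally have "(\<Sum>k\<in>D. Sup k - Inf k) < \<delta>" using U(4) by simp
        moreover have "\<Union>D \<subseteq> {a..b}" using DU(2) by blast
        ultimately have "(\<Sum>k\<in>D. norm (F (Sup k) - F (Inf k))) < e / 2"
          by (intro \<delta>(2)[THEN spec, THEN mp] conjI Dd)
        moreover have "norm (\<Sum>(x,k)\<in>p1. measure lborel k *\<^sub>R g x - (F (Sup k) - F (Inf k))) \<le> (\<Sum>(x,k)\<in>p1. norm (F (Sup k) - F (Inf k)))"
          by (rule sum_norm_le) (auto simp: p1_def g_def norm_minus_commute)
        moreover have "(\<Sum>(x,k)\<in>p1. norm (F (Sup k) - F (Inf k))) = (\<Sum>k\<in>D. norm (F (Sup k) - F (Inf k)))"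
        proof -
          have ne: "k \<noteq> {}" if "k \<in> D" for k using Dk[OF that] by auto
          have "(\<Sum>(x,k)\<in>p1. norm (F (Sup k) - F (Inf k))) = (\<Sum>(x,k)\<in>p1. (if k = {} then 0 else norm (F (Sup k) - F (Inf k))))"
          proof (rule sum.cong[OF refl], clarify)
            fix x k assume "(x,k) \<in> p1"
            then have "k \<in> D" unfolding D_def by force
            then show "norm (F (Sup k) - F (Inf k)) = (if k = {} then 0 else norm (F (Sup k) - F (Inf k)))" using ne by simp
          qed
          also have "\<dots> = (\<Sum>k\<in>D. (if k = {} then 0 else norm (F (Sup k) - F (Inf k))))"
            by (rule red) auto
          also have "\<dots> = (\<Sum>k\<in>D. norm (F (Sup k) - F (Inf k)))" using ne by (intro sum.cong) auto
          finally show ?thesis .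
        qed
        ultimately show ?thesis by simp
      qed
      have "(\<Sum>(x,k)\<in>p. measure lborel k *\<^sub>R g x) - (F b - F a) = (\<Sum>(x,k)\<in>p. measure lborel k *\<^sub>R g x - (F (Sup k) - F (Inf k)))"
        using tel by (simp add: sum_subtractf case_prod_unfold)
      also have "\<dots> = (\<Sum>(x,k)\<in>p1. measure lborel k *\<^sub>R g x - (F (Sup k) - F (Inf k))) + (\<Sum>(x,k)\<in>p2. measure lborel k *\<^sub>R g x - (F (Sup k) - F (Inf k)))"
        by (rule split)
      finally have eq: "(\<Sum>(x,k)\<in>p. measure lborel k *\<^sub>R g x) - (F b - F a) = (\<Sum>(x,k)\<in>p1. measure lborel k *\<^sub>R g x - (F (Sup k) - F (Inf k))) + (\<Sum>(x,k)\<in>p2. measure lborel k *\<^sub>R g x - (F (Sup k) - F (Inf k)))" .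
      show ?thesis unfolding eq by (rule order.strict_trans1[OF norm_triangle_ineq]) (use A B e1 in linarith)
    qed
    ultimately show "\<exists>\<gamma>. gauge \<gamma> \<and> (\<forall>\<D>. \<D> tagged_division_of cbox a b \<and> \<gamma> fine \<D> \<longrightarrow>
       norm ((\<Sum>(x,k)\<in>\<D>. measure lborel k *\<^sub>R g x) - (F b - F a)) < e)"
      by (intro exI[of _ \<gamma>] conjI allI impI) simp_all
  qed
  then have g: "(g has_integral (F b - F a)) {a..b}" by simp
  have "negligible N" using N by (simp add: N_def)
  moreover have "f x = g x" if "x \<in> {a..b} - N" for x using that by (auto simp only: g_def if_False)
  ultimately show ?thesis using g by (rule has_integral_spike)
qed


text \<open>
  Truncating \<open>\<bar>f\<bar>\<close> at height n costs little in the integral by dominated convergence, and the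
  truncated part contributes at most n times the total length.
\<close>

lemma absolutely_continuous_indefinite_integral:
  fixes f :: "real \<Rightarrow> complex"
  assumes f: "f absolutely_integrable_on {a..b}"
    and F: "\<And>x. x \<in> {a..b} \<Longrightarrow> F x = c + integral {a..x} f"
  shows "absolutely_continuous_on_interval a b F"
  unfolding absolutely_continuous_on_interval_def
proof (intro allI impI)
  fix e :: real assume e: "e > 0"
  have nf: "(\<lambda>x. norm (f x)) absolutely_integrable_on {a..b}" using absolutely_integrable_norm[OF f] by (simp add: comp_def)
  define h where "h n x = min (norm (f x)) (real n)" for n :: nat and x
  have h: "h n absolutely_integrable_on {a..b}" for n
    unfolding h_def by (rule absolutely_integrable_min_1[OF nf]) simp
  have "(\<lambda>n. integral {a..b} (h n)) \<longlonglongrightarrow> integral {a..b} (\<lambda>x. norm (f x))"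
  proof (rule dominated_convergence)
    show "h n integrable_on {a..b}" for n using h by (simp add: absolutely_integrable_on_def)
    show "(\<lambda>x. norm (f x)) integrable_on {a..b}" using nf by (simp add: absolutely_integrable_on_def)
    show "norm (h n x) \<le> norm (f x)" for n x by (simp add: h_def)
    show "(\<lambda>n. h n x) \<longlonglongrightarrow> norm (f x)" for x
    proof (rule tendsto_eventually)
      obtain m where "norm (f x) \<le> real m" using real_arch_simple by blast
      then show "\<forall>\<^sub>F n in sequentially. h n x = norm (f x)"
        by (intro eventually_sequentiallyI[of m]) (auto simp: h_def)
    qed
  qed
  then have "\<forall>\<^sub>F n in sequentially. dist (integral {a..b} (h n)) (integral {a..b} (\<lambda>x. norm (f x))) < e / 2"
    using e by (intro tendstoD) auto
  then obtain n where n: "dist (integral {a..b} (h n)) (integral {a..b} (\<lambda>x. norm (f x))) < e / 2"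
    using eventually_happens by force
  define \<phi> where "\<phi> x = norm (f x) - h n x" for x
  have \<phi>: "\<phi> integrable_on {a..b}" "\<And>x. 0 \<le> \<phi> x"
    unfolding \<phi>_def using h[of n] nf by (auto simp: absolutely_integrable_on_def h_def intro!: integrable_diff)
  have i\<phi>: "integral {a..b} \<phi> < e / 2"
  proof -
    have "integral {a..b} \<phi> = integral {a..b} (\<lambda>x. norm (f x)) - integral {a..b} (h n)"
      unfolding \<phi>_def using h[of n] nf by (intro integral_diff) (auto simp: absolutely_integrable_on_def)
    then show ?thesis using n by (simp add: dist_real_def abs_if split: if_splits)
  qed
  define \<delta> where "\<delta> = e / 2 / (real n + 1)"
  have "\<delta> > 0" using e by (simp add: \<delta>_def)
  moreover have "(\<Sum>k\<in>D. norm (F (Sup k) - F (Inf k))) < e"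
    if D: "D division_of \<Union>D" "\<Union>D \<subseteq> {a..b}" "(\<Sum>k\<in>D. Sup k - Inf k) < \<delta>" for D
  proof -
    have one: "norm (F (Sup k) - F (Inf k)) \<le> integral k \<phi> + real n * (Sup k - Inf k)" if "k \<in> D" for k
    proof -
      obtain u v where uv: "k = {u..v}" "u \<le> v" 
        using division_ofD(3)[OF D(1) \<open>k \<in> D\<close>] division_ofD(4)[OF D(1) \<open>k \<in> D\<close>] by fastforce
      have k: "k \<subseteq> {a..b}" using that D(2) by auto
      then have uv': "a \<le> u" "v \<le> b" using uv by auto
      have ih: "h n integrable_on k" and i1: "\<phi> integrable_on k" and i2: "(\<lambda>x. norm (f x)) integrable_on k" and i3: "f integrable_on k"
        using h[of n] \<phi>(1) nf f k unfolding uv by (auto simp: absolutely_integrable_on_def intro: integrable_subinterval_real)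
      have fi: "f integrable_on {a..v}" using f uv' by (auto simp: absolutely_integrable_on_def intro: integrable_subinterval_real)
      have "F (Sup k) - F (Inf k) = integral k f"
        using Henstock_Kurzweil_Integration.integral_combine[of a u v f] fi uv uv' F[of u] F[of v] by (simp add: algebra_simps)
      also have "norm \<dots> \<le> integral k (\<lambda>x. norm (f x))" using i3 i2 by (intro integral_norm_bound_integral) auto
      also have "\<dots> = integral k \<phi> + integral k (h n)"
        using integral_add[OF i1 ih] by (simp add: \<phi>_def)
      also have "integral k (h n) \<le> integral k (\<lambda>x. real n)"
        by (rule integral_le[OF ih]) (auto simp: uv h_def)
      finally show ?thesis using uv by (simp add: mult.commute)
    qed
    have "(\<Sum>k\<in>D. norm (F (Sup k) - F (Inf k))) \<le> (\<Sum>k\<in>D. integral k \<phi>) + real n * (\<Sum>k\<in>D. Sup k - Inf k)"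
      using sum_mono[OF one, of D] by (simp add: sum.distrib sum_distrib_left)
    also have "(\<Sum>k\<in>D. integral k \<phi>) = integral (\<Union>D) \<phi>"
    proof (rule integral_combine_division_bottomup[OF D(1), symmetric])
      fix k assume k: "k \<in> D"
      then obtain u v where uv: "k = {u..v}" using division_ofD(4)[OF D(1) k] by fastforce
      have "{u..v} \<subseteq> {a..b}" using k D(2) unfolding uv by blast
      then show "\<phi> integrable_on k" unfolding uv by (rule integrable_subinterval_real[OF \<phi>(1)])
    qed
    also have "\<dots> \<le> integral {a..b} \<phi>"
    proof (rule integral_subset_le[OF D(2)])
      show "\<phi> integrable_on \<Union>D"
        using integrable_on_subdivision[OF D(1) \<phi>(1) D(2)] .
    qed (use \<phi> in auto)
    finally have "(\<Sum>k\<in>D. norm (F (Sup k) - F (Inf k))) \<le> integral {a..b} \<phi> + real n * (\<Sum>k\<in>D. Sup k - Inf k)" by simp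
    moreover have "real n * (\<Sum>k\<in>D. Sup k - Inf k) \<le> real n * \<delta>" using D(3) by (intro mult_left_mono) auto
    moreover have "real n * \<delta> \<le> e / 2" using e by (simp add: \<delta>_def field_simps)
    ultimately show ?thesis using i\<phi> by linarith
  qed
  ultimately show "\<exists>\<delta>>0. small_variation F a b \<delta> e" by blast
qed

text \<open>
  F is absolutely continuous with almost everywhere derivative f, in integrated form. This is
  the form in which all differential equations below are stated.
\<close>

definition is_primitive :: "real \<Rightarrow> real \<Rightarrow> (real \<Rightarrow> complex) \<Rightarrow> (real \<Rightarrow> complex) \<Rightarrow> bool" where
  "is_primitive a b F f \<longleftrightarrow> f absolutely_integrable_on {a..b} \<and> (\<forall>x\<in>{a..b}. F x = F a + integral {a..x} f)"

lemma is_primitive_eq: "is_primitive a b F f \<Longrightarrow> x \<in> {a..b} \<Longrightarrow> F x = F a + integral {a..x} f"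
  unfolding is_primitive_def by blast

lemma is_primitive_integrable: "is_primitive a b F f \<Longrightarrow> f absolutely_integrable_on {a..b}"
  unfolding is_primitive_def by blast

lemma is_primitive_continuous:
  assumes "is_primitive a b F f"
  shows "continuous_on {a..b} F"
proof -
  have "continuous_on {a..b} (\<lambda>x. F a + integral {a..x} f)"
    using is_primitive_integrable[OF assms]
    by (intro continuous_intros indefinite_integral_continuous_1) (auto simp: absolutely_integrable_on_def)
  moreover have "\<And>x. x \<in> {a..b} \<Longrightarrow> F a + integral {a..x} f = F x" using is_primitive_eq[OF assms] by metis
  ultimately show ?thesis by (rule continuous_on_eq)
qed

lemma is_primitive_AC: "is_primitive a b F f \<Longrightarrow> absolutely_continuous_on_interval a b F"
  by (rule absolutely_continuous_indefinite_integral[where f=f and a=a and b=b and F=F and c="F a"]) (auto intro: is_primitive_integrable is_primitive_eq)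

lemma is_primitive_deriv:
  assumes "is_primitive a b F f"
  shows "negligible {x\<in>{a..b}. \<not> (F has_vector_derivative f x) (at x within {a..b})}"
proof (rule negligible_subset[OF negligible_not_deriv_indefinite_integral[where f=f and a=a and b=b]])
  show "f integrable_on {a..b}" using is_primitive_integrable[OF assms] by (auto simp: absolutely_integrable_on_def)
  show "{x\<in>{a..b}. \<not> (F has_vector_derivative f x) (at x within {a..b})} \<subseteq>
    {x\<in>{a..b}. \<not> ((\<lambda>x. integral {a..x} f) has_vector_derivative f x) (at x within {a..b})}"
  proof -
    have "(F has_vector_derivative f x) (at x within {a..b})" if x: "x \<in> {a..b}" "((\<lambda>x. integral {a..x} f) has_vector_derivative f x) (at x within {a..b})" for x
    proof -
      have "((\<lambda>x. F a + integral {a..x} f) has_vector_derivative f x) (at x within {a..b})"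
      using x(2) by (auto intro!: derivative_eq_intros)
      then show ?thesis
        by (rule has_vector_derivative_transform[OF x(1), rotated]) (use is_primitive_eq[OF assms] in metis)
    qed
    then show ?thesis by blast
  qed
qed

lemma absolutely_continuous_subinterval:
  assumes "absolutely_continuous_on_interval a b F" "a \<le> c" "d \<le> b"
  shows "absolutely_continuous_on_interval c d F"
proof -
  have "{c..d} \<subseteq> {a..b}" using assms by auto
  then have *: "\<Union>D \<subseteq> {a..b}" if "\<Union>D \<subseteq> {c..d}" for D using that by (rule order_trans[rotated])
  show ?thesis
    unfolding absolutely_continuous_on_interval_def
  proof (intro allI impI)
    fix e :: real assume "e > 0"
    from assms(1) this obtain \<delta> where \<delta>: "\<delta> > 0" "small_variation F a b \<delta> e"
      by (rule absolutely_continuousE)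
    show "\<exists>\<delta>>0. small_variation F c d \<delta> e"
      using \<delta> * by (intro exI[of _ \<delta>] conjI allI impI) simp_all
  qed
qed

text \<open>
  The converse of \<open>is_primitive_AC\<close> and \<open>is_primitive_deriv\<close>: this turns membership in the
  domain of L into an integral equation.
\<close>

lemma is_primitiveI:
  assumes "f absolutely_integrable_on {a..b}" "absolutely_continuous_on_interval a b F"
    and N: "negligible {x\<in>{a..b}. \<not> (F has_vector_derivative f x) (at x within {a..b})}"
  shows "is_primitive a b F f"
  unfolding is_primitive_def
proof (intro conjI ballI assms(1))
  fix x assume x: "x \<in> {a..b}"
  have "(f has_integral (F x - F a)) {a..x}"
  proof (rule has_integral_of_absolutely_continuous)
    show "absolutely_continuous_on_interval a x F" using assms(2) x by (auto intro: absolutely_continuous_subinterval)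
    show "negligible {t\<in>{a..x}. \<not> (F has_vector_derivative f t) (at t within {a..x})}"
      by (rule negligible_subset[OF N]) (use x in \<open>auto intro: has_vector_derivative_within_subset\<close>)
  qed (use x in auto)
  then show "F x = F a + integral {a..x} f" by (simp add: integral_unique)
qed

lemma absolutely_integrable_mult_continuous:
  fixes f G :: "real \<Rightarrow> complex"
  assumes f: "f absolutely_integrable_on {a..b}" and G: "continuous_on {a..b} G"
  shows "(\<lambda>x. f x * G x) absolutely_integrable_on {a..b}"
proof -
  have "(\<lambda>x. G x * f x) absolutely_integrable_on {a..b}"
  proof (rule absolutely_integrable_bounded_measurable_product[where h="(*)", OF bilinear_times _ _ _ f])
    show "G \<in> borel_measurable (lebesgue_on {a..b})"
      by (rule continuous_imp_measurable_on_sets_lebesgue[OF G]) simp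
    show "bounded (G ` {a..b})" by (intro compact_imp_bounded compact_continuous_image G) simp
  qed simp
  then show ?thesis by (simp add: mult.commute)
qed

text \<open>
  The product rule; with exponentials as second factor it solves linear first-order equations
  whose right-hand side is merely integrable.
\<close>

lemma is_primitive_mult:
  assumes F: "is_primitive a b F f"
    and G: "\<And>x. x \<in> {a..b} \<Longrightarrow> (G has_vector_derivative G' x) (at x within {a..b})" 
    and G': "continuous_on {a..b} G'"
  shows "is_primitive a b (\<lambda>x. F x * G x) (\<lambda>x. f x * G x + F x * G' x)"
proof (rule is_primitiveI)
  have cF: "continuous_on {a..b} F" using is_primitive_continuous[OF F] .
  have cG: "continuous_on {a..b} G"
    using G by (intro continuous_on_vector_derivative) auto
  have fi: "f absolutely_integrable_on {a..b}" using is_primitive_integrable[OF F] .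
  have "(\<lambda>x. f x * G x) absolutely_integrable_on {a..b}" by (rule absolutely_integrable_mult_continuous[OF fi cG])
  moreover have "(\<lambda>x. F x * G' x) absolutely_integrable_on {a..b}"
    using cF G' by (intro absolutely_integrable_continuous_real continuous_intros)
  ultimately show "(\<lambda>x. f x * G x + F x * G' x) absolutely_integrable_on {a..b}"
    by (simp add: mult.commute set_integral_add)
  show "negligible {x\<in>{a..b}. \<not> ((\<lambda>x. F x * G x) has_vector_derivative (f x * G x + F x * G' x)) (at x within {a..b})}"
    by (rule negligible_subset[OF is_primitive_deriv[OF F]])
      (auto intro!: derivative_eq_intros G)
  obtain B where B: "B > 0" "\<And>x. x \<in> {a..b} \<Longrightarrow> norm (F x) \<le> B"
    using compact_imp_bounded[OF compact_continuous_image[OF cF compact_Icc]] by (force simp: bounded_pos)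
  obtain B' where B': "B' > 0" "\<And>x. x \<in> {a..b} \<Longrightarrow> norm (G x) \<le> B'"
    using compact_imp_bounded[OF compact_continuous_image[OF cG compact_Icc]] by (force simp: bounded_pos)
  obtain K where K: "K > 0" "\<And>x. x \<in> {a..b} \<Longrightarrow> norm (G' x) \<le> K"
    using compact_imp_bounded[OF compact_continuous_image[OF G' compact_Icc]] by (force simp: bounded_pos)
  have Lip: "norm (G v - G u) \<le> K * (v - u)" if "a \<le> u" "u \<le> v" "v \<le> b" for u v
  proof -
    have "(G' has_integral (G v - G u)) {u..v}"
      using that by (intro fundamental_theorem_of_calculus has_vector_derivative_within_subset[OF G]) auto
    then have "norm (G v - G u) \<le> K * measure lborel {u..v}"
      using K that by (intro has_integral_bound_real[where S="{}"]) auto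
    then show ?thesis using that by simp
  qed
  show "absolutely_continuous_on_interval a b (\<lambda>x. F x * G x)"
    unfolding absolutely_continuous_on_interval_def
  proof (intro allI impI)
    fix e :: real assume e: "e > 0"
    have "e / (2 * B') > 0" using e B' by simp
    from is_primitive_AC[OF F] this obtain \<delta> where \<delta>: "\<delta> > 0" "small_variation F a b \<delta> (e / (2 * B'))"
      by (rule absolutely_continuousE)
    define \<delta>' where "\<delta>' = min \<delta> (e / (2 * B * K))"
    have "\<delta>' > 0" using \<delta> e B K by (simp add: \<delta>'_def)
    moreover have "(\<Sum>k\<in>D. norm (F (Sup k) * G (Sup k) - F (Inf k) * G (Inf k))) < e"
      if D: "D division_of \<Union>D" "\<Union>D \<subseteq> {a..b}" "(\<Sum>k\<in>D. Sup k - Inf k) < \<delta>'" for D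
    proof -
      have one: "norm (F (Sup k) * G (Sup k) - F (Inf k) * G (Inf k)) \<le> B' * norm (F (Sup k) - F (Inf k)) + B * K * (Sup k - Inf k)" if "k \<in> D" for k
      proof -
        obtain u v where uv: "k = {u..v}" "u \<le> v" using division_ofD(3)[OF D(1) \<open>k \<in> D\<close>] division_ofD(4)[OF D(1) \<open>k \<in> D\<close>] by fastforce
        have k: "k \<subseteq> {a..b}" using that D(2) by auto
        then have uv': "a \<le> u" "v \<le> b" using uv by auto
        have "F v * G v - F u * G u = (F v - F u) * G v + F u * (G v - G u)" by (simp add: algebra_simps)
        then have "norm (F v * G v - F u * G u) \<le> norm (F v - F u) * norm (G v) + norm (F u) * norm (G v - G u)"
          by (metis norm_mult norm_triangle_ineq)
        also have "\<dots> \<le> norm (F v - F u) * B' + B * (K * (v - u))"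
          using B B' Lip uv uv' by (intro add_mono mult_mono) auto
        finally show ?thesis using uv by (simp add: algebra_simps)
      qed
      have "(\<Sum>k\<in>D. norm (F (Sup k) * G (Sup k) - F (Inf k) * G (Inf k))) \<le> B' * (\<Sum>k\<in>D. norm (F (Sup k) - F (Inf k))) + B * K * (\<Sum>k\<in>D. Sup k - Inf k)"
        using sum_mono[OF one, of D] by (simp add: sum.distrib sum_distrib_left)
      moreover have "B' * (\<Sum>k\<in>D. norm (F (Sup k) - F (Inf k))) < B' * (e / (2 * B'))"
        using D \<delta>(2)[rule_format, of D] B' by (intro mult_strict_left_mono) (auto simp: \<delta>'_def)
      moreover have "B * K * (\<Sum>k\<in>D. Sup k - Inf k) \<le> B * K * (e / (2 * B * K))"
        using D B K by (intro mult_left_mono) (auto simp: \<delta>'_def)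
      ultimately show ?thesis using B B' K by (simp add: field_simps)
    qed
    ultimately show "\<exists>\<delta>>0. \<forall>D. D division_of \<Union>D \<and> \<Union>D \<subseteq> {a..b} \<and> (\<Sum>k\<in>D. Sup k - Inf k) < \<delta> \<longrightarrow>
        (\<Sum>k\<in>D. norm (F (Sup k) * G (Sup k) - F (Inf k) * G (Inf k))) < e"
      by (intro exI[of _ \<delta>'] conjI allI impI) simp_all
  qed
qed

lemma is_primitive_add:
  assumes "is_primitive a b F f" "is_primitive a b G g"
  shows "is_primitive a b (\<lambda>x. F x + G x) (\<lambda>x. f x + g x)"
  unfolding is_primitive_def
proof (intro conjI ballI)
  show "(\<lambda>x. f x + g x) absolutely_integrable_on {a..b}" using assms[THEN is_primitive_integrable] by simp
  fix x assume x: "x \<in> {a..b}"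
  have "f integrable_on {a..x}" "g integrable_on {a..x}"
    using assms[THEN is_primitive_integrable] x by (auto simp: absolutely_integrable_on_def intro: integrable_subinterval_real)
  then have "integral {a..x} (\<lambda>x. f x + g x) = integral {a..x} f + integral {a..x} g" by (rule integral_add)
  then show "F x + G x = F a + G a + integral {a..x} (\<lambda>x. f x + g x)"
    using is_primitive_eq[OF assms(1) x] is_primitive_eq[OF assms(2) x] by (metis add.assoc add.left_commute)
qed

lemma is_primitive_cmult:
  assumes "is_primitive a b F f"
  shows "is_primitive a b (\<lambda>x. c * F x) (\<lambda>x. c * f x)"
  unfolding is_primitive_def
proof (intro conjI ballI)
  show "(\<lambda>x. c * f x) absolutely_integrable_on {a..b}" using is_primitive_integrable[OF assms] by simp
  fix x assume x: "x \<in> {a..b}"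
  show "c * F x = c * F a + integral {a..x} (\<lambda>x. c * f x)" 
    unfolding integral_mult_right distrib_left[symmetric] using is_primitive_eq[OF assms x] by simp
qed

lemma is_primitive_cong:
  assumes "is_primitive a b F f" "\<And>x. x \<in> {a..b} \<Longrightarrow> F x = G x" "\<And>x. x \<in> {a..b} \<Longrightarrow> f x = g x"
  shows "is_primitive a b G g"
  unfolding is_primitive_def
proof (intro conjI ballI)
  show "g absolutely_integrable_on {a..b}" 
    using is_primitive_integrable[OF assms(1)] assms(3) set_integrable_cong[of lebesgue lebesgue "{a..b}" "{a..b}" f g] by simp
  fix x assume x: "x \<in> {a..b}"
  have "integral {a..x} g = integral {a..x} f" using assms(3) x by (intro integral_cong) auto
  moreover have "a \<in> {a..b}" using x by auto
  ultimately show "G x = G a + integral {a..x} g" using assms(2) x is_primitive_eq[OF assms(1) x] by metis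
qed

lemma integrable_mult_continuous:
  fixes f G :: "real \<Rightarrow> complex"
  assumes f: "f absolutely_integrable_on {a..b}" and G: "continuous_on {a..b} G" and uv: "a \<le> u" "v \<le> b"
  shows "(\<lambda>t. f t * G t) integrable_on {u..v}"
proof -
  have "(\<lambda>t. f t * G t) integrable_on {a..b}"
    using absolutely_integrable_mult_continuous[OF f G] by (simp add: absolutely_integrable_on_def)
  then show ?thesis by (rule integrable_subinterval_real) (use uv in auto)
qed

section \<open>The initial value problem with integrable coefficients\<close>

abbreviation L1 :: "(real \<Rightarrow> 'a::{banach, second_countable_topology}) \<Rightarrow> bool" where
  "L1 f \<equiv> f absolutely_integrable_on {0..pi}"

definition L1norm :: "(real \<Rightarrow> complex) \<Rightarrow> real" where
  "L1norm f = integral {0..pi} (\<lambda>x. norm (f x))"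

lemma absolutely_integrable_norm_integrable:
  fixes f :: "real \<Rightarrow> complex"
  shows "f absolutely_integrable_on {a..b} \<Longrightarrow> a \<le> u \<Longrightarrow> v \<le> b \<Longrightarrow> (\<lambda>x. norm (f x)) integrable_on {u..v}"
  by (auto simp: absolutely_integrable_on_def intro: integrable_subinterval_real)

lemma L1norm_nonneg: "0 \<le> L1norm f"
  unfolding L1norm_def by (cases "(\<lambda>x. norm (f x)) integrable_on {0..pi}") (auto intro: integral_nonneg simp: not_integrable_integral)

lemma integral_norm_le_L1norm:
  assumes "L1 f" "0 \<le> u" "v \<le> pi"
  shows "integral {u..v} (\<lambda>x. norm (f x)) \<le> L1norm f"
  unfolding L1norm_def using assms
  by (intro integral_subset_le absolutely_integrable_norm_integrable[OF assms(1)]) auto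

lemma norm_integral_mult_le:
  fixes G :: "real \<Rightarrow> complex"
  assumes f: "L1 f" and uv: "0 \<le> u" "v \<le> pi"
    and G: "continuous_on {u..v} G" "\<And>t. t \<in> {u..v} \<Longrightarrow> norm (G t) \<le> B" "0 \<le> B"
  shows "norm (integral {u..v} (\<lambda>t. f t * G t)) \<le> B * L1norm f"
proof -
  have fu: "f absolutely_integrable_on {u..v}" using f uv by (auto intro: absolutely_integrable_on_subinterval)
  have "norm (integral {u..v} (\<lambda>t. f t * G t)) \<le> integral {u..v} (\<lambda>t. B * norm (f t))"
  proof (rule integral_norm_bound_integral)
    show "(\<lambda>t. f t * G t) integrable_on {u..v}" using absolutely_integrable_mult_continuous[OF fu G(1)] by (simp add: absolutely_integrable_on_def)
    show "(\<lambda>t. B * norm (f t)) integrable_on {u..v}"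
      using absolutely_integrable_norm_integrable[OF fu, of u v] by (intro integrable_on_mult_right) auto
    show "norm (f t * G t) \<le> B * norm (f t)" if "t \<in> {u..v}" for t
      using mult_right_mono[OF G(2)[OF that] norm_ge_zero[of "f t"]] by (simp add: norm_mult mult.commute)
  qed
  also have "\<dots> = B * integral {u..v} (\<lambda>t. norm (f t))" by simp
  also have "\<dots> \<le> B * L1norm f" using integral_norm_le_L1norm[OF f uv] G(3) by (rule mult_left_mono)
  finally show ?thesis .
qed

lemma L1norm_mult_le:
  assumes f: "L1 f"
    and G: "continuous_on {0..pi} G" "\<And>t. t \<in> {0..pi} \<Longrightarrow> norm (G t) \<le> B"
  shows "L1norm (\<lambda>t. f t * G t) \<le> B * L1norm f"
proof -
  have "L1norm (\<lambda>t. f t * G t) \<le> integral {0..pi} (\<lambda>t. B * norm (f t))"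
    unfolding L1norm_def
  proof (rule integral_le)
    show "(\<lambda>t. norm (f t * G t)) integrable_on {0..pi}" using absolutely_integrable_mult_continuous[OF f G(1)] by (simp add: absolutely_integrable_on_def)
    show "(\<lambda>t. B * norm (f t)) integrable_on {0..pi}"
      using absolutely_integrable_norm_integrable[OF f, of 0 pi] by (intro integrable_on_mult_right) auto
    show "norm (f t * G t) \<le> B * norm (f t)" if "t \<in> {0..pi}" for t
      using mult_right_mono[OF G(2)[OF that] norm_ge_zero[of "f t"]] by (simp add: norm_mult mult.commute)
  qed
  then show ?thesis by (simp add: L1norm_def)
qed

lemma L1norm_add_le:
  assumes f: "L1 f" "L1 g"
  shows "L1norm (\<lambda>t. f t + g t) \<le> L1norm f + L1norm g"
proof -
  have "L1 (\<lambda>t. f t + g t)" using assms by simp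
  note ii = absolutely_integrable_norm_integrable[OF this, of 0 pi] absolutely_integrable_norm_integrable[OF f(1), of 0 pi]
      absolutely_integrable_norm_integrable[OF f(2), of 0 pi]
  have "L1norm (\<lambda>t. f t + g t) \<le> integral {0..pi} (\<lambda>t. norm (f t) + norm (g t))"
    unfolding L1norm_def using ii by (intro integral_le integrable_add) (auto simp: norm_triangle_ineq)
  also have "\<dots> = L1norm f + L1norm g" unfolding L1norm_def using ii by (intro integral_add) auto
  finally show ?thesis .
qed

lemma L1norm_continuous_le:
  assumes "continuous_on {0..pi} y" "\<And>x. x \<in> {0..pi} \<Longrightarrow> norm (y x) \<le> B"
  shows "L1norm y \<le> pi * B"
proof -
  have "L1norm y \<le> integral {0..pi} (\<lambda>x. B)"
    unfolding L1norm_def using assms by (intro integral_le integrable_continuous_real continuous_intros) auto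
  then show ?thesis by simp
qed

text \<open>
  The equation \<open>y'' = q y + g\<close>, as a first-order system for y and its derivative y1.
\<close>

definition solves_ode :: "(real \<Rightarrow> complex) \<Rightarrow> (real \<Rightarrow> complex) \<Rightarrow> (real \<Rightarrow> complex) \<Rightarrow> (real \<Rightarrow> complex) \<Rightarrow> bool" where
  "solves_ode q g y y1 \<longleftrightarrow> is_primitive 0 pi y y1 \<and> is_primitive 0 pi y1 (\<lambda>x. q x * y x + g x)"

lemma solves_ode_continuous: "solves_ode q g y y1 \<Longrightarrow> continuous_on {0..pi} y" "solves_ode q g y y1 \<Longrightarrow> continuous_on {0..pi} y1"
  by (auto simp: solves_ode_def intro: is_primitive_continuous)

lemma solves_ode_add:
  assumes "solves_ode q g y y1" "solves_ode q h w w1"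
  shows "solves_ode q (\<lambda>x. g x + h x) (\<lambda>x. y x + w x) (\<lambda>x. y1 x + w1 x)"
proof -
  have "is_primitive 0 pi (\<lambda>x. y1 x + w1 x) (\<lambda>x. (q x * y x + g x) + (q x * w x + h x))"
    using assms unfolding solves_ode_def by (intro is_primitive_add) auto
  moreover have "(\<lambda>x. (q x * y x + g x) + (q x * w x + h x)) = (\<lambda>x. q x * (y x + w x) + (g x + h x))"
    by (auto simp: algebra_simps)
  ultimately show ?thesis using assms unfolding solves_ode_def by (auto intro: is_primitive_add)
qed

lemma solves_ode_cmult:
  assumes "solves_ode q g y y1"
  shows "solves_ode q (\<lambda>x. c * g x) (\<lambda>x. c * y x) (\<lambda>x. c * y1 x)"
proof -
  have "is_primitive 0 pi (\<lambda>x. c * y1 x) (\<lambda>x. c * (q x * y x + g x))"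
    using assms unfolding solves_ode_def by (intro is_primitive_cmult) auto
  moreover have "(\<lambda>x. c * (q x * y x + g x)) = (\<lambda>x. q x * (c * y x) + c * g x)"
    by (auto simp: algebra_simps)
  ultimately show ?thesis using assms unfolding solves_ode_def by (auto intro: is_primitive_cmult)
qed

lemma solves_ode_cong:
  assumes "solves_ode q g y y1" "\<And>x. x \<in> {0..pi} \<Longrightarrow> q x * y x + g x = p x * y x + h x"
  shows "solves_ode p h y y1"
  using assms unfolding solves_ode_def by (auto intro: is_primitive_cong)

text \<open>
  Twice integrating h is integration against the kernel \<open>x - t\<close>; by the product rule this needs
  no change of the order of integration.
\<close>

lemma volterra_primitive:
  assumes h: "L1 h"
  shows "is_primitive 0 pi (\<lambda>x. \<alpha> + \<beta> * of_real x + integral {0..x} (\<lambda>t. h t * of_real (x - t))) (\<lambda>x. \<beta> + integral {0..x} h)"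
    and "is_primitive 0 pi (\<lambda>x. \<beta> + integral {0..x} h) h"
proof -
  let ?H = "\<lambda>x. \<beta> + integral {0..x} h"
  show H: "is_primitive 0 pi ?H h" using h by (simp add: is_primitive_def)
  have P: "is_primitive 0 pi (\<lambda>x. ?H x * of_real x) (\<lambda>x. h x * of_real x + ?H x * 1)"
    by (rule is_primitive_mult[OF H]) (auto intro!: derivative_eq_intros continuous_intros simp: has_real_derivative_iff_has_vector_derivative)
  have cH: "continuous_on {0..pi} ?H" using is_primitive_continuous[OF H] .
  have eq: "\<alpha> + \<beta> * of_real x + integral {0..x} (\<lambda>t. h t * of_real (x - t)) = \<alpha> + integral {0..x} ?H"
    if x: "x \<in> {0..pi}" for x
  proof -
    have hx: "h absolutely_integrable_on {0..x}" using h x by (auto intro: absolutely_integrable_on_subinterval)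
    then have i1: "h integrable_on {0..x}" by (simp add: absolutely_integrable_on_def)
    have i2: "(\<lambda>t. h t * of_real t) integrable_on {0..x}"
      using absolutely_integrable_mult_continuous[OF hx, of of_real] by (auto simp: absolutely_integrable_on_def intro: continuous_intros)
    have i3: "?H integrable_on {0..x}" using cH x by (intro integrable_continuous_real) (auto intro: continuous_on_subset)
    have "?H x * of_real x = integral {0..x} (\<lambda>x. h x * of_real x + ?H x * 1)" using is_primitive_eq[OF P x] by simp
    also have "\<dots> = integral {0..x} (\<lambda>t. h t * of_real t) + integral {0..x} ?H"
      using integral_add[OF i2 i3] by simp
    finally have A: "?H x * of_real x = integral {0..x} (\<lambda>t. h t * of_real t) + integral {0..x} ?H" .
    have "integral {0..x} (\<lambda>t. h t * of_real (x - t)) = integral {0..x} (\<lambda>t. h t * of_real x - h t * of_real t)"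
      by (simp add: algebra_simps)
    also have "\<dots> = integral {0..x} h * of_real x - integral {0..x} (\<lambda>t. h t * of_real t)"
      using i1 i2 by (subst integral_diff) (auto intro: integrable_on_mult_left)
    finally have e: "integral {0..x} (\<lambda>t. h t * of_real (x - t)) = integral {0..x} h * of_real x - integral {0..x} (\<lambda>t. h t * of_real t)" .
    show ?thesis using A unfolding e distrib_right by (simp add: add_diff_eq)
  qed
  show "is_primitive 0 pi (\<lambda>x. \<alpha> + \<beta> * of_real x + integral {0..x} (\<lambda>t. h t * of_real (x - t))) ?H"
    unfolding is_primitive_def
  proof (intro conjI ballI)
    show "L1 ?H" using cH by (rule absolutely_integrable_continuous_real)
    show "\<alpha> + \<beta> * of_real x + integral {0..x} (\<lambda>t. h t * of_real (x - t)) = \<alpha> + \<beta> * of_real 0 + integral {0..0} (\<lambda>t. h t * of_real (0 - t)) + integral {0..x} ?H"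
      if "x \<in> {0..pi}" for x using eq[OF that] by simp
  qed
qed

lemma mult_exp_minus_le:
  fixes s k :: real assumes "k > 0"
  shows "s * exp (- k * s) \<le> 1 / k"
proof -
  have "k * s \<le> exp (k * s)" using exp_ge_add_one_self[of "k * s"] by linarith
  then have "k * s * exp (- (k * s)) \<le> 1" by (simp add: exp_minus field_simps)
  then show ?thesis using assms by (simp add: field_simps)
qed

text \<open>
  As the kernel \<open>x - t\<close> vanishes on the diagonal, the Volterra operator is a contraction in the
  norm \<open>sup (exp (- \<kappa> x) \<bar>y x\<bar>)\<close> for large \<open>\<kappa>\<close>: \<open>s exp (- \<kappa> s)\<close> is at most \<open>1 / \<kappa>\<close>, so its norm
  is at most \<open>\<parallel>q\<parallel>\<^sub>1 / \<kappa>\<close>. The constant K does not depend on g and the initial values, as is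
  required for operator bounds later.
\<close>

lemma ivp_exists:
  assumes q: "L1 q"
  shows "\<exists>K. \<forall>g \<alpha> \<beta>. L1 g \<longrightarrow> (\<exists>y y1. solves_ode q g y y1 \<and> y 0 = \<alpha> \<and> y1 0 = \<beta> \<and>
     (\<forall>x\<in>{0..pi}. norm (y x) \<le> K * (norm \<alpha> + norm \<beta> + L1norm g) \<and> norm (y1 x) \<le> K * (norm \<alpha> + norm \<beta> + L1norm g)))"
proof -
  \<comment> \<open>This makes the contraction constant at most 1/2.\<close>
  define \<kappa> where "\<kappa> = 2 * L1norm q + 1"
  have \<kappa>: "\<kappa> > 0" "L1norm q / \<kappa> \<le> 1 / 2" using L1norm_nonneg[of q] by (auto simp: \<kappa>_def field_simps)
  define K1 where "K1 = exp (\<kappa> * pi) * 8"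
  define K where "K = K1 + 1 + L1norm q * K1"
  have K1: "K1 \<ge> 0" by (simp add: K1_def)
  have K: "K \<ge> K1" "K \<ge> 1 + L1norm q * K1" using L1norm_nonneg[of q] K1 by (auto simp: K_def)
  define c where "c x = max 0 (min pi x)" for x :: real
  have cI: "c x \<in> {0..pi}" for x by (auto simp: c_def)
  have cid: "c x = x" if "x \<in> {0..pi}" for x using that by (auto simp: c_def)
  have cc: "continuous_on UNIV c" unfolding c_def by (intro continuous_intros)
  have "\<exists>y y1. solves_ode q g y y1 \<and> y 0 = \<alpha> \<and> y1 0 = \<beta> \<and>
     (\<forall>x\<in>{0..pi}. norm (y x) \<le> K * (norm \<alpha> + norm \<beta> + L1norm g) \<and> norm (y1 x) \<le> K * (norm \<alpha> + norm \<beta> + L1norm g))"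
    if g: "L1 g" for g \<alpha> \<beta>
  proof -
    \<comment> \<open>The unknown is \<open>U x = exp (- \<kappa> x) y x\<close>, extended to the whole line by clamping the argument.\<close>
    define h where "h U t = q t * (of_real (exp (\<kappa> * t)) * apply_bcontfun U t) + g t" for U :: "real \<Rightarrow>\<^sub>C complex" and t
    have cU: "continuous_on S (apply_bcontfun U)" for U :: "real \<Rightarrow>\<^sub>C complex" and S
      using apply_bcontfun[of U] by (auto simp: bcontfun_def intro: continuous_on_subset)
    have qU: "L1 (\<lambda>t. q t * (of_real (exp (\<kappa> * t)) * apply_bcontfun U t))" for U
      by (intro absolutely_integrable_mult_continuous q continuous_intros cU)
    have h: "L1 (h U)" for U
      unfolding h_def using qU[of U] g by (rule set_integral_add)
    define V where "V U x = \<alpha> + \<beta> * of_real x + integral {0..x} (\<lambda>t. h U t * of_real (x - t))" for U x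
    have cV: "continuous_on {0..pi} (V U)" for U
      using is_primitive_continuous[OF volterra_primitive(1)[OF h[of U], of \<alpha> \<beta>]] by (simp add: V_def)
    define T where "T U = Bcontfun (\<lambda>x. of_real (exp (- \<kappa> * c x)) * V U (c x))" for U
    have "(\<lambda>x. of_real (exp (- \<kappa> * c x)) * V U (c x)) \<in> bcontfun" for U
    proof -
      let ?W = "\<lambda>x. of_real (exp (- \<kappa> * x)) * V U x"
      have W: "continuous_on {0..pi} ?W" by (intro continuous_intros cV)
      have "continuous_on UNIV (\<lambda>x. ?W (c x))"
        by (rule continuous_on_compose2[OF W cc]) (use cI in auto)
      moreover have "bounded (range (\<lambda>x. ?W (c x)))"
        by (rule bounded_subset[OF compact_imp_bounded[OF compact_continuous_image[OF W compact_Icc]]]) (use cI in auto)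
      ultimately show ?thesis by (simp add: bcontfun_def)
    qed
    then have Tx: "apply_bcontfun (T U) x = of_real (exp (- \<kappa> * c x)) * V U (c x)" for U x
      by (simp add: T_def Bcontfun_inverse)
    have kern: "norm (integral {0..x} (\<lambda>t. q t * (of_real (exp (\<kappa> * t)) * w t) * of_real (x - t))) \<le> exp (\<kappa> * x) * (B / 2)"
      if x: "x \<in> {0..pi}" and w: "continuous_on {0..pi} w" "\<And>t. norm (w t) \<le> B" for x w B
    proof -
      have B: "B \<ge> 0" using w(2) norm_ge_zero order_trans by blast
      have "norm (integral {0..x} (\<lambda>t. q t * (of_real (exp (\<kappa> * t)) * w t * of_real (x - t)))) \<le> (exp (\<kappa> * x) * (B / \<kappa>)) * L1norm q"
      proof (rule norm_integral_mult_le[OF q])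
        show "continuous_on {0..x} (\<lambda>t. of_real (exp (\<kappa> * t)) * w t * of_real (x - t))"
          using x by (intro continuous_intros continuous_on_subset[OF w(1)]) auto
        fix t assume t: "t \<in> {0..x}"
        have "exp (\<kappa> * t) * (x - t) = exp (\<kappa> * x) * ((x - t) * exp (- \<kappa> * (x - t)))"
          by (simp add: exp_add[symmetric] mult.commute mult.left_commute) (simp add: algebra_simps)
        also have "\<dots> \<le> exp (\<kappa> * x) * (1 / \<kappa>)" using mult_exp_minus_le[OF \<kappa>(1)] by (intro mult_left_mono) auto
        finally have c1: "exp (\<kappa> * t) * (x - t) \<le> exp (\<kappa> * x) * (1 / \<kappa>)" .
        have "exp (\<kappa> * t) * (x - t) * norm (w t) \<le> exp (\<kappa> * x) * (1 / \<kappa>) * B"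
          by (rule mult_mono[OF c1 w(2)]) (use \<kappa> in auto)
        then show "norm (of_real (exp (\<kappa> * t)) * w t * of_real (x - t)) \<le> exp (\<kappa> * x) * (B / \<kappa>)"
          using t by (simp add: norm_mult mult_ac del: of_real_diff)
      qed (use x B \<kappa> in auto)
      also have "\<dots> = exp (\<kappa> * x) * (B * (L1norm q / \<kappa>))" by simp
      also have "\<dots> \<le> exp (\<kappa> * x) * (B * (1/2))" using \<kappa>(2) B by (intro mult_left_mono) auto
      finally show ?thesis by (simp add: mult.assoc)
    qed
    have hi: "(\<lambda>t. h U t * of_real (x - t)) integrable_on {0..x}" if "x \<in> {0..pi}" for U x
      using that by (intro integrable_mult_continuous[OF h[of U]] continuous_intros) auto
    have "dist (T U) (T W) \<le> 1/2 * dist U W" for U W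
    proof (rule dist_bound)
      fix x
      define s where "s = c x"
      have s: "s \<in> {0..pi}" using cI by (simp add: s_def)
      have "V U s - V W s = integral {0..s} (\<lambda>t. h U t * of_real (s - t) - h W t * of_real (s - t))"
        unfolding V_def using hi[OF s] by (simp add: integral_diff)
      also have "(\<lambda>t. h U t * of_real (s - t) - h W t * of_real (s - t)) = 
        (\<lambda>t. q t * (of_real (exp (\<kappa> * t)) * (apply_bcontfun U t - apply_bcontfun W t)) * of_real (s - t))"
        by (auto simp: h_def algebra_simps)
      finally have "norm (V U s - V W s) \<le> exp (\<kappa> * s) * (dist U W / 2)"
        using kern[OF s, of "\<lambda>t. apply_bcontfun U t - apply_bcontfun W t" "dist U W"] dist_bounded[of U _ W]
        by (auto simp: dist_norm intro!: continuous_intros cU)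
      then have "exp (- \<kappa> * s) * norm (V U s - V W s) \<le> exp (- \<kappa> * s) * (exp (\<kappa> * s) * (dist U W / 2))"
        by (intro mult_left_mono) auto
      also have "\<dots> = dist U W / 2" by (simp add: exp_minus field_simps)
      finally show "dist (apply_bcontfun (T U) x) (apply_bcontfun (T W) x) \<le> 1/2 * dist U W"
        unfolding Tx s_def[symmetric] dist_norm right_diff_distrib[symmetric] norm_mult by simp
    qed
    then obtain U where U: "T U = U"
      using banach_fix_type[of "1/2" T] by auto
    define y where "y x = of_real (exp (\<kappa> * x)) * apply_bcontfun U x" for x
    have yV: "y x = V U x" if x: "x \<in> {0..pi}" for x
    proof -
      have "apply_bcontfun U x = of_real (exp (- \<kappa> * x)) * V U x" using Tx[of U x] U cid[OF x] by simp
      moreover have "complex_of_real (exp (\<kappa> * x)) * of_real (exp (- \<kappa> * x)) = 1"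
        by (simp add: of_real_mult[symmetric] exp_add[symmetric] del: of_real_mult)
      ultimately show ?thesis unfolding y_def by (simp only: mult.assoc[symmetric]) simp
    qed
    have hy: "h U = (\<lambda>x. q x * y x + g x)" by (auto simp: h_def y_def)
    define y1 where "y1 x = \<beta> + integral {0..x} (h U)" for x
    have P1: "is_primitive 0 pi y y1"
      using volterra_primitive(1)[OF h[of U], of \<alpha> \<beta>] 
      by (rule is_primitive_cong) (use yV in \<open>auto simp: V_def y1_def\<close>)
    have P2: "is_primitive 0 pi y1 (h U)"
      using volterra_primitive(2)[OF h[of U], of \<beta>] unfolding y1_def .
    have sol: "solves_ode q g y y1" using P1 P2 unfolding solves_ode_def hy by simp
    have y0: "y 0 = \<alpha>" "y1 0 = \<beta>" using yV[of 0] by (auto simp: V_def y1_def)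
    define S where "S = norm \<alpha> + norm \<beta> + L1norm g"
    have S0: "S \<ge> 0" "L1norm g \<le> S" "norm \<beta> \<le> S" using L1norm_nonneg[of g] by (auto simp: S_def)
    have pi4: "pi < 4" using pi_less_4 .
    have Ubound: "norm (apply_bcontfun U x) \<le> 4 * S + norm U / 2" for x
    proof -
      define s where "s = c x"
      have s: "s \<in> {0..pi}" using cI by (simp add: s_def)
      have Ux: "apply_bcontfun U x = of_real (exp (- \<kappa> * s)) * V U s" using Tx[of U x] U by (simp add: s_def)
      have i1: "(\<lambda>t. q t * (of_real (exp (\<kappa> * t)) * apply_bcontfun U t) * of_real (s - t)) integrable_on {0..s}"
        using s by (intro integrable_mult_continuous[OF qU[of U]] continuous_intros) auto
      have i2: "(\<lambda>t. g t * of_real (s - t)) integrable_on {0..s}"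
        using s by (intro integrable_mult_continuous[OF g] continuous_intros) auto
      have "integral {0..s} (\<lambda>t. h U t * of_real (s - t)) = integral {0..s} (\<lambda>t. q t * (of_real (exp (\<kappa> * t)) * apply_bcontfun U t) * of_real (s - t) + g t * of_real (s - t))"
        by (simp add: h_def algebra_simps)
      also have "\<dots> = integral {0..s} (\<lambda>t. q t * (of_real (exp (\<kappa> * t)) * apply_bcontfun U t) * of_real (s - t)) + integral {0..s} (\<lambda>t. g t * of_real (s - t))"
        using i1 i2 by (rule integral_add)
      finally have VU: "V U s = (\<alpha> + \<beta> * of_real s + integral {0..s} (\<lambda>t. g t * of_real (s - t))) + integral {0..s} (\<lambda>t. q t * (of_real (exp (\<kappa> * t)) * apply_bcontfun U t) * of_real (s - t))"
        by (simp add: V_def)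
      have k: "norm (integral {0..s} (\<lambda>t. q t * (of_real (exp (\<kappa> * t)) * apply_bcontfun U t) * of_real (s - t))) \<le> exp (\<kappa> * s) * (norm U / 2)"
        by (rule kern[OF s cU norm_bounded])
      have g4: "norm (integral {0..s} (\<lambda>t. g t * of_real (s - t))) \<le> 4 * L1norm g"
        by (rule norm_integral_mult_le[OF g]) (use s pi4 in \<open>auto intro!: continuous_intros simp del: of_real_diff\<close>)
      have "norm (\<alpha> + \<beta> * of_real s + integral {0..s} (\<lambda>t. g t * of_real (s - t))) \<le> norm \<alpha> + norm \<beta> * 4 + 4 * L1norm g"
        using s pi4 g4 by (intro order_trans[OF norm_triangle_ineq] add_mono order_refl) (auto simp: norm_mult intro!: mult_left_mono)
      also have "\<dots> \<le> 4 * S" by (simp add: S_def)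
      finally have a: "norm (\<alpha> + \<beta> * of_real s + integral {0..s} (\<lambda>t. g t * of_real (s - t))) \<le> 4 * S" .
      have "norm (V U s) \<le> 4 * S + exp (\<kappa> * s) * (norm U / 2)"
        unfolding VU by (rule order_trans[OF norm_triangle_ineq add_mono[OF a k]])
      then have "exp (- \<kappa> * s) * norm (V U s) \<le> exp (- \<kappa> * s) * (4 * S + exp (\<kappa> * s) * (norm U / 2))"
        by (intro mult_left_mono) auto
      also have "\<dots> = exp (- \<kappa> * s) * (4 * S) + norm U / 2" by (simp add: exp_minus field_simps)
      also have "exp (- \<kappa> * s) * (4 * S) \<le> 1 * (4 * S)" using s \<kappa> S0 by (intro mult_right_mono) auto
      finally show ?thesis unfolding Ux by (simp add: norm_mult)
    qed
    have "norm U \<le> 4 * S + norm U / 2" by (rule norm_bound[OF Ubound])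
    then have U8: "norm (apply_bcontfun U x) \<le> 8 * S" for x using norm_bounded[of U x] by linarith
    have yb: "norm (y x) \<le> K1 * S" if "x \<in> {0..pi}" for x
    proof -
      have "exp (\<kappa> * x) * norm (apply_bcontfun U x) \<le> exp (\<kappa> * pi) * (8 * S)"
        using that \<kappa> U8 by (intro mult_mono) auto
      then show ?thesis by (simp add: y_def norm_mult K1_def)
    qed
    have y1b: "norm (y1 x) \<le> (1 + L1norm q * K1) * S" if x: "x \<in> {0..pi}" for x
    proof -
      have "norm (integral {0..x} (h U)) \<le> integral {0..x} (\<lambda>t. norm (h U t))"
        using absolutely_integrable_norm_integrable[OF h[of U], of 0 x] h[of U] x
        by (intro integral_norm_bound_integral) (auto simp: absolutely_integrable_on_def intro: integrable_subinterval_real)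
      also have "\<dots> \<le> L1norm (h U)" using x by (intro integral_norm_le_L1norm h) auto
      also have "\<dots> \<le> L1norm (\<lambda>t. q t * y t) + L1norm g"
        unfolding hy using L1norm_add_le[OF qU[of U] g] by (simp add: y_def)
      also have "L1norm (\<lambda>t. q t * y t) \<le> (K1 * S) * L1norm q"
        by (rule L1norm_mult_le[OF q is_primitive_continuous[OF P1] yb])
      finally have "norm (y1 x) \<le> norm \<beta> + (K1 * S * L1norm q + L1norm g)"
        unfolding y1_def by (intro order_trans[OF norm_triangle_ineq] add_mono) auto
      also have "\<dots> \<le> S + K1 * S * L1norm q" by (simp add: S_def)
      finally show ?thesis by (simp add: algebra_simps)
    qed
    have "norm (y x) \<le> K * S \<and> norm (y1 x) \<le> K * S" if x: "x \<in> {0..pi}" for x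
      using yb[OF x] y1b[OF x] mult_right_mono[OF K(1) S0(1)] mult_right_mono[OF K(2) S0(1)] by linarith
    then show ?thesis using sol y0 unfolding S_def by blast
  qed
  then show ?thesis by blast
qed

section \<open>The boundary value problem and the resolvent\<close>

lemma AE_M_pi_iff: "(AE x in lebesgue_on {0..pi}. P x) \<longleftrightarrow> negligible {x\<in>{0..pi}. \<not> P x}"
proof -
  have "(AE x in lebesgue_on {0..pi}. P x) \<longleftrightarrow> (AE x in lebesgue. x \<in> {0..pi} \<longrightarrow> P x)"
    by (rule AE_restrict_space_iff) simp
  also have "\<dots> \<longleftrightarrow> (\<exists>N. negligible N \<and> {x. \<not> (x \<in> {0..pi} \<longrightarrow> P x)} \<subseteq> N)"
    by (rule eventually_ae_filter_negligible)
  also have "{x. \<not> (x \<in> {0..pi} \<longrightarrow> P x)} = {x\<in>{0..pi}. \<not> P x}" by auto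
  also have "(\<exists>N. negligible N \<and> {x\<in>{0..pi}. \<not> P x} \<subseteq> N) \<longleftrightarrow> negligible {x\<in>{0..pi}. \<not> P x}"
    using negligible_subset by blast
  finally show ?thesis .
qed

lemma integrable_M_pi_iff:
  fixes f :: "real \<Rightarrow> 'a::{banach, second_countable_topology}"
  shows "integrable (lebesgue_on {0..pi}) f \<longleftrightarrow> L1 f"
  by (subst integrable_restrict_space) (simp_all add: set_integrable_def)

lemma Lp_iff: "f \<in> Lp a \<longleftrightarrow> f \<in> borel_measurable (lebesgue_on {0..pi}) \<and> L1 (\<lambda>x. norm (f x) powr a)"
  by (simp add: Lp_def integrable_M_pi_iff)

lemma Lp_absolutely_integrable:
  assumes "f \<in> Lp a" "1 \<le> a"
  shows "L1 f"
proof (rule measurable_bounded_by_integrable_imp_absolutely_integrable)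
  show "(\<lambda>x. 1 + norm (f x) powr a) integrable_on {0..pi}"
    using assms by (intro integrable_add) (auto simp: Lp_iff absolutely_integrable_on_def)
  show "norm (f x) \<le> 1 + norm (f x) powr a" for x
  proof (cases "norm (f x) \<le> 1")
    case False
    then have "norm (f x) powr 1 \<le> norm (f x) powr a" using assms(2) by (intro powr_mono) auto
    then show ?thesis using False by simp
  qed (use powr_ge_zero[of "norm (f x)" a] in linarith)
qed (use assms in \<open>auto simp: Lp_iff\<close>)

lemma Lp2_iff: "f \<in> Lp 2 \<longleftrightarrow> L1 f \<and> L1 (\<lambda>x. (norm (f x))\<^sup>2)"
proof -
  have eq: "(\<lambda>x. norm (f x) powr 2) = (\<lambda>x. (norm (f x))\<^sup>2)" by (intro ext) (simp add: powr_numeral)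
  have 1: "f \<in> Lp 2 \<Longrightarrow> L1 f" by (rule Lp_absolutely_integrable[where a=2]) simp_all
  have 2: "f \<in> borel_measurable (lebesgue_on {0..pi})" if "L1 f"
    using that by (rule absolutely_integrable_imp_borel_measurable) simp
  show ?thesis using 1 2 Lp_iff[of f 2] unfolding eq by blast
qed

lemma Lp2_spike:
  assumes "f \<in> Lp 2" "negligible {x\<in>{0..pi}. f x \<noteq> g x}"
  shows "g \<in> Lp 2"
proof -
  have f: "L1 f" "L1 (\<lambda>x. (norm (f x))\<^sup>2)"
    using assms(1) by (simp_all add: Lp2_iff)
  have "L1 g"
    by (rule absolutely_integrable_spike[OF f(1) assms(2)]) auto
  moreover have "L1 (\<lambda>x. (norm (g x))\<^sup>2)"
    by (rule absolutely_integrable_spike[OF f(2) assms(2)]) auto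
  ultimately show ?thesis by (simp add: Lp2_iff)
qed

lemma Lp2_diff:
  assumes f: "f \<in> Lp 2" and g: "g \<in> Lp 2"
  shows "(\<lambda>x. f x - g x) \<in> Lp 2"
proof -
  have fa: "L1 f" "L1 g" using f g by (simp_all add: Lp2_iff)
  have d: "L1 (\<lambda>x. f x - g x)" using set_integral_diff(1)[OF fa] .
  have "L1 (\<lambda>x. (norm (f x - g x))\<^sup>2)"
  proof (rule measurable_bounded_by_integrable_imp_absolutely_integrable)
    show "(\<lambda>x. (norm (f x - g x))\<^sup>2) \<in> borel_measurable (lebesgue_on {0..pi})"
      using absolutely_integrable_imp_borel_measurable[OF d] by measurable simp
    show "(\<lambda>x. 2 * (norm (f x))\<^sup>2 + 2 * (norm (g x))\<^sup>2) integrable_on {0..pi}"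
      using f g by (intro integrable_add integrable_on_mult_right) (auto simp: Lp2_iff absolutely_integrable_on_def)
    fix x
    have "(norm (f x - g x))\<^sup>2 \<le> (norm (f x) + norm (g x))\<^sup>2" by (intro power_mono norm_triangle_ineq4) auto
    also have "\<dots> \<le> 2 * (norm (f x))\<^sup>2 + 2 * (norm (g x))\<^sup>2"
      using sum_squares_bound[of "norm (f x)" "norm (g x)"] by (simp add: power2_sum)
    finally show "norm ((norm (f x - g x))\<^sup>2) \<le> 2 * (norm (f x))\<^sup>2 + 2 * (norm (g x))\<^sup>2" by simp
  qed simp
  then show ?thesis using d by (simp add: Lp2_iff)
qed

lemma continuous_Lp2:
  assumes "continuous_on {0..pi} y"
  shows "y \<in> Lp 2"
  unfolding Lp2_iff using assms by (intro conjI absolutely_integrable_continuous_real continuous_intros)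

text \<open>
  The boundary conditions are the vanishing of two linear forms in the boundary values of y and
  its derivative, which is what reduces the boundary value problem to a system of two linear
  equations.
\<close>

fun boundary_form1 :: "bc \<Rightarrow> (real \<Rightarrow> complex) \<Rightarrow> (real \<Rightarrow> complex) \<Rightarrow> complex" where
  "boundary_form1 Per_plus y y1 = y pi - y 0"
| "boundary_form1 Per_minus y y1 = y pi + y 0"
| "boundary_form1 Dir y y1 = y 0"

fun boundary_form2 :: "bc \<Rightarrow> (real \<Rightarrow> complex) \<Rightarrow> (real \<Rightarrow> complex) \<Rightarrow> complex" where
  "boundary_form2 Per_plus y y1 = y1 pi - y1 0"
| "boundary_form2 Per_minus y y1 = y1 pi + y1 0"
| "boundary_form2 Dir y y1 = y pi"

definition satisfies_bc :: "bc \<Rightarrow> (real \<Rightarrow> complex) \<Rightarrow> (real \<Rightarrow> complex) \<Rightarrow> bool" where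
  "satisfies_bc bc y y1 \<longleftrightarrow> boundary_form1 bc y y1 = 0 \<and> boundary_form2 bc y y1 = 0"

lemma boundary_form_add:
  "boundary_form1 bc (\<lambda>x. y x + w x) (\<lambda>x. y1 x + w1 x) = boundary_form1 bc y y1 + boundary_form1 bc w w1"
  "boundary_form2 bc (\<lambda>x. y x + w x) (\<lambda>x. y1 x + w1 x) = boundary_form2 bc y y1 + boundary_form2 bc w w1"
  by (cases bc; simp)+

lemma boundary_form_cmult:
  "boundary_form1 bc (\<lambda>x. c * y x) (\<lambda>x. c * y1 x) = c * boundary_form1 bc y y1"
  "boundary_form2 bc (\<lambda>x. c * y x) (\<lambda>x. c * y1 x) = c * boundary_form2 bc y y1"
  by (cases bc; simp add: algebra_simps)+

lemma boundary_form_bound: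
  assumes "\<And>x. x \<in> {0..pi} \<Longrightarrow> norm (y x) \<le> B \<and> norm (y1 x) \<le> B"
  shows "norm (boundary_form1 bc y y1) \<le> 2 * B" "norm (boundary_form2 bc y y1) \<le> 2 * B"
proof -
  have b: "norm (y 0) \<le> B" "norm (y pi) \<le> B" "norm (y1 0) \<le> B" "norm (y1 pi) \<le> B"
    using assms[of 0] assms[of pi] by auto
  have "B \<ge> 0" using b(1) norm_ge_zero order_trans by blast
  then show "norm (boundary_form1 bc y y1) \<le> 2 * B" "norm (boundary_form2 bc y y1) \<le> 2 * B"
    using b norm_triangle_ineq4[of "y pi" "y 0"] norm_triangle_ineq[of "y pi" "y 0"]
      norm_triangle_ineq4[of "y1 pi" "y1 0"] norm_triangle_ineq[of "y1 pi" "y1 0"]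
    by (cases bc; simp; fail)+
qed

definition solves_bvp :: "bc \<Rightarrow> (real \<Rightarrow> complex) \<Rightarrow> complex \<Rightarrow> (real \<Rightarrow> complex) \<Rightarrow> (real \<Rightarrow> complex) \<Rightarrow> (real \<Rightarrow> complex) \<Rightarrow> bool" where
  "solves_bvp bc v z f y y1 \<longleftrightarrow> solves_ode (\<lambda>x. v x - z) f y y1 \<and> satisfies_bc bc y y1"

text \<open>
  Defined by uniqueness for the integral equation; \<open>resolvent_set_iff\<close> identifies it with the
  complement of the eigenvalues.
\<close>

definition resolvent_set :: "bc \<Rightarrow> (real \<Rightarrow> complex) \<Rightarrow> complex set" where
  "resolvent_set bc v = {z. \<forall>y y1. solves_bvp bc v z (\<lambda>x. 0) y y1 \<longrightarrow> (\<forall>x\<in>{0..pi}. y x = 0)}"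

lemma solves_bvp_add: "solves_bvp bc v z f y y1 \<Longrightarrow> solves_bvp bc v z g w w1 \<Longrightarrow> solves_bvp bc v z (\<lambda>x. f x + g x) (\<lambda>x. y x + w x) (\<lambda>x. y1 x + w1 x)"
  by (simp add: solves_bvp_def satisfies_bc_def boundary_form_add solves_ode_add)

lemma solves_bvp_cmult: "solves_bvp bc v z f y y1 \<Longrightarrow> solves_bvp bc v z (\<lambda>x. c * f x) (\<lambda>x. c * y x) (\<lambda>x. c * y1 x)"
  by (simp add: solves_bvp_def satisfies_bc_def boundary_form_cmult solves_ode_cmult)

lemma solves_bvp_diff: "solves_bvp bc v z f y y1 \<Longrightarrow> solves_bvp bc v z g w w1 \<Longrightarrow> solves_bvp bc v z (\<lambda>x. f x - g x) (\<lambda>x. y x - w x) (\<lambda>x. y1 x - w1 x)"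
  using solves_bvp_add[of bc v z f y y1 "\<lambda>x. - 1 * g x" "\<lambda>x. - 1 * w x" "\<lambda>x. - 1 * w1 x"] solves_bvp_cmult[of bc v z g w w1 "-1"] by simp

lemma solves_bvp_continuous: "solves_bvp bc v z f y y1 \<Longrightarrow> continuous_on {0..pi} y"
  by (auto simp: solves_bvp_def dest: solves_ode_continuous)

text \<open>
  Moves terms between the potential, the spectral parameter and the right-hand side: the one
  algebraic fact behind all perturbation arguments.
\<close>

lemma solves_bvp_change:
  assumes "solves_bvp bc v z f y y1" "\<And>x. x \<in> {0..pi} \<Longrightarrow> (v x - z) * y x + f x = (u x - w) * y x + g x"
  shows "solves_bvp bc u w g y y1"
  using assms solves_ode_cong[of "\<lambda>x. v x - z" f y y1 "\<lambda>x. u x - w" g] by (simp add: solves_bvp_def)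

lemma solves_bvp_cong:
  assumes "solves_bvp bc v z f y y1" "\<And>x. x \<in> {0..pi} \<Longrightarrow> y x = w x" "\<And>x. x \<in> {0..pi} \<Longrightarrow> f x = g x"
  shows "solves_bvp bc v z g w y1"
proof -
  have "is_primitive 0 pi w y1" "is_primitive 0 pi y1 (\<lambda>x. (v x - z) * w x + g x)"
    using assms unfolding solves_bvp_def solves_ode_def by (auto elim: is_primitive_cong)
  moreover have "satisfies_bc bc w y1"
  proof -
    have "boundary_form1 bc w y1 = boundary_form1 bc y y1" "boundary_form2 bc w y1 = boundary_form2 bc y y1"
      using assms(2)[of 0] assms(2)[of pi] by (cases bc; simp)+
    then show ?thesis using assms(1) by (simp add: solves_bvp_def satisfies_bc_def)
  qed
  ultimately show ?thesis by (simp add: solves_bvp_def solves_ode_def)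
qed

lemma solves_bvp_unique:
  assumes "z \<in> resolvent_set bc v" "solves_bvp bc v z f y y1" "solves_bvp bc v z f w w1" "x \<in> {0..pi}"
  shows "y x = w x"
proof -
  have "solves_bvp bc v z (\<lambda>x. 0) (\<lambda>x. y x - w x) (\<lambda>x. y1 x - w1 x)" using solves_bvp_diff[OF assms(2,3)] by simp
  then have "y x - w x = 0" using assms(1,4) by (auto simp: resolvent_set_def)
  then show ?thesis by simp
qed

text \<open>
  The Fredholm alternative reduced to dimension two: the solution is a particular solution with
  zero initial values plus a combination of the fundamental system p, s. If the determinant of
  the boundary forms on p, s vanished, some combination of them would be an eigenfunction.
\<close>

lemma solves_bvp_exists:
  assumes v: "L1 v" and z: "z \<in> resolvent_set bc v"
  shows "\<exists>M\<ge>0. \<forall>f. L1 f \<longrightarrow> (\<exists>y y1. solves_bvp bc v z f y y1 \<and>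
     (\<forall>x\<in>{0..pi}. norm (y x) \<le> M * L1norm f \<and> norm (y1 x) \<le> M * L1norm f))"
proof -
  have q: "L1 (\<lambda>x. v x - z)"
    using v by (intro set_integral_diff) (auto intro: absolutely_integrable_continuous_real)
  have L0: "L1norm (\<lambda>x. 0) = 0" by (simp add: L1norm_def)
  obtain K where K: "\<And>g \<alpha> \<beta>. L1 g \<Longrightarrow> (\<exists>y y1. solves_ode (\<lambda>x. v x - z) g y y1 \<and> y 0 = \<alpha> \<and> y1 0 = \<beta> \<and>
     (\<forall>x\<in>{0..pi}. norm (y x) \<le> K * (norm \<alpha> + norm \<beta> + L1norm g) \<and> norm (y1 x) \<le> K * (norm \<alpha> + norm \<beta> + L1norm g)))"
    using ivp_exists[OF q] by blast
  obtain p p1 where p: "solves_ode (\<lambda>x. v x - z) (\<lambda>x. 0) p p1" "p 0 = 1" "p1 0 = 0"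
     and pb: "\<And>x. x\<in>{0..pi} \<Longrightarrow> norm (p x) \<le> K \<and> norm (p1 x) \<le> K"
    using K[of "\<lambda>x. 0" 1 0] L0 by auto
  obtain s s1 where s: "solves_ode (\<lambda>x. v x - z) (\<lambda>x. 0) s s1" "s 0 = 0" "s1 0 = 1"
     and sb: "\<And>x. x\<in>{0..pi} \<Longrightarrow> norm (s x) \<le> K \<and> norm (s1 x) \<le> K"
    using K[of "\<lambda>x. 0" 0 1] L0 by auto
  have K1: "K \<ge> 1" using pb[of 0] p by auto
  define a11 a12 a21 a22 where "a11 = boundary_form1 bc p p1" and "a12 = boundary_form1 bc s s1" and "a21 = boundary_form2 bc p p1" and "a22 = boundary_form2 bc s s1"
  define det where "det = a11 * a22 - a12 * a21"
  have comb: "solves_ode (\<lambda>x. v x - z) g (\<lambda>x. (c * p x + d * s x) + w x) (\<lambda>x. (c * p1 x + d * s1 x) + w1 x)"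
    if "solves_ode (\<lambda>x. v x - z) g w w1" for c d g w w1
    using solves_ode_add[OF solves_ode_add[OF solves_ode_cmult[OF p(1)] solves_ode_cmult[OF s(1)]] that] by simp
  have bf: "boundary_form1 bc (\<lambda>x. (c * p x + d * s x) + w x) (\<lambda>x. (c * p1 x + d * s1 x) + w1 x) = c * a11 + d * a12 + boundary_form1 bc w w1"
     "boundary_form2 bc (\<lambda>x. (c * p x + d * s x) + w x) (\<lambda>x. (c * p1 x + d * s1 x) + w1 x) = c * a21 + d * a22 + boundary_form2 bc w w1" for c d w w1
    unfolding boundary_form_add boundary_form_cmult a11_def a12_def a21_def a22_def by auto
  have triv: "c = 0 \<and> d = 0" if "c * a11 + d * a12 = 0" "c * a21 + d * a22 = 0" for c d
  proof -
    have z0: "solves_ode (\<lambda>x. v x - z) (\<lambda>x. 0) (\<lambda>x. 0) (\<lambda>x. 0)"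
      using solves_ode_cmult[OF p(1), of 0] by simp
    have sol: "solves_ode (\<lambda>x. v x - z) (\<lambda>x. 0) (\<lambda>x. c * p x + d * s x) (\<lambda>x. c * p1 x + d * s1 x)"
      using comb[OF z0, of c d] by simp
    moreover have b0: "boundary_form1 bc (\<lambda>x. 0) (\<lambda>x. 0) = 0" "boundary_form2 bc (\<lambda>x. 0) (\<lambda>x. 0) = 0" by (cases bc; simp)+
    have "satisfies_bc bc (\<lambda>x. c * p x + d * s x) (\<lambda>x. c * p1 x + d * s1 x)"
      using bf[of c d "\<lambda>x. 0" "\<lambda>x. 0"] that b0 by (simp add: satisfies_bc_def)
    ultimately have y0: "c * p x + d * s x = 0" if "x \<in> {0..pi}" for x
      using z that by (auto simp: resolvent_set_def solves_bvp_def)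
    then have "c = 0" using y0[of 0] p s by simp
    moreover have "d = 0"
    proof -
      have P: "is_primitive 0 pi (\<lambda>x. c * p x + d * s x) (\<lambda>x. c * p1 x + d * s1 x)" using sol by (simp add: solves_ode_def)
      have c1: "continuous_on {0..pi} (\<lambda>x. c * p1 x + d * s1 x)" using solves_ode_continuous(2)[OF sol] .
      have m: "0 \<in> {0..pi}" by simp
      have A: "((\<lambda>x. integral {0..x} (\<lambda>x. c * p1 x + d * s1 x)) has_vector_derivative c * p1 0 + d * s1 0) (at 0 within {0..pi})"
        using integral_has_vector_derivative[OF c1 m] .
      have i0: "integral {0..x} (\<lambda>x. c * p1 x + d * s1 x) = 0" if "x \<in> {0..pi}" for x
        using is_primitive_eq[OF P that] unfolding y0[OF that] y0[OF m] by simp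
      have z: "((\<lambda>x. 0::complex) has_vector_derivative 0) (at 0 within {0..pi})" by simp
      have B: "((\<lambda>x. integral {0..x} (\<lambda>x. c * p1 x + d * s1 x)) has_vector_derivative 0) (at 0 within {0..pi})"
        by (rule has_vector_derivative_transform[OF m _ z]) (rule i0)
      have "c * p1 0 + d * s1 0 = 0"
        using vector_derivative_within_closed_interval[OF pi_gt_zero m A] vector_derivative_within_closed_interval[OF pi_gt_zero m B] by simp
      then show ?thesis using p s by simp
    qed
    ultimately show ?thesis by simp
  qed
  have det: "det \<noteq> 0"
  proof
    assume d0: "det = 0"
    \<comment> \<open>A singular matrix has its adjugate columns in the kernel; if these vanish, the matrix is 0.\<close>
    have "a12 = 0 \<and> - a11 = 0" by (rule triv) (use d0 in \<open>simp_all add: det_def algebra_simps\<close>)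
    moreover have "a22 = 0 \<and> - a21 = 0" by (rule triv) (use d0 in \<open>simp_all add: det_def algebra_simps\<close>)
    ultimately show False using triv[of 1 0] by simp
  qed
  define M where "M = K + K * (2 * K * (norm a22 + norm a12) / norm det) + K * (2 * K * (norm a11 + norm a21) / norm det)"
  have M0: "M \<ge> 0" using K1 by (simp add: M_def)
  have "\<exists>y y1. solves_bvp bc v z f y y1 \<and> (\<forall>x\<in>{0..pi}. norm (y x) \<le> M * L1norm f \<and> norm (y1 x) \<le> M * L1norm f)"
    if f: "L1 f" for f
  proof -
    define n where "n = L1norm f"
    have n0: "n \<ge> 0" by (simp add: n_def L1norm_nonneg)
    obtain w w1 where w: "solves_ode (\<lambda>x. v x - z) f w w1" "\<And>x. x\<in>{0..pi} \<Longrightarrow> norm (w x) \<le> K * n \<and> norm (w1 x) \<le> K * n"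
      using K[OF f, of 0 0] by (auto simp: n_def)
    define b1 b2 where "b1 = boundary_form1 bc w w1" and "b2 = boundary_form2 bc w w1"
    have b: "norm b1 \<le> 2 * (K * n)" "norm b2 \<le> 2 * (K * n)" unfolding b1_def b2_def using boundary_form_bound[OF w(2)] by auto
    define c where "c = (b2 * a12 - b1 * a22) / det"
    define d where "d = (b1 * a21 - b2 * a11) / det"
    have "c * a11 + d * a12 + b1 = 0" "c * a21 + d * a22 + b2 = 0"
      using det by (simp_all add: c_def d_def field_simps) (simp_all add: det_def algebra_simps)
    then have sol: "solves_bvp bc v z f (\<lambda>x. (c * p x + d * s x) + w x) (\<lambda>x. (c * p1 x + d * s1 x) + w1 x)"
      unfolding solves_bvp_def satisfies_bc_def bf using comb[OF w(1)] by (simp add: b1_def b2_def)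
    have cb: "norm c \<le> (2 * K * (norm a22 + norm a12) / norm det) * n"
    proof -
      have "norm (b2 * a12 - b1 * a22) \<le> norm b2 * norm a12 + norm b1 * norm a22" by (metis norm_mult norm_triangle_ineq4)
      also have "\<dots> \<le> 2 * (K * n) * norm a12 + 2 * (K * n) * norm a22" using b by (intro add_mono mult_right_mono) auto
      finally show ?thesis using det by (simp add: c_def norm_divide divide_simps) (simp add: algebra_simps)
    qed
    have db: "norm d \<le> (2 * K * (norm a11 + norm a21) / norm det) * n"
    proof -
      have "norm (b1 * a21 - b2 * a11) \<le> norm b1 * norm a21 + norm b2 * norm a11" by (metis norm_mult norm_triangle_ineq4)
      also have "\<dots> \<le> 2 * (K * n) * norm a21 + 2 * (K * n) * norm a11" using b by (intro add_mono mult_right_mono) auto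
      finally show ?thesis using det by (simp add: d_def norm_divide divide_simps) (simp add: algebra_simps)
    qed
    have fin: "norm (c * P + d * S + W) \<le> M * n" if "norm P \<le> K" "norm S \<le> K" "norm W \<le> K * n" for P S W
    proof -
      have "norm (c * P + d * S + W) \<le> norm c * norm P + norm d * norm S + norm W"
        by (metis norm_mult norm_triangle_mono norm_triangle_ineq order_refl)
      also have "\<dots> \<le> (2 * K * (norm a22 + norm a12) / norm det) * n * K + (2 * K * (norm a11 + norm a21) / norm det) * n * K + K * n"
        using cb db that by (intro add_mono mult_mono) (auto intro: order_trans[OF norm_ge_zero])
      also have "\<dots> = M * n" by (simp add: M_def algebra_simps)
      finally show ?thesis .
    qed
    show ?thesis
      using sol fin pb sb w(2) unfolding n_def[symmetric] by (intro exI conjI ballI) auto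
  qed
  then show ?thesis using M0 by blast
qed

text \<open>
  The resolvent on all integrable right-hand sides. Like the operator resolvent it is set to 0
  outside the interval, so that the two agree as functions on square integrable arguments.
\<close>

definition weak_resolvent :: "bc \<Rightarrow> (real \<Rightarrow> complex) \<Rightarrow> complex \<Rightarrow> (real \<Rightarrow> complex) \<Rightarrow> real \<Rightarrow> complex" where
  "weak_resolvent bc v z f x = (if x \<in> {0..pi} then (SOME y. \<exists>y1. solves_bvp bc v z f y y1) x else 0)"

lemma weak_resolvent_eq:
  assumes "z \<in> resolvent_set bc v" "solves_bvp bc v z f y y1" "x \<in> {0..pi}"
  shows "weak_resolvent bc v z f x = y x"
proof -
  have "\<exists>y1. solves_bvp bc v z f (SOME y. \<exists>y1. solves_bvp bc v z f y y1) y1" using someI_ex[of "\<lambda>y. \<exists>y1. solves_bvp bc v z f y y1"] assms(2) by blast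
  then show ?thesis using solves_bvp_unique[OF assms(1) _ assms(2,3)] assms(3) by (auto simp: weak_resolvent_def)
qed

lemma weak_resolvent_is_sol:
  assumes v: "L1 v" and z: "z \<in> resolvent_set bc v" and f: "L1 f"
  shows "\<exists>y1. solves_bvp bc v z f (weak_resolvent bc v z f) y1"
proof -
  obtain y y1 where y: "solves_bvp bc v z f y y1" using solves_bvp_exists[OF v z] f by blast
  have "solves_bvp bc v z f (weak_resolvent bc v z f) y1" by (rule solves_bvp_cong[OF y]) (simp_all add: weak_resolvent_eq[OF z y])
  then show ?thesis by blast
qed

lemma weak_resolvent_bound:
  assumes v: "L1 v" and z: "z \<in> resolvent_set bc v"
  obtains M where "M \<ge> 0" "\<And>f x. L1 f \<Longrightarrow> norm (weak_resolvent bc v z f x) \<le> M * L1norm f"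
proof -
  obtain M where M: "M \<ge> 0" "\<And>f. L1 f \<Longrightarrow> (\<exists>y y1. solves_bvp bc v z f y y1 \<and>
     (\<forall>x\<in>{0..pi}. norm (y x) \<le> M * L1norm f \<and> norm (y1 x) \<le> M * L1norm f))"
    using solves_bvp_exists[OF v z] by blast
  have "norm (weak_resolvent bc v z f x) \<le> M * L1norm f" if f: "L1 f" for f x
  proof (cases "x \<in> {0..pi}")
    case True
    obtain y y1 where "solves_bvp bc v z f y y1" "\<And>x. x\<in>{0..pi} \<Longrightarrow> norm (y x) \<le> M * L1norm f" using M(2)[OF f] by blast
    then show ?thesis using weak_resolvent_eq[OF z _ True] True by metis
  qed (use M L1norm_nonneg[of f] in \<open>auto simp: weak_resolvent_def\<close>)
  then show thesis using M(1) that by blast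
qed

lemma weak_resolvent_continuous:
  assumes v: "L1 v" and z: "z \<in> resolvent_set bc v" and f: "L1 f"
  shows "continuous_on {0..pi} (weak_resolvent bc v z f)"
  using weak_resolvent_is_sol[OF assms] solves_bvp_continuous by blast

lemma weak_resolvent_add:
  assumes v: "L1 v" and z: "z \<in> resolvent_set bc v"
    and f: "L1 f" and g: "L1 g"
  shows "weak_resolvent bc v z (\<lambda>t. f t + g t) x = weak_resolvent bc v z f x + weak_resolvent bc v z g x"
proof (cases "x \<in> {0..pi}")
  case True
  obtain y1 w1 where "solves_bvp bc v z f (weak_resolvent bc v z f) y1" "solves_bvp bc v z g (weak_resolvent bc v z g) w1"
    using weak_resolvent_is_sol[OF v z f] weak_resolvent_is_sol[OF v z g] by blast
  then show ?thesis using weak_resolvent_eq[OF z solves_bvp_add True] by blast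
next
  case False
  then show ?thesis unfolding weak_resolvent_def by (simp only: if_False) simp
qed

lemma weak_resolvent_cmult:
  assumes v: "L1 v" and z: "z \<in> resolvent_set bc v" and f: "L1 f"
  shows "weak_resolvent bc v z (\<lambda>t. c * f t) x = c * weak_resolvent bc v z f x"
proof (cases "x \<in> {0..pi}")
  case True
  obtain y1 where "solves_bvp bc v z f (weak_resolvent bc v z f) y1" using weak_resolvent_is_sol[OF v z f] by blast
  then show ?thesis using weak_resolvent_eq[OF z solves_bvp_cmult True] by blast
next
  case False
  then show ?thesis unfolding weak_resolvent_def by (simp only: if_False) simp
qed

lemma differentiable_of_vector_derivative: "(f has_vector_derivative d) (at x within S) \<Longrightarrow> f differentiable (at x within S)"
  unfolding differentiable_def has_vector_derivative_def by blast

text \<open>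
  The Lebesgue differentiation theorem gives the second derivative almost everywhere, and square
  integrability of \<open>L y\<close> comes from \<open>L y = z y - f\<close> with y continuous.
\<close>

lemma solves_bvp_L_dom:
  assumes v: "L1 v" and sol: "solves_bvp bc v z f y y1" and f: "f \<in> Lp 2"
  shows "y \<in> L_dom bc v" and "AE x in M_pi. z * y x - L_op v y x = f x"
proof -
  have P: "is_primitive 0 pi y y1" and P1: "is_primitive 0 pi y1 (\<lambda>x. (v x - z) * y x + f x)"
    using sol by (auto simp: solves_bvp_def solves_ode_def)
  have cy: "continuous_on {0..pi} y" and cy1: "continuous_on {0..pi} y1"
    using is_primitive_continuous P P1 by auto
  have hy: "(y has_vector_derivative y1 x) (at x within {0..pi})" if x: "x \<in> {0..pi}" for x
  proof -
    have "((\<lambda>x. y 0 + integral {0..x} y1) has_vector_derivative y1 x) (at x within {0..pi})"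
      using integral_has_vector_derivative[OF cy1 x] by (auto intro!: derivative_eq_intros)
    then show ?thesis by (rule has_vector_derivative_transform[OF x, rotated]) (rule is_primitive_eq[OF P])
  qed
  have D: "D_pi y x = y1 x" if "x \<in> {0..pi}" for x
    unfolding D_pi_def by (rule vector_derivative_within_closed_interval[OF pi_gt_zero that hy[OF that]])
  have PD: "is_primitive 0 pi (D_pi y) (\<lambda>x. (v x - z) * y x + f x)"
    by (rule is_primitive_cong[OF P1]) (simp_all add: D)
  define N where "N = {x\<in>{0..pi}. \<not> (D_pi y has_vector_derivative ((v x - z) * y x + f x)) (at x within {0..pi})}"
  have N: "negligible N" unfolding N_def by (rule is_primitive_deriv[OF PD])
  have DD: "D_pi (D_pi y) x = (v x - z) * y x + f x" if "x \<in> {0..pi} - N" for x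
    unfolding D_pi_def[of "D_pi y"] 
    by (rule vector_derivative_within_closed_interval[OF pi_gt_zero]) (use that in \<open>auto simp: N_def\<close>)
  have Lv: "L_op v y x = z * y x - f x" if "x \<in> {0..pi} - N" for x
    using DD[OF that] by (simp add: L_op_def algebra_simps)
  have "negligible {x\<in>{0..pi}. \<not> (z * y x - L_op v y x = f x)}"
    by (rule negligible_subset[OF N]) (use Lv in \<open>force simp: algebra_simps\<close>)
  then show "AE x in M_pi. z * y x - L_op v y x = f x" by (simp add: AE_M_pi_iff)
  have "L_op v y \<in> Lp 2"
  proof (rule Lp2_spike)
    show "(\<lambda>x. z * y x - f x) \<in> Lp 2" by (intro Lp2_diff f continuous_Lp2 continuous_intros cy)
    show "negligible {x\<in>{0..pi}. z * y x - f x \<noteq> L_op v y x}" by (rule negligible_subset[OF N]) (use Lv in force)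
  qed
  moreover have "y differentiable_on {0..pi}"
    unfolding differentiable_on_def using hy differentiable_of_vector_derivative by blast
  moreover have "AE x in M_pi. D_pi y differentiable (at x within {0..pi})"
    unfolding AE_M_pi_iff by (rule negligible_subset[OF N]) (auto simp: N_def intro: differentiable_of_vector_derivative)
  moreover have "boundary_cond bc y"
    using sol D[of 0] D[of pi] by (cases bc) (auto simp: solves_bvp_def satisfies_bc_def eq_neg_iff_add_eq_0)
  ultimately show "y \<in> L_dom bc v"
    using is_primitive_AC[OF P] is_primitive_AC[OF PD] by (simp add: L_dom_def)
qed

text \<open>
  A differential equation that holds almost everywhere becomes an integral equation only through
  the absolute continuity of the derivative.
\<close>

lemma L_dom_solves_bvp:
  assumes v: "L1 v" and f: "L1 f"
    and y: "y \<in> L_dom bc v" and eq: "AE x in M_pi. z * y x - L_op v y x = f x"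
  shows "solves_bvp bc v z f y (D_pi y)"
proof -
  have hy: "(y has_vector_derivative D_pi y x) (at x within {0..pi})" if "x \<in> {0..pi}" for x
    using y that unfolding L_dom_def D_pi_def differentiable_on_def by (auto simp: vector_derivative_works)
  have cy: "continuous_on {0..pi} y" using hy by (intro continuous_on_vector_derivative) auto
  have AC: "absolutely_continuous_on_interval 0 pi y" "absolutely_continuous_on_interval 0 pi (D_pi y)"
    using y by (auto simp: L_dom_def)
  have g: "L1 (\<lambda>x. (v x - z) * y x + f x)"
  proof -
    have "L1 (\<lambda>x. v x - z)"
      using v by (intro set_integral_diff) (auto intro: absolutely_integrable_continuous_real)
    then show ?thesis using absolutely_integrable_mult_continuous[OF _ cy] f by (intro set_integral_add) auto
  qed
  define N1 where "N1 = {x\<in>{0..pi}. \<not> (D_pi y differentiable (at x within {0..pi}))}"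
  define N2 where "N2 = {x\<in>{0..pi}. \<not> (z * y x - L_op v y x = f x)}"
  have N: "negligible (N1 \<union> N2)" using y eq by (auto simp: L_dom_def AE_M_pi_iff N1_def N2_def)
  have P1: "is_primitive 0 pi (D_pi y) (\<lambda>x. (v x - z) * y x + f x)"
  proof (rule is_primitiveI[OF g AC(2)])
    have "(D_pi y has_vector_derivative ((v x - z) * y x + f x)) (at x within {0..pi})" if "x \<in> {0..pi}" "x \<notin> N1 \<union> N2" for x
    proof -
      have "(D_pi y has_vector_derivative D_pi (D_pi y) x) (at x within {0..pi})"
        using that unfolding D_pi_def[of "D_pi y"] by (auto simp: N1_def vector_derivative_works)
      moreover have "z * y x - L_op v y x = f x" using that by (auto simp: N2_def)
      then have "D_pi (D_pi y) x = (v x - z) * y x + f x" by (simp add: L_op_def algebra_simps)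
      ultimately show ?thesis by simp
    qed
    then show "negligible {x\<in>{0..pi}. \<not> (D_pi y has_vector_derivative ((v x - z) * y x + f x)) (at x within {0..pi})}"
      by (intro negligible_subset[OF N]) auto
  qed
  have cD: "continuous_on {0..pi} (D_pi y)" by (rule is_primitive_continuous[OF P1])
  have e: "{x\<in>{0..pi}. \<not> (y has_vector_derivative D_pi y x) (at x within {0..pi})} = {}" using hy by auto
  have P: "is_primitive 0 pi y (D_pi y)"
    by (rule is_primitiveI[OF absolutely_integrable_continuous_real[OF cD] AC(1)]) (simp only: e negligible_empty)
  have "satisfies_bc bc y (D_pi y)"
    using y by (cases bc) (auto simp: L_dom_def satisfies_bc_def)
  then show ?thesis using P P1 by (simp add: solves_bvp_def solves_ode_def)
qed

lemma resolvent_set_iff: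
  assumes v: "L1 v"
  shows "z \<in> resolvent_set bc v \<longleftrightarrow> \<not> L_eigenvalue bc v z"
proof
  assume z: "z \<in> resolvent_set bc v"
  show "\<not> L_eigenvalue bc v z"
  proof
    assume "L_eigenvalue bc v z"
    then obtain y where y: "y \<in> L_dom bc v" "\<not> (AE x in M_pi. y x = 0)" "AE x in M_pi. L_op v y x = z * y x"
      by (auto simp: L_eigenvalue_def)
    have "AE x in M_pi. z * y x - L_op v y x = 0" using y(3) by eventually_elim simp
    then have "solves_bvp bc v z (\<lambda>x. 0) y (D_pi y)" by (intro L_dom_solves_bvp v y) auto
    then have "\<forall>x\<in>{0..pi}. y x = 0" using z by (auto simp: resolvent_set_def)
    then have "AE x in M_pi. y x = 0" unfolding AE_M_pi_iff by (auto intro: negligible_subset[OF negligible_empty])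
    then show False using y(2) by simp
  qed
next
  assume nz: "\<not> L_eigenvalue bc v z"
  have "\<forall>x\<in>{0..pi}. y x = 0" if sol: "solves_bvp bc v z (\<lambda>x. 0) y y1" for y y1
  proof -
    have "(\<lambda>x. 0) \<in> Lp 2" by (intro continuous_Lp2 continuous_intros)
    note d = solves_bvp_L_dom[OF v sol this]
    have "AE x in M_pi. L_op v y x = z * y x" using d(2) by eventually_elim simp
    then have "AE x in M_pi. y x = 0" using nz d(1) unfolding L_eigenvalue_def by blast
    then have N: "negligible {x\<in>{0..pi}. y x \<noteq> 0}" by (simp add: AE_M_pi_iff)
    have "((\<lambda>x. norm (y x)) has_integral 0) (cbox 0 pi)"
      by (rule has_integral_spike[OF N _ has_integral_0]) auto
    then have "norm (y x) = 0" if "x \<in> {0..pi}" for x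
      by (rule has_integral_0_cbox_imp_0[rotated 2]) (use solves_bvp_continuous[OF sol] that pi_gt_zero in \<open>auto intro!: continuous_intros simp del: pi_gt_zero\<close>)
    then show ?thesis by simp
  qed
  then show "z \<in> resolvent_set bc v" by (auto simp: resolvent_set_def)
qed

lemma resolvent_eq_weak_resolvent:
  assumes v: "L1 v" and z: "z \<in> resolvent_set bc v" and f: "f \<in> Lp 2"
  shows "resolvent bc v z f = weak_resolvent bc v z f"
  unfolding resolvent_def
proof (rule the_equality)
  have fa: "L1 f" using f by (simp add: Lp2_iff)
  obtain y1 where s: "solves_bvp bc v z f (weak_resolvent bc v z f) y1" using weak_resolvent_is_sol[OF v z fa] by blast
  show "weak_resolvent bc v z f \<in> L_dom bc v \<and> (\<forall>x. x \<notin> {0..pi} \<longrightarrow> weak_resolvent bc v z f x = 0) \<and>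
    (AE x in M_pi. z * weak_resolvent bc v z f x - L_op v (weak_resolvent bc v z f) x = f x)"
    using solves_bvp_L_dom[OF v s f] by (simp add: weak_resolvent_def)
  fix y assume y: "y \<in> L_dom bc v \<and> (\<forall>x. x \<notin> {0..pi} \<longrightarrow> y x = 0) \<and> (AE x in M_pi. z * y x - L_op v y x = f x)"
  then have "solves_bvp bc v z f y (D_pi y)" by (intro L_dom_solves_bvp v fa) auto
  then show "y = weak_resolvent bc v z f"
    using y weak_resolvent_eq[OF z] by (intro ext) (metis weak_resolvent_def)
qed

section \<open>A priori estimate for the free equation\<close>

lemma first_order_solution:
  assumes q: "is_primitive 0 pi q (\<lambda>x. c * q x + g x)" and g: "L1 g" and x: "x \<in> {0..pi}"
  shows "q x * exp (- c * of_real x) = q 0 + integral {0..x} (\<lambda>t. g t * exp (- c * of_real t))"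
proof -
  have "is_primitive 0 pi (\<lambda>x. q x * exp (- c * of_real x)) (\<lambda>x. (c * q x + g x) * exp (- c * of_real x) + q x * (- c * exp (- c * of_real x)))"
    by (rule is_primitive_mult[OF q]) (auto intro!: derivative_eq_intros continuous_intros has_vector_derivative_real_field simp: field_simps)
  moreover have "(\<lambda>x. (c * q x + g x) * exp (- c * of_real x) + q x * (- c * exp (- c * of_real x))) = (\<lambda>t. g t * exp (- c * of_real t))"
    by (auto simp: algebra_simps)
  ultimately have "is_primitive 0 pi (\<lambda>x. q x * exp (- c * of_real x)) (\<lambda>t. g t * exp (- c * of_real t))" by simp
  from is_primitive_eq[OF this x] show ?thesis by simp
qed

lemma exp_average_integrable:
  fixes g :: "real \<Rightarrow> complex" and x :: real
  assumes g: "L1 g" and uv: "0 \<le> u" "v \<le> pi"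
  shows "(\<lambda>t. exp (- (\<tau> * \<bar>x - t\<bar>)) * norm (g t)) integrable_on {u..v}"
proof -
  have "continuous_on {0..pi} (\<lambda>t. complex_of_real (exp (- (\<tau> * \<bar>x - t\<bar>))))" by (intro continuous_intros)
  from absolutely_integrable_norm_integrable[OF absolutely_integrable_mult_continuous[OF g this] uv]
  show ?thesis by (rule integrable_eq) (simp add: norm_mult)
qed

lemma norm_integral_exp_le:
  assumes g: "L1 g" and uv: "0 \<le> u" "v \<le> pi"
    and c: "\<And>t. t \<in> {u..v} \<Longrightarrow> Re (c * of_real t + d) = - (\<tau> * \<bar>x - t\<bar>)"
  shows "norm (integral {u..v} (\<lambda>t. g t * exp (c * of_real t + d))) \<le> integral {0..pi} (\<lambda>t. exp (- (\<tau> * \<bar>x - t\<bar>)) * norm (g t))"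
proof -
  have cc: "continuous_on {0..pi} (\<lambda>t. exp (c * of_real t + d))" by (intro continuous_intros)
  have n: "norm (g t * exp (c * of_real t + d)) = exp (- (\<tau> * \<bar>x - t\<bar>)) * norm (g t)" if "t \<in> {u..v}" for t
    by (simp only: norm_mult norm_exp_eq_Re c[OF that] mult.commute)
  have "norm (integral {u..v} (\<lambda>t. g t * exp (c * of_real t + d))) \<le> integral {u..v} (\<lambda>t. exp (- (\<tau> * \<bar>x - t\<bar>)) * norm (g t))"
    by (rule integral_norm_bound_integral[OF integrable_mult_continuous[OF g cc uv] exp_average_integrable[OF g uv]]) (simp only: n)
  also have "\<dots> \<le> integral {0..pi} (\<lambda>t. exp (- (\<tau> * \<bar>x - t\<bar>)) * norm (g t))"
    using uv by (intro integral_subset_le exp_average_integrable[OF g]) auto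
  finally show ?thesis .
qed

text \<open>
  The averages in which the a priori estimate is expressed. For g in \<open>L\<^sup>a\<close> they are at most a
  multiple of \<open>\<tau> powr (- (1 - 1/a))\<close>, and this is how integrability enters the final exponent.
\<close>

definition exp_average_bound :: "real \<Rightarrow> (real \<Rightarrow> complex) \<Rightarrow> real \<Rightarrow> bool" where
  "exp_average_bound \<tau> g A \<longleftrightarrow> (\<forall>x\<in>{0..pi}. integral {0..pi} (\<lambda>t. exp (- (\<tau> * \<bar>x - t\<bar>)) * norm (g t)) \<le> A)"

text \<open>
  The square of \<open>\<mu>\<close> keeps a distance from the free eigenvalues of all three boundary conditions
  at once.
\<close>

definition well_separated :: "complex \<Rightarrow> bool" where
  "well_separated \<mu> \<longleftrightarrow> \<mu> \<noteq> 0 \<and> Im \<mu> \<ge> 0 \<and> norm (1 - exp (2 * of_real pi * \<i> * \<mu>)) \<ge> 1 / 2"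

text \<open>
  The factorization \<open>d\<^sup>2/dx\<^sup>2 + \<mu>\<^sup>2 = (d/dx - \<i> \<mu>) (d/dx + \<i> \<mu>)\<close> replaces the Green function.
  All three kinds of boundary conditions couple \<open>q 0\<close>, \<open>q pi\<close>, \<open>p 0\<close>, \<open>p pi\<close> so that \<open>q 0\<close> and
  \<open>p pi\<close> are determined after division by \<open>1 - e\<close>, \<open>1 + e\<close> or \<open>1 - e\<^sup>2\<close>, where
  \<open>e = exp (\<i> \<mu> pi)\<close> has modulus at most 1; a lower bound for \<open>1 - e\<^sup>2\<close> controls them all.
\<close>

lemma free_apriori_estimate:
  fixes \<mu> :: complex
  assumes well_separated: "well_separated \<mu>" and sol: "solves_bvp bc (\<lambda>x. 0) (\<mu>\<^sup>2) g u u1" and g: "L1 g"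
    and A: "exp_average_bound (Im \<mu>) g A" and x: "x \<in> {0..pi}"
  shows "norm (u x) \<le> 5 * A / norm \<mu>"
proof -
  have \<mu>: "\<mu> \<noteq> 0" "Im \<mu> \<ge> 0" "norm (1 - exp (2 * of_real pi * \<i> * \<mu>)) \<ge> 1 / 2" using well_separated by (auto simp: well_separated_def)
  have P: "is_primitive 0 pi u u1" and P1: "is_primitive 0 pi u1 (\<lambda>x. (0 - \<mu>\<^sup>2) * u x + g x)" and bc: "satisfies_bc bc u u1"
    using sol by (auto simp: solves_bvp_def solves_ode_def)
  define q where "q x = u1 x + \<i> * \<mu> * u x" for x
  define p where "p x = u1 x + (- \<i> * \<mu>) * u x" for x
  have "is_primitive 0 pi q (\<lambda>x. ((0 - \<mu>\<^sup>2) * u x + g x) + \<i> * \<mu> * u1 x)"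
    unfolding q_def by (intro is_primitive_add is_primitive_cmult P P1)
  then have Pq: "is_primitive 0 pi q (\<lambda>x. (\<i> * \<mu>) * q x + g x)"
    by (rule is_primitive_cong) (auto simp: q_def algebra_simps power2_eq_square)
  have "is_primitive 0 pi p (\<lambda>x. ((0 - \<mu>\<^sup>2) * u x + g x) + (- \<i> * \<mu>) * u1 x)"
    unfolding p_def by (intro is_primitive_add is_primitive_cmult P P1)
  then have Pp: "is_primitive 0 pi p (\<lambda>x. (- \<i> * \<mu>) * p x + g x)"
    by (rule is_primitive_cong) (auto simp: p_def algebra_simps power2_eq_square)
  define e where "e = exp (\<i> * \<mu> * of_real pi)"
  have e1: "norm e \<le> 1" using \<mu>(2) by (simp add: e_def)
  have qx: "\<exists>b. norm b \<le> A \<and> q x = exp (\<i> * \<mu> * of_real x) * q 0 + b" if x: "x \<in> {0..pi}" for x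
  proof (intro exI conjI)
    let ?b = "integral {0..x} (\<lambda>t. g t * exp (- (\<i> * \<mu>) * of_real t + \<i> * \<mu> * of_real x))"
    have "norm ?b \<le> integral {0..pi} (\<lambda>t. exp (- (Im \<mu> * \<bar>x - t\<bar>)) * norm (g t))"
      by (rule norm_integral_exp_le[OF g]) (use x in \<open>auto simp: algebra_simps abs_if\<close>)
    then show "norm ?b \<le> A" using A x unfolding exp_average_bound_def by fastforce
    have E: "exp (- (\<i> * \<mu>) * of_real x) * exp (\<i> * \<mu> * of_real x) = 1" by (simp add: exp_add[symmetric])
    have "q x = q x * exp (- (\<i> * \<mu>) * of_real x) * exp (\<i> * \<mu> * of_real x)" using E by (simp add: mult.assoc)
    also have "\<dots> = (q 0 + integral {0..x} (\<lambda>t. g t * exp (- (\<i> * \<mu>) * of_real t))) * exp (\<i> * \<mu> * of_real x)"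
      by (subst first_order_solution[OF Pq g x]) simp
    also have "\<dots> = exp (\<i> * \<mu> * of_real x) * q 0 + integral {0..x} (\<lambda>t. g t * exp (- (\<i> * \<mu>) * of_real t)) * exp (\<i> * \<mu> * of_real x)"
      by (simp add: algebra_simps)
    also have "integral {0..x} (\<lambda>t. g t * exp (- (\<i> * \<mu>) * of_real t)) * exp (\<i> * \<mu> * of_real x) = ?b"
      unfolding integral_mult_left[symmetric] exp_add by (simp add: mult.assoc)
    finally show "q x = exp (\<i> * \<mu> * of_real x) * q 0 + ?b" .
  qed
  have px: "\<exists>b. norm b \<le> A \<and> p x = exp (\<i> * \<mu> * of_real (pi - x)) * p pi - b" if x: "x \<in> {0..pi}" for x
  proof (intro exI conjI)
    let ?b = "integral {x..pi} (\<lambda>t. g t * exp ((\<i> * \<mu>) * of_real t + (- \<i> * \<mu> * of_real x)))"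
    have "norm ?b \<le> integral {0..pi} (\<lambda>t. exp (- (Im \<mu> * \<bar>x - t\<bar>)) * norm (g t))"
      by (rule norm_integral_exp_le[OF g]) (use x in \<open>auto simp: algebra_simps abs_if\<close>)
    then show "norm ?b \<le> A" using A x unfolding exp_average_bound_def by fastforce
    have m: "- (- \<i> * \<mu>) = \<i> * \<mu>" by simp
    let ?G = "\<lambda>t. g t * exp (\<i> * \<mu> * of_real t)"
    have 1: "p x * exp (\<i> * \<mu> * of_real x) = p 0 + integral {0..x} ?G"
      using first_order_solution[OF Pp g x] unfolding m .
    have 2: "p pi * exp (\<i> * \<mu> * of_real pi) = p 0 + integral {0..pi} ?G"
      using first_order_solution[OF Pp g, of pi] unfolding m by simp
    have "?G integrable_on {0..pi}"
      by (rule integrable_mult_continuous[OF g]) (auto intro!: continuous_intros)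
    then have 3: "integral {0..x} ?G + integral {x..pi} ?G = integral {0..pi} ?G"
      using x by (intro Henstock_Kurzweil_Integration.integral_combine) auto
    have E: "exp (\<i> * \<mu> * of_real x) * exp (- \<i> * \<mu> * of_real x) = 1" by (simp add: exp_add[symmetric])
    have "p x = p x * exp (\<i> * \<mu> * of_real x) * exp (- \<i> * \<mu> * of_real x)" using E by (simp add: mult.assoc)
    also have "p x * exp (\<i> * \<mu> * of_real x) = p pi * exp (\<i> * \<mu> * of_real pi) - integral {x..pi} ?G"
      using 1 2 3 by (simp add: algebra_simps)
    also have "(p pi * exp (\<i> * \<mu> * of_real pi) - integral {x..pi} ?G) * exp (- \<i> * \<mu> * of_real x) =
       p pi * (exp (\<i> * \<mu> * of_real pi) * exp (- \<i> * \<mu> * of_real x)) - integral {x..pi} ?G * exp (- \<i> * \<mu> * of_real x)"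
      by (simp add: left_diff_distrib mult.assoc)
    also have "exp (\<i> * \<mu> * of_real pi) * exp (- \<i> * \<mu> * of_real x) = exp (\<i> * \<mu> * of_real (pi - x))"
      by (simp add: exp_add[symmetric] algebra_simps)
    also have "integral {x..pi} ?G * exp (- \<i> * \<mu> * of_real x) = ?b"
      unfolding integral_mult_left[symmetric] exp_add by (simp add: mult.assoc)
    finally show "p x = exp (\<i> * \<mu> * of_real (pi - x)) * p pi - ?b" by (simp add: mult.commute)
  qed
  obtain b where b: "norm b \<le> A" "q pi = e * q 0 + b" using qx[of pi] unfolding e_def by auto
  obtain b' where b': "norm b' \<le> A" "p 0 = e * p pi - b'" using px[of 0] unfolding e_def by auto
  have A0: "A \<ge> 0" using b(1) norm_ge_zero[of b] by linarith
  have ee: "exp (2 * of_real pi * \<i> * \<mu>) = e * e"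
    unfolding e_def exp_add[symmetric] by (simp add: algebra_simps)
  have e2: "norm (1 - e * e) \<ge> 1 / 2" using \<mu>(3) by (simp add: ee)
  have em: "norm (1 - e) \<ge> 1 / 4" "norm (1 + e) \<ge> 1 / 4"
  proof -
    have f: "norm (1 - e * e) = norm (1 - e) * norm (1 + e)" by (simp add: norm_mult[symmetric] algebra_simps)
    have "norm (1 + e) \<le> 2" "norm (1 - e) \<le> 2"
      using norm_triangle_ineq[of 1 e] norm_triangle_ineq4[of 1 e] e1 by auto
    then have "norm (1 - e) * norm (1 + e) \<le> norm (1 - e) * 2" "norm (1 - e) * norm (1 + e) \<le> 2 * norm (1 + e)"
      by (auto intro!: mult_left_mono mult_right_mono)
    then show "norm (1 - e) \<ge> 1 / 4" "norm (1 + e) \<ge> 1 / 4" using e2 f by auto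
  qed
  have div: "norm s \<le> 4 * A" if "s * d = r" "norm d \<ge> k" "norm r \<le> 4 * A * k" "k > 0" for s d r :: complex and k
  proof -
    have "norm s * k \<le> norm s * norm d" using that by (intro mult_left_mono) auto
    also have "\<dots> = norm r" using that(1) by (simp add: norm_mult[symmetric])
    finally have "norm s * k \<le> (4 * A) * k" using that(3) by simp
    then show ?thesis using that(4) by simp
  qed
  have eb: "norm (e * w) \<le> norm w" for w using e1 by (simp add: norm_mult mult_left_le_one_le)
  have "norm (q 0) \<le> 4 * A \<and> norm (p pi) \<le> 4 * A"
  proof (cases bc)
    case Per_plus
    then have "u pi = u 0" "u1 pi = u1 0" using bc by (auto simp: satisfies_bc_def)
    then have "q pi = q 0" "p 0 = p pi" by (auto simp: q_def p_def)
    then have "q 0 * (1 - e) = b" "p pi * (1 - e) = - b'" using b b' by (auto simp: algebra_simps)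
    then show ?thesis using div[of "q 0" "1 - e" b "1/4"] div[of "p pi" "1 - e" "-b'" "1/4"] em b b' by auto
  next
    case Per_minus
    then have "u pi = - u 0" "u1 pi = - u1 0" using bc by (auto simp: satisfies_bc_def eq_neg_iff_add_eq_0)
    then have "q pi = - q 0" "p 0 = - p pi" by (auto simp: q_def p_def)
    then have "q 0 * (1 + e) = - b" "p pi * (1 + e) = b'" using b b' 
      by (metis add.commute add_diff_cancel_left' add_uminus_conv_diff diff_minus_eq_add minus_diff_eq mult.commute mult.right_neutral distrib_left,
          metis (no_types, lifting) add.commute diff_eq_eq add_diff_cancel_left' add_uminus_conv_diff diff_minus_eq_add minus_diff_eq mult.commute mult.right_neutral distrib_left)
    then show ?thesis using div[of "q 0" "1 + e" "-b" "1/4"] div[of "p pi" "1 + e" "b'" "1/4"] em b b' by auto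
  next
    case Dir
    then have "u pi = 0" "u 0 = 0" using bc by (auto simp: satisfies_bc_def)
    then have "q pi = p pi" "q 0 = p 0" by (auto simp: q_def p_def)
    then have "q 0 = e * (e * q 0 + b) - b'" "p pi = e * (e * p pi - b') + b" using b b' by metis+
    then have "q 0 * (1 - e * e) = e * b - b'" "p pi * (1 - e * e) = b - e * b'" by (simp_all add: algebra_simps)
    moreover have "norm (e * b - b') \<le> 4 * A * (1/2)" "norm (b - e * b') \<le> 4 * A * (1/2)"
      using norm_triangle_ineq4[of "e * b" b'] norm_triangle_ineq4[of b "e * b'"] eb[of b] eb[of b'] b b' by linarith+
    ultimately show ?thesis using div[of "q 0" "1 - e * e" _ "1/2"] div[of "p pi" "1 - e * e" _ "1/2"] e2 by auto
  qed
  then have qp: "norm (q 0) \<le> 4 * A" "norm (p pi) \<le> 4 * A" by auto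
  obtain c where c: "norm c \<le> A" "q x = exp (\<i> * \<mu> * of_real x) * q 0 + c" using qx[OF x] by blast
  obtain d where d: "norm d \<le> A" "p x = exp (\<i> * \<mu> * of_real (pi - x)) * p pi - d" using px[OF x] by blast
  have "norm (exp (\<i> * \<mu> * of_real x)) \<le> 1" "norm (exp (\<i> * \<mu> * of_real (pi - x))) \<le> 1"
    using \<mu>(2) x by auto
  then have "norm (exp (\<i> * \<mu> * of_real x) * q 0) \<le> 1 * (4 * A)" "norm (exp (\<i> * \<mu> * of_real (pi - x)) * p pi) \<le> 1 * (4 * A)"
    unfolding norm_mult using qp by (intro mult_mono; simp)+
  then have "norm (q x) \<le> 5 * A" "norm (p x) \<le> 5 * A"
    using c d norm_triangle_ineq[of "exp (\<i> * \<mu> * of_real x) * q 0" c] norm_triangle_ineq4[of "exp (\<i> * \<mu> * of_real (pi - x)) * p pi" d]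
    by auto
  then have "norm (q x - p x) \<le> 10 * A" using norm_triangle_ineq4[of "q x" "p x"] by linarith
  moreover have "q x - p x = 2 * \<i> * \<mu> * u x" by (simp add: q_def p_def)
  ultimately have "norm \<mu> * norm (u x) \<le> 5 * A" by (simp add: norm_mult)
  then show ?thesis using \<mu>(1) by (simp add: field_simps)
qed

lemma separated_of_large_Im:
  assumes "Im \<mu> \<ge> 1 / 4"
  shows "norm (1 - exp (2 * of_real pi * \<i> * \<mu>)) \<ge> 1 / 2"
proof -
  have "norm (exp (2 * of_real pi * \<i> * \<mu>)) = exp (- (2 * pi * Im \<mu>))" by simp
  also have "\<dots> \<le> exp (- 1)" 
  proof -
    have "pi * (1/4) \<le> pi * Im \<mu>" using assms by (intro mult_left_mono) auto
    then have "1 \<le> 2 * (pi * Im \<mu>)" using pi_gt3 by linarith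
    then show ?thesis by (simp add: mult.assoc)
  qed
  also have "\<dots> \<le> 1 / 2" using exp_ge_add_one_self[of 1] by (simp add: exp_minus divide_simps)
  finally show ?thesis using norm_triangle_ineq2[of 1 "exp (2 * of_real pi * \<i> * \<mu>)"] by simp
qed

text \<open>
  For small \<open>Im \<mu>\<close> the equation \<open>(Re \<mu>)\<^sup>2 = N\<^sup>2 + N + (Im \<mu>)\<^sup>2\<close> puts \<open>\<bar>Re \<mu>\<bar>\<close> between \<open>N + 1/4\<close>
  and \<open>N + 1/2\<close>, so \<open>exp (2 pi \<i> \<mu>)\<close> lies in the left half plane.
\<close>

lemma separated_on_line:
  assumes Re: "Re (\<mu>\<^sup>2) = real N ^ 2 + real N" and N: "N \<ge> 1" and Im: "0 \<le> Im \<mu>" "Im \<mu> \<le> 1 / 2"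
  shows "norm (1 - exp (2 * of_real pi * \<i> * \<mu>)) \<ge> 1 / 2"
proof -
  define s where "s = \<bar>Re \<mu>\<bar> - real N"
  have sq: "\<bar>Re \<mu>\<bar>\<^sup>2 = real N ^ 2 + real N + (Im \<mu>)\<^sup>2" using Re by (simp add: power2_eq_square)
  have im: "(Im \<mu>)\<^sup>2 \<le> (1/2)\<^sup>2" using Im by (intro power_mono) auto
  have "\<bar>Re \<mu>\<bar>\<^sup>2 \<le> (real N + 1/2)\<^sup>2" using sq im by (simp add: power2_sum power_divide)
  then have s2: "s \<le> 1/2" unfolding s_def using power2_le_imp_le[of "\<bar>Re \<mu>\<bar>" "real N + 1/2"] by simp
  have "(real N + 1/4)\<^sup>2 \<le> \<bar>Re \<mu>\<bar>\<^sup>2" proof -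
    have "1 \<le> real N" "0 \<le> (Im \<mu>)\<^sup>2" using N by auto
    moreover have "(real N + 1/4)\<^sup>2 = (real N)\<^sup>2 + real N / 2 + 1/16" by (simp add: power2_sum power_divide)
    ultimately show ?thesis unfolding sq by linarith
  qed
  then have s1: "s \<ge> 1/4" unfolding s_def using power2_le_imp_le[of "real N + 1/4" "\<bar>Re \<mu>\<bar>"] by simp
  have "cos (2 * pi * Re \<mu>) = cos (2 * pi * \<bar>Re \<mu>\<bar>)" by (cases "Re \<mu> \<ge> 0") auto
  also have "\<dots> = cos (2 * pi * s + 2 * pi * real N)" by (simp add: s_def algebra_simps)
  also have "\<dots> = cos (2 * pi * s)" using cos_int_2pin[of "int N"] sin_int_2pin[of "int N"] by (simp add: cos_add)
  also have "\<dots> = - sin (2 * pi * s - pi / 2)" by (simp add: sin_diff)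
  also have "\<dots> \<le> 0"
  proof -
    have "pi * (1/4) \<le> pi * s" "pi * s \<le> pi * (1/2)" using s1 s2 by (auto intro!: mult_left_mono)
    then have "0 \<le> 2 * pi * s - pi / 2" "2 * pi * s - pi / 2 \<le> pi" using pi_gt_zero by linarith+
    then show ?thesis using sin_ge_zero by simp
  qed
  finally have c: "cos (2 * pi * Re \<mu>) \<le> 0" .
  have "Re (exp (2 * of_real pi * \<i> * \<mu>)) = exp (- (2 * pi * Im \<mu>)) * cos (2 * pi * Re \<mu>)" by (simp add: Re_exp)
  also have "\<dots> \<le> 0" using c by (simp add: mult_le_0_iff)
  finally have "1 \<le> Re (1 - exp (2 * of_real pi * \<i> * \<mu>))" by simp
  also have "\<dots> \<le> norm (1 - exp (2 * of_real pi * \<i> * \<mu>))" by (rule complex_Re_le_cmod)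
  finally show ?thesis by simp
qed

lemma sqrt_upper_half:
  obtains \<mu> :: complex where "\<mu>\<^sup>2 = z" "Im \<mu> \<ge> 0"
proof (cases "Im (csqrt z) \<ge> 0")
  case True then show ?thesis using that[of "csqrt z"] by simp
next
  case False then show ?thesis using that[of "- csqrt z"] by simp
qed

lemma Im_le_of_square:
  fixes \<mu> :: complex assumes "Im \<mu> \<ge> 0"
  shows "\<bar>Im (\<mu>\<^sup>2)\<bar> \<le> 2 * norm \<mu> * Im \<mu>"
  using mult_left_mono[OF abs_Re_le_cmod[of \<mu>] assms] assms by (simp add: power2_eq_square abs_mult mult_ac)

lemma norm_le_Im_of_square:
  fixes \<mu> :: complex assumes "Im \<mu> \<ge> 0" "Re (\<mu>\<^sup>2) \<le> \<bar>Im (\<mu>\<^sup>2)\<bar>"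
  shows "norm \<mu> \<le> 3 * Im \<mu>"
proof -
  define s where "s = \<bar>Re \<mu>\<bar>"
  define t where "t = Im \<mu>"
  have st: "s \<ge> 0" "t \<ge> 0" using assms by (auto simp: s_def t_def)
  have ss: "s * s = Re \<mu> * Re \<mu>" by (simp add: s_def abs_mult_self_eq)
  have "s * s - t * t \<le> 2 * s * t" using assms unfolding ss by (simp add: s_def t_def power2_eq_square abs_mult mult_ac)
  then have "(s - t)\<^sup>2 \<le> 2 * t\<^sup>2" by (simp add: power2_eq_square algebra_simps)
  also have "\<dots> \<le> (3/2 * t)\<^sup>2" by (simp add: power2_eq_square)
  finally have "s - t \<le> 3/2 * t" by (rule power2_le_imp_le) (use st in simp)
  then have "s\<^sup>2 \<le> (5/2 * t)\<^sup>2" using st by (intro power_mono) auto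
  then have "(norm \<mu>)\<^sup>2 \<le> (3 * t)\<^sup>2" unfolding cmod_power2 using ss zero_le_square[of "Im \<mu>"]
    by (simp add: power2_eq_square t_def del: zero_le_square)
  then have "norm \<mu> \<le> 3 * t" by (rule power2_le_imp_le) (use st in simp)
  then show ?thesis by (simp add: t_def)
qed

section \<open>Exponential averages and the difference of the resolvents\<close>

text \<open>
  The norm for Lebesgue measure itself, to which Hoelder's inequality applies without extra
  factors.
\<close>

definition Lp_full_norm :: "real \<Rightarrow> (real \<Rightarrow> complex) \<Rightarrow> real" where
  "Lp_full_norm a f = pi powr (1 / a) * Lp_norm a f"

lemma Lp_norm_nonneg: "Lp_norm a f \<ge> 0"
  by (simp add: Lp_norm_def)

lemma Lp_full_norm_nonneg: "Lp_full_norm a f \<ge> 0"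
  by (simp add: Lp_full_norm_def Lp_norm_nonneg)

lemma Lp_full_norm_powr:
  assumes f: "f \<in> Lp a" and a: "a > 0"
  shows "Lp_full_norm a f powr a = integral {0..pi} (\<lambda>x. norm (f x) powr a)"
proof -
  have i: "integrable M_pi (\<lambda>x. norm (f x) powr a)" using f by (simp add: Lp_def)
  have e: "(LINT x|M_pi. norm (f x) powr a) = integral {0..pi} (\<lambda>x. norm (f x) powr a)"
    by (rule lebesgue_integral_eq_integral[OF i]) simp
  have n: "integral {0..pi} (\<lambda>x. norm (f x) powr a) \<ge> 0"
    using f by (intro integral_nonneg) (auto simp: Lp_iff absolutely_integrable_on_def)
  have "Lp_full_norm a f powr a = (pi powr (1/a)) powr a * ((1 / pi * integral {0..pi} (\<lambda>x. norm (f x) powr a)) powr (1/a)) powr a"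
    unfolding Lp_full_norm_def Lp_norm_def e by (rule powr_mult)
  also have "\<dots> = pi * (1 / pi * integral {0..pi} (\<lambda>x. norm (f x) powr a))"
    using a n by (simp add: powr_powr)
  finally show ?thesis by simp
qed

text \<open>
  Young's inequality for the normalized functions. To avoid a case distinction for vanishing f,
  its norm is replaced by a slightly larger number F.
\<close>

lemma Hoelder_continuous:
  fixes g :: "real \<Rightarrow> real"
  assumes f: "f \<in> Lp a" and a: "1 < a" and uv: "0 \<le> u" "v \<le> pi"
    and g: "continuous_on {0..pi} g" "\<And>t. t \<in> {u..v} \<Longrightarrow> 0 \<le> g t"
    and G: "integral {u..v} (\<lambda>t. g t powr (a / (a - 1))) \<le> G powr (a / (a - 1))" "0 < G"
  shows "integral {u..v} (\<lambda>t. g t * norm (f t)) \<le> Lp_full_norm a f * G"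
proof (rule field_le_epsilon)
  fix e :: real assume e: "e > 0"
  define b where "b = a / (a - 1)"
  have b: "b > 1" "1 / a + 1 / b = 1" using a by (auto simp: b_def field_simps)
  define F where "F = Lp_full_norm a f + e / G"
  have F: "F > 0" using e G Lp_full_norm_nonneg[of a f] by (simp add: F_def add_nonneg_pos)
  have fa: "L1 f" using Lp_absolutely_integrable[OF f] a by simp
  have fpi: "(\<lambda>t. norm (f t) powr a) integrable_on {u..v}"
    using f uv by (auto simp: Lp_iff absolutely_integrable_on_def intro: integrable_subinterval_real)
  have guv: "continuous_on {u..v} g" by (rule continuous_on_subset[OF g(1)]) (use uv in auto)
  have gpi: "(\<lambda>t. g t powr b) integrable_on {u..v}"
    by (rule integrable_continuous_real) (use b guv g(2) in \<open>intro continuous_on_powr' continuous_intros; auto\<close>)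
  have fgi: "(\<lambda>t. g t * norm (f t)) integrable_on {u..v}"
  proof -
    have "(\<lambda>t. norm (f t * complex_of_real (g t))) integrable_on {u..v}"
      using absolutely_integrable_norm_integrable[OF absolutely_integrable_mult_continuous[OF fa, of "\<lambda>t. complex_of_real (g t)"] uv] g(1)
      by (auto intro: continuous_intros)
    then show ?thesis by (rule integrable_eq) (use g(2) in \<open>simp add: norm_mult mult.commute\<close>)
  qed
  have pw: "g t * norm (f t) \<le> F * G * ((norm (f t) powr a) * (1 / (F powr a * a)) + (g t powr b) * (1 / (G powr b * b)))" if t: "t \<in> {u..v}" for t
  proof -
    have "(norm (f t) / F) * (g t / G) \<le> (norm (f t) / F) powr a / a + (g t / G) powr b / b"
      using b a F G g(2)[OF t] by (intro Youngs_inequality) auto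
    also have "\<dots> = (norm (f t) powr a) * (1 / (F powr a * a)) + (g t powr b) * (1 / (G powr b * b))"
      using F G g(2)[OF t] by (simp add: powr_divide)
    finally have "F * G * ((norm (f t) / F) * (g t / G)) \<le> F * G * ((norm (f t) powr a) * (1 / (F powr a * a)) + (g t powr b) * (1 / (G powr b * b)))"
      using F G by (intro mult_left_mono) auto
    moreover have "F * G * ((norm (f t) / F) * (g t / G)) = g t * norm (f t)" using F G by (simp add: field_simps)
    ultimately show ?thesis by simp
  qed
  have "integral {u..v} (\<lambda>t. g t * norm (f t)) \<le> integral {u..v} (\<lambda>t. F * G * ((norm (f t) powr a) * (1 / (F powr a * a)) + (g t powr b) * (1 / (G powr b * b))))"
    by (rule integral_le[OF fgi _ pw]) (intro integrable_on_mult_right integrable_add integrable_on_mult_left fpi gpi)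
  also have "\<dots> = F * G * (integral {u..v} (\<lambda>t. norm (f t) powr a) * (1 / (F powr a * a)) + integral {u..v} (\<lambda>t. g t powr b) * (1 / (G powr b * b)))"
    by (simp only: integral_mult_right integral_mult_left integral_add[OF integrable_on_mult_left[OF fpi] integrable_on_mult_left[OF gpi]])
  also have "\<dots> \<le> F * G * (F powr a * (1 / (F powr a * a)) + G powr b * (1 / (G powr b * b)))"
  proof -
    have "integral {u..v} (\<lambda>t. norm (f t) powr a) \<le> integral {0..pi} (\<lambda>t. norm (f t) powr a)"
      using f uv fpi by (intro integral_subset_le) (auto simp: Lp_iff absolutely_integrable_on_def)
    also have "\<dots> = Lp_full_norm a f powr a" using Lp_full_norm_powr[OF f] a by simp
    also have "\<dots> \<le> F powr a" using a e G Lp_full_norm_nonneg[of a f] by (intro powr_mono2) (auto simp: F_def)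
    finally have 1: "integral {u..v} (\<lambda>t. norm (f t) powr a) \<le> F powr a" .
    have 2: "integral {u..v} (\<lambda>t. g t powr b) \<le> G powr b" using G(1) by (simp add: b_def)
    show ?thesis using F G a b by (intro mult_left_mono add_mono mult_right_mono 1 2) auto
  qed
  also have "\<dots> = F * G * (1 / a + 1 / b)" using F G by simp
  also have "\<dots> = Lp_full_norm a f * G + e" using b G by (simp add: F_def field_simps)
  finally show "integral {u..v} (\<lambda>t. g t * norm (f t)) \<le> Lp_full_norm a f * G + e" .
qed

lemma Lp_full_norm_1:
  assumes "f \<in> Lp 1" shows "Lp_full_norm 1 f = L1norm f"
  using Lp_full_norm_powr[OF assms] Lp_full_norm_nonneg[of 1 f] by (simp add: L1norm_def)

lemma L1norm_le_Lp_norm: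
  assumes f: "f \<in> Lp a" and a: "1 \<le> a"
  shows "L1norm f \<le> pi * Lp_norm a f"
proof (cases "a = 1")
  case True
  then show ?thesis using Lp_full_norm_1 f by (simp add: Lp_full_norm_def)
next
  case False
  then have a1: "1 < a" using a by simp
  have e: "(pi powr ((a-1)/a)) powr (a / (a - 1)) = pi" using a1 by (simp add: powr_powr)
  have "integral {0..pi} (\<lambda>t. 1 * norm (f t)) \<le> Lp_full_norm a f * pi powr ((a-1)/a)"
    by (rule Hoelder_continuous[OF f a1]) (use e in auto)
  also have "\<dots> = (pi powr (1/a) * pi powr ((a-1)/a)) * Lp_norm a f" by (simp add: Lp_full_norm_def)
  also have "pi powr (1/a) * pi powr ((a-1)/a) = pi powr (1/a + (a-1)/a)" by (simp add: powr_add)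
  also have "1/a + (a-1)/a = 1" using a1 by (simp add: field_simps)
  finally show ?thesis by (simp add: L1norm_def)
qed

lemma exp_weight_le:
  fixes \<tau> s c :: real
  assumes "\<tau> \<ge> 0" "s \<ge> 0" "c \<ge> 0"
  shows "exp (- (\<tau> * s)) * c \<le> c"
proof -
  have "0 \<le> \<tau> * s" using assms by simp
  then have "exp (- (\<tau> * s)) \<le> 1" by simp
  from mult_right_mono[OF this assms(3)] show ?thesis by simp
qed

lemma exp_average_bound_L1:
  assumes g: "L1 g" and t: "\<tau> \<ge> 0"
  shows "exp_average_bound \<tau> g (L1norm g)"
  unfolding exp_average_bound_def
proof
  fix x :: real assume x: "x \<in> {0..pi}"
  have "integral {0..pi} (\<lambda>t. exp (- (\<tau> * \<bar>x - t\<bar>)) * norm (g t)) \<le> integral {0..pi} (\<lambda>t. norm (g t))"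
    by (rule integral_le[OF exp_average_integrable[OF g] absolutely_integrable_norm_integrable[OF g]])
       (auto intro: exp_weight_le[OF t])
  then show "integral {0..pi} (\<lambda>t. exp (- (\<tau> * \<bar>x - t\<bar>)) * norm (g t)) \<le> L1norm g" by (simp add: L1norm_def)
qed

lemma exp_average_bound_add:
  assumes f: "L1 f" and g: "L1 g"
    and A: "exp_average_bound \<tau> f A" and B: "exp_average_bound \<tau> g B"
  shows "exp_average_bound \<tau> (\<lambda>x. f x + g x) (A + B)"
  unfolding exp_average_bound_def
proof
  fix x :: real assume x: "x \<in> {0..pi}"
  let ?w = "\<lambda>t. exp (- (\<tau> * \<bar>x - t\<bar>))"
  note i = exp_average_integrable[OF f, of 0 pi \<tau> x] exp_average_integrable[OF g, of 0 pi \<tau> x]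
    exp_average_integrable[OF set_integral_add(1)[OF f g], of 0 pi \<tau> x]
  have "integral {0..pi} (\<lambda>t. ?w t * norm (f t + g t)) \<le> integral {0..pi} (\<lambda>t. ?w t * norm (f t) + ?w t * norm (g t))"
    using i by (intro integral_le integrable_add) (auto simp: distrib_left[symmetric] intro!: mult_left_mono norm_triangle_ineq)
  also have "\<dots> = integral {0..pi} (\<lambda>t. ?w t * norm (f t)) + integral {0..pi} (\<lambda>t. ?w t * norm (g t))"
    using i by (intro integral_add) auto
  also have "\<dots> \<le> A + B" using A B x unfolding exp_average_bound_def by (intro add_mono) blast+
  finally show "integral {0..pi} (\<lambda>t. ?w t * norm (f t + g t)) \<le> A + B" .
qed

lemma exp_average_bound_mult:
  assumes v: "L1 v" and w: "continuous_on {0..pi} w" "\<And>x. x \<in> {0..pi} \<Longrightarrow> norm (w x) \<le> B"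
    and A: "exp_average_bound \<tau> v A" and B: "B \<ge> 0"
  shows "exp_average_bound \<tau> (\<lambda>x. v x * w x) (B * A)"
  unfolding exp_average_bound_def
proof
  fix x :: real assume x: "x \<in> {0..pi}"
  let ?k = "\<lambda>t. exp (- (\<tau> * \<bar>x - t\<bar>))"
  note i = exp_average_integrable[OF v, of 0 pi \<tau> x] exp_average_integrable[OF absolutely_integrable_mult_continuous[OF v w(1)], of 0 pi \<tau> x]
  have "integral {0..pi} (\<lambda>t. ?k t * norm (v t * w t)) \<le> integral {0..pi} (\<lambda>t. B * (?k t * norm (v t)))"
  proof (rule integral_le)
    fix t assume "t \<in> {0..pi}"
    then have "norm (v t) * norm (w t) \<le> norm (v t) * B" using w(2) by (intro mult_left_mono) auto
    then have "?k t * (norm (v t) * norm (w t)) \<le> ?k t * (norm (v t) * B)" by (rule mult_left_mono) simp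
    then show "?k t * norm (v t * w t) \<le> B * (?k t * norm (v t))" by (simp add: norm_mult mult_ac)
  qed (use i in \<open>auto intro: integrable_on_mult_right\<close>)
  also have "\<dots> = B * integral {0..pi} (\<lambda>t. ?k t * norm (v t))" by simp
  also have "\<dots> \<le> B * A" using A x B unfolding exp_average_bound_def by (intro mult_left_mono) blast+
  finally show "integral {0..pi} (\<lambda>t. ?k t * norm (v t * w t)) \<le> B * A" .
qed

lemma integral_exp_abs_le:
  fixes k x :: real
  assumes k: "k > 0" and x: "x \<in> {0..pi}"
  shows "integral {0..pi} (\<lambda>t. exp (- (k * \<bar>x - t\<bar>))) \<le> 2 / k"
proof -
  let ?e = "\<lambda>t. exp (- (k * \<bar>x - t\<bar>))"
  have "((\<lambda>t. exp (- (k * (x - t)))) has_integral ((\<lambda>t. exp (- (k * (x - t))) / k) x - (\<lambda>t. exp (- (k * (x - t))) / k) 0)) {0..x}"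
    by (rule fundamental_theorem_of_calculus) (use k x in \<open>auto intro!: derivative_eq_intros simp: has_real_derivative_iff_has_vector_derivative[symmetric]\<close>)
  then have "((\<lambda>t. exp (- (k * (x - t)))) has_integral (1 / k - exp (- (k * x)) / k)) {0..x}" by simp
  then have 1: "(?e has_integral (1 / k - exp (- (k * x)) / k)) {0..x}" by (rule has_integral_eq[rotated]) auto
  have "((\<lambda>t. exp (- (k * (t - x)))) has_integral ((\<lambda>t. - exp (- (k * (t - x))) / k) pi - (\<lambda>t. - exp (- (k * (t - x))) / k) x)) {x..pi}"
    by (rule fundamental_theorem_of_calculus) (use k x in \<open>auto intro!: derivative_eq_intros simp: has_real_derivative_iff_has_vector_derivative[symmetric]\<close>)
  then have "((\<lambda>t. exp (- (k * (t - x)))) has_integral (1 / k - exp (- (k * (pi - x))) / k)) {x..pi}" by simp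
  then have 2: "(?e has_integral (1 / k - exp (- (k * (pi - x))) / k)) {x..pi}" by (rule has_integral_eq[rotated]) auto
  have "(?e has_integral ((1 / k - exp (- (k * x)) / k) + (1 / k - exp (- (k * (pi - x))) / k))) {0..pi}"
    by (rule has_integral_combine[OF _ _ 1 2]) (use x in auto)
  then have "integral {0..pi} ?e = (1 / k - exp (- (k * x)) / k) + (1 / k - exp (- (k * (pi - x))) / k)" by (rule integral_unique)
  moreover have "exp (- (k * x)) / k \<ge> 0" "exp (- (k * (pi - x))) / k \<ge> 0" using k by auto
  ultimately show ?thesis by (simp add: field_simps)
qed

text \<open>
  Hoelder's inequality with the weight, whose norm for the dual exponent \<open>b = a / (a - 1)\<close> is at
  most \<open>(2 / (\<tau> b)) powr (1/b) \<le> 2 \<tau> powr (- (1 - 1/a))\<close>. For \<open>a = 1\<close> the weight is merely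
  bounded by 1.
\<close>

lemma exp_average_bound_Lp:
  assumes f: "f \<in> Lp a" and a: "1 \<le> a" and \<tau>: "\<tau> > 0"
  shows "exp_average_bound \<tau> f (2 * Lp_full_norm a f * \<tau> powr (- (1 - 1 / a)))"
proof (cases "a = 1")
  case True
  then show ?thesis using exp_average_bound_L1[OF Lp_absolutely_integrable[OF f a], of \<tau>] \<tau> Lp_full_norm_1[of f] L1norm_nonneg[of f] f
    unfolding exp_average_bound_def by fastforce
next
  case False
  then have a1: "1 < a" using a by simp
  define b where "b = a / (a - 1)"
  have b: "b > 1" using a1 by (simp add: b_def field_simps)
  define G where "G = 2 * \<tau> powr (- (1 - 1 / a))"
  have G: "G powr b = 2 powr b * (1 / \<tau>)"
  proof -
    have "- (1 - 1 / a) * b = -1" using a1 by (simp add: b_def field_simps)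
    then show ?thesis using \<tau> by (simp add: G_def powr_mult powr_powr powr_minus_divide)
  qed
  have "exp_average_bound \<tau> f (Lp_full_norm a f * G)" unfolding exp_average_bound_def
  proof
    fix x assume x: "x \<in> {0..pi}"
    have pw: "exp y powr b = exp (y * b)" for y by (simp add: powr_def mult.commute)
    have E: "(\<lambda>t. exp (- (\<tau> * \<bar>x - t\<bar>)) powr b) = (\<lambda>t. exp (- ((\<tau> * b) * \<bar>x - t\<bar>)))"
      unfolding pw by (simp add: mult_ac)
    have "integral {0..pi} (\<lambda>t. exp (- (\<tau> * \<bar>x - t\<bar>)) powr b) \<le> 2 / (\<tau> * b)"
      unfolding E using x \<tau> b by (intro integral_exp_abs_le) auto
    also have "\<dots> \<le> 2 * (1 / \<tau>)" using \<tau> b by (simp add: divide_simps)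
    also have "\<dots> \<le> 2 powr b * (1 / \<tau>)" using powr_mono[of 1 b 2] b \<tau> by (intro mult_right_mono) auto
    finally have 1: "integral {0..pi} (\<lambda>t. exp (- (\<tau> * \<bar>x - t\<bar>)) powr b) \<le> G powr b" unfolding G .
    show "integral {0..pi} (\<lambda>t. exp (- (\<tau> * \<bar>x - t\<bar>)) * norm (f t)) \<le> Lp_full_norm a f * G"
      by (rule Hoelder_continuous[OF f a1 _ _ _ _ 1[unfolded b_def]]) (use \<tau> in \<open>auto intro!: continuous_intros simp: G_def\<close>)
  qed
  then show ?thesis by (simp add: G_def mult_ac)
qed

text \<open>
  At a maximum point of \<open>\<bar>u\<bar>\<close> the contribution of \<open>v u\<close> to the free estimate is at most half the
  maximum.
\<close>

lemma perturbed_estimate: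
  assumes \<mu>: "well_separated \<mu>" and v: "L1 v" and small: "10 * L1norm v \<le> norm \<mu>"
    and sol: "solves_bvp bc v (\<mu>\<^sup>2) f u u1" and f: "L1 f" and A: "exp_average_bound (Im \<mu>) f A"
    and x: "x \<in> {0..pi}"
  shows "norm (u x) \<le> 10 * A / norm \<mu>"
proof -
  have m: "norm \<mu> > 0" "Im \<mu> \<ge> 0" using \<mu> by (auto simp: well_separated_def)
  have cu: "continuous_on {0..pi} u" using solves_bvp_continuous[OF sol] .
  have "continuous_on {0..pi} (\<lambda>x. norm (u x))" using cu by (intro continuous_intros)
  then obtain x0 where x0: "x0 \<in> {0..pi}" "\<And>y. y \<in> {0..pi} \<Longrightarrow> norm (u y) \<le> norm (u x0)"
    using continuous_attains_sup[of "{0..pi}" "\<lambda>x. norm (u x)"] by auto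
  define B where "B = norm (u x0)"
  have vu: "L1 (\<lambda>x. v x * u x)" by (rule absolutely_integrable_mult_continuous[OF v cu])
  have s: "solves_bvp bc (\<lambda>x. 0) (\<mu>\<^sup>2) (\<lambda>x. f x + v x * u x) u u1"
    by (rule solves_bvp_change[OF sol]) (simp add: algebra_simps)
  have cb: "exp_average_bound (Im \<mu>) (\<lambda>x. f x + v x * u x) (A + B * L1norm v)"
    by (intro exp_average_bound_add f vu A exp_average_bound_mult[OF v cu _ exp_average_bound_L1[OF v m(2)]]) (use x0 in \<open>auto simp: B_def\<close>)
  have "B \<le> 5 * (A + B * L1norm v) / norm \<mu>"
    unfolding B_def by (rule free_apriori_estimate[OF \<mu> s set_integral_add(1)[OF f vu] cb[unfolded B_def] x0(1)])
  then have "B * norm \<mu> \<le> 5 * A + B * (5 * L1norm v)" using m by (simp add: field_simps)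
  also have "\<dots> \<le> 5 * A + B * (norm \<mu> / 2)" using small by (intro add_mono mult_left_mono) (auto simp: B_def)
  finally have "B * norm \<mu> \<le> 10 * A" by (simp add: field_simps)
  then have "B \<le> 10 * A / norm \<mu>" using m by (simp add: field_simps)
  then show ?thesis using x0(2)[OF x] by (simp add: B_def)
qed

lemma well_separated_in_resolvent_set:
  assumes \<mu>: "well_separated \<mu>" and v: "L1 v" and small: "10 * L1norm v \<le> norm \<mu>"
  shows "\<mu>\<^sup>2 \<in> resolvent_set bc v"
proof -
  have z: "L1 (\<lambda>x. 0::complex)" by simp
  have "exp_average_bound (Im \<mu>) (\<lambda>x. 0) 0" by (simp add: exp_average_bound_def)
  then have "norm (y x) \<le> 10 * 0 / norm \<mu>" if "solves_bvp bc v (\<mu>\<^sup>2) (\<lambda>x. 0) y y1" "x \<in> {0..pi}" for y y1 x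
    using perturbed_estimate[OF \<mu> v small that(1) z _ that(2)] by blast
  then show ?thesis by (auto simp: resolvent_set_def)
qed

text \<open>
  The difference solves the free equation with right-hand side \<open>v u\<close>. The bound for u has a
  factor \<open>1 / \<bar>\<mu>\<bar>\<close> and the exponent belonging to f; the free estimate adds another factor
  \<open>1 / \<bar>\<mu>\<bar>\<close> and the exponent belonging to v.
\<close>

lemma weak_resolvent_diff_estimate:
  assumes \<mu>: "well_separated \<mu>" "Im \<mu> > 0" and p: "1 \<le> p" "v \<in> Lp p" and a: "1 \<le> a" "f \<in> Lp a" and small: "10 * L1norm v \<le> norm \<mu>"
  shows "norm (weak_resolvent bc v (\<mu>\<^sup>2) f x - weak_resolvent bc (\<lambda>x. 0) (\<mu>\<^sup>2) f x) \<le>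
    200 * Lp_full_norm p v * Lp_full_norm a f * Im \<mu> powr (- ((1 - 1/p) + (1 - 1/a))) / norm (\<mu>\<^sup>2)"
proof (cases "x \<in> {0..pi}")
  case False
  then show ?thesis by (auto simp: weak_resolvent_def Lp_full_norm_nonneg)
next
  case x: True
  have m: "norm \<mu> > 0" using \<mu> by (auto simp: well_separated_def)
  have v: "L1 v" and f: "L1 f"
    using Lp_absolutely_integrable p a by auto
  have z0: "L1 (\<lambda>x. 0::complex)" by simp
  have r: "\<mu>\<^sup>2 \<in> resolvent_set bc v" "\<mu>\<^sup>2 \<in> resolvent_set bc (\<lambda>x. 0)"
    using well_separated_in_resolvent_set[OF \<mu>(1) v small] well_separated_in_resolvent_set[OF \<mu>(1) z0] m by (auto simp: L1norm_def)
  define u where "u = weak_resolvent bc v (\<mu>\<^sup>2) f"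
  define w where "w = weak_resolvent bc (\<lambda>x. 0) (\<mu>\<^sup>2) f"
  obtain u1 w1 where u: "solves_bvp bc v (\<mu>\<^sup>2) f u u1" and w: "solves_bvp bc (\<lambda>x. 0) (\<mu>\<^sup>2) f w w1"
    using weak_resolvent_is_sol[OF v r(1) f] weak_resolvent_is_sol[OF z0 r(2) f] by (auto simp: u_def w_def)
  have cu: "continuous_on {0..pi} u" using solves_bvp_continuous[OF u] .
  have vu: "L1 (\<lambda>x. v x * u x)" by (rule absolutely_integrable_mult_continuous[OF v cu])
  define A where "A = 2 * Lp_full_norm a f * Im \<mu> powr (- (1 - 1 / a))"
  define V where "V = 2 * Lp_full_norm p v * Im \<mu> powr (- (1 - 1 / p))"
  have ub: "norm (u y) \<le> 10 * A / norm \<mu>" if "y \<in> {0..pi}" for y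
    unfolding A_def by (rule perturbed_estimate[OF \<mu>(1) v small u f exp_average_bound_Lp[OF a(2,1) \<mu>(2)] that])
  have A0: "A \<ge> 0" by (simp add: A_def Lp_full_norm_nonneg)
  have s: "solves_bvp bc (\<lambda>x. 0) (\<mu>\<^sup>2) (\<lambda>x. f x + v x * u x) u u1"
    by (rule solves_bvp_change[OF u]) (simp add: algebra_simps)
  have d: "solves_bvp bc (\<lambda>x. 0) (\<mu>\<^sup>2) (\<lambda>x. v x * u x) (\<lambda>x. u x - w x) (\<lambda>x. u1 x - w1 x)"
    using solves_bvp_diff[OF s w] by simp
  have cb: "exp_average_bound (Im \<mu>) (\<lambda>x. v x * u x) (10 * A / norm \<mu> * V)"
    unfolding V_def by (rule exp_average_bound_mult[OF v cu ub exp_average_bound_Lp[OF p(2,1) \<mu>(2)]]) (use A0 in auto)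
  have "norm (u x - w x) \<le> 5 * (10 * A / norm \<mu> * V) / norm \<mu>"
    by (rule free_apriori_estimate[OF \<mu>(1) d vu cb x])
  also have "\<dots> = 50 * (V * A) / norm (\<mu>\<^sup>2)" by (simp add: norm_mult power2_eq_square mult.commute)
  also have "V * A = 4 * (Lp_full_norm p v * Lp_full_norm a f) * Im \<mu> powr (- ((1 - 1/p) + (1 - 1/a)))"
    unfolding V_def A_def minus_add_distrib powr_add by simp
  finally show ?thesis by (simp add: u_def w_def mult.assoc)
qed

lemma far_well_separated:
  assumes "Re z \<le> \<bar>Im z\<bar>" "1 \<le> norm z"
  obtains \<mu> where "\<mu>\<^sup>2 = z" "well_separated \<mu>" "Im \<mu> \<ge> sqrt (norm z) / 3" "norm \<mu> = sqrt (norm z)"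
proof -
  obtain \<mu> where \<mu>: "\<mu>\<^sup>2 = z" "Im \<mu> \<ge> 0" by (rule sqrt_upper_half)
  have n: "norm \<mu> = sqrt (norm z)" unfolding \<mu>(1)[symmetric] norm_power by simp
  have i: "norm \<mu> \<le> 3 * Im \<mu>" using norm_le_Im_of_square[OF \<mu>(2)] assms \<mu>(1) by simp
  have "1 \<le> norm \<mu>" unfolding n using assms(2) by simp
  then have "Im \<mu> \<ge> 1/4" "\<mu> \<noteq> 0" using i by auto
  then have "well_separated \<mu>" using separated_of_large_Im \<mu>(2) by (simp add: well_separated_def)
  then show thesis using that \<mu>(1) n i by simp
qed

lemma line_well_separated:
  assumes "Re z = real N ^ 2 + real N" "N \<ge> 1"
  obtains \<mu> where "\<mu>\<^sup>2 = z" "well_separated \<mu>" "\<bar>Im z\<bar> \<le> 2 * sqrt (norm z) * Im \<mu>" "norm \<mu> = sqrt (norm z)" "real N \<le> norm \<mu>"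
proof -
  obtain \<mu> where \<mu>: "\<mu>\<^sup>2 = z" "Im \<mu> \<ge> 0" by (rule sqrt_upper_half)
  have n: "norm \<mu> = sqrt (norm z)" unfolding \<mu>(1)[symmetric] norm_power by simp
  have "(real N)\<^sup>2 \<le> norm z" using complex_Re_le_cmod[of z] assms by linarith
  then have N: "real N \<le> norm \<mu>" unfolding n by (rule real_le_rsqrt)
  then have "\<mu> \<noteq> 0" using assms(2) by auto
  moreover have "norm (1 - exp (2 * of_real pi * \<i> * \<mu>)) \<ge> 1 / 2"
    using separated_of_large_Im[of \<mu>] separated_on_line[of \<mu> N] assms \<mu> by (cases "Im \<mu> \<ge> 1/4") auto
  ultimately have "well_separated \<mu>" using \<mu>(2) by (simp add: well_separated_def)
  then show thesis using that \<mu>(1) n Im_le_of_square[OF \<mu>(2)] N by simp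
qed

lemma far_in_resolvent_set:
  assumes z: "Re z \<le> \<bar>Im z\<bar>" "1 \<le> norm z" and v: "L1 v" "(10 * L1norm v)\<^sup>2 \<le> norm z"
  shows "z \<in> resolvent_set bc v"
proof -
  obtain \<mu> where m: "\<mu>\<^sup>2 = z" "well_separated \<mu>" "norm \<mu> = sqrt (norm z)" using far_well_separated[OF z] by metis
  have "10 * L1norm v \<le> norm \<mu>" unfolding m(3) by (rule real_le_rsqrt[OF v(2)])
  then show ?thesis using well_separated_in_resolvent_set[OF m(2) v(1)] m(1) by simp
qed

lemma line_in_resolvent_set:
  assumes z: "Re z = real N ^ 2 + real N" "N \<ge> 1" and v: "L1 v" "10 * L1norm v \<le> real N"
  shows "z \<in> resolvent_set bc v"
proof -
  obtain \<mu> where m: "\<mu>\<^sup>2 = z" "well_separated \<mu>" "real N \<le> norm \<mu>" using line_well_separated[OF z] by metis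
  then show ?thesis using well_separated_in_resolvent_set[OF m(2) v(1)] v(2) by auto
qed

lemma far_diff_estimate:
  assumes z: "Re z \<le> \<bar>Im z\<bar>" "1 \<le> norm z" and p: "1 \<le> p" "v \<in> Lp p" and a: "1 \<le> a" "f \<in> Lp a" and small: "(10 * L1norm v)\<^sup>2 \<le> norm z"
    and \<delta>: "\<delta> = (1 - 1/p) + (1 - 1/a)" "\<delta> \<le> 1"
  shows "norm (weak_resolvent bc v z f x - weak_resolvent bc (\<lambda>x. 0) z f x) \<le>
    600 * Lp_full_norm p v * Lp_full_norm a f * norm z powr (- 1 - \<delta> / 2)"
proof -
  obtain \<mu> where m: "\<mu>\<^sup>2 = z" "well_separated \<mu>" "Im \<mu> \<ge> sqrt (norm z) / 3" "norm \<mu> = sqrt (norm z)" by (rule far_well_separated[OF z])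
  have "1 / p \<le> 1" "1 / a \<le> 1" using p a by simp_all
  then have d0: "\<delta> \<ge> 0" using \<delta>(1) by linarith
  have s0: "sqrt (norm z) / 3 > 0" using z(2) by (cases "z = 0") auto
  then have i0: "Im \<mu> > 0" using m(3) by linarith
  have sm: "10 * L1norm v \<le> norm \<mu>" unfolding m(4) by (rule real_le_rsqrt[OF small])
  have nz: "norm z > 0" using z(2) by linarith
  have "Im \<mu> powr (- \<delta>) \<le> (sqrt (norm z) / 3) powr (- \<delta>)"
    using s0 m(3) d0 by (intro powr_mono2') auto
  also have "\<dots> = 3 powr \<delta> * norm z powr (- \<delta> / 2)"
    using nz by (simp add: powr_divide powr_minus_divide powr_half_sqrt[symmetric] powr_powr)
  also have "\<dots> \<le> 3 * norm z powr (- \<delta> / 2)"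
    using powr_mono[OF \<delta>(2), of 3] by (intro mult_right_mono) auto
  finally have pw: "Im \<mu> powr (- \<delta>) \<le> 3 * norm z powr (- \<delta> / 2)" .
  have "norm (weak_resolvent bc v z f x - weak_resolvent bc (\<lambda>x. 0) z f x) \<le> 200 * Lp_full_norm p v * Lp_full_norm a f * Im \<mu> powr (- \<delta>) / norm z"
    using weak_resolvent_diff_estimate[OF m(2) i0 p a sm, of bc x] unfolding m(1) \<delta>(1) .
  also have "\<dots> \<le> 200 * Lp_full_norm p v * Lp_full_norm a f * (3 * norm z powr (- \<delta> / 2)) / norm z"
    using pw by (intro divide_right_mono mult_left_mono) (auto simp: Lp_full_norm_nonneg)
  also have "\<dots> = 600 * Lp_full_norm p v * Lp_full_norm a f * (norm z powr (- \<delta> / 2) * norm z powr (-1))"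
    using nz by (simp add: powr_minus_divide)
  also have "norm z powr (- \<delta> / 2) * norm z powr (-1) = norm z powr (- 1 - \<delta> / 2)"
    by (simp only: powr_add[symmetric]) (simp add: algebra_simps)
  finally show ?thesis .
qed

lemma line_diff_estimate:
  assumes z: "Re z = real N ^ 2 + real N" "N \<ge> 1" "Im z \<noteq> 0" and p: "1 \<le> p" "v \<in> Lp p" and a: "1 \<le> a" "f \<in> Lp a" and small: "10 * L1norm v \<le> real N"
    and \<delta>: "\<delta> = (1 - 1/p) + (1 - 1/a)" "\<delta> \<le> 1"
  shows "norm (weak_resolvent bc v z f x - weak_resolvent bc (\<lambda>x. 0) z f x) \<le>
    400 * Lp_full_norm p v * Lp_full_norm a f * (\<bar>Im z\<bar> powr (- \<delta>) * norm z powr (\<delta> / 2 - 1))"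
proof -
  obtain \<mu> where m: "\<mu>\<^sup>2 = z" "well_separated \<mu>" "\<bar>Im z\<bar> \<le> 2 * sqrt (norm z) * Im \<mu>" "norm \<mu> = sqrt (norm z)" "real N \<le> norm \<mu>"
    by (rule line_well_separated[OF z(1,2)])
  have "1 / p \<le> 1" "1 / a \<le> 1" using p a by simp_all
  then have d0: "\<delta> \<ge> 0" using \<delta>(1) by linarith
  have nz: "norm z > 0" using z(3) by auto
  have le: "\<bar>Im z\<bar> / (2 * sqrt (norm z)) \<le> Im \<mu>" using m(3) nz by (simp add: field_simps)
  have s0: "\<bar>Im z\<bar> / (2 * sqrt (norm z)) > 0" using z(3) nz by simp
  then have i0: "Im \<mu> > 0" using le by linarith
  have sm: "10 * L1norm v \<le> norm \<mu>" using small m(5) by simp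
  have "Im \<mu> powr (- \<delta>) \<le> (\<bar>Im z\<bar> / (2 * sqrt (norm z))) powr (- \<delta>)"
    using s0 le d0 by (intro powr_mono2') auto
  also have "\<dots> = 2 powr \<delta> * (\<bar>Im z\<bar> powr (- \<delta>) * norm z powr (\<delta> / 2))"
    using nz by (simp add: powr_divide powr_mult powr_minus_divide powr_half_sqrt[symmetric] powr_powr)
  also have "\<dots> \<le> 2 * (\<bar>Im z\<bar> powr (- \<delta>) * norm z powr (\<delta> / 2))"
    using powr_mono[OF \<delta>(2), of 2] by (intro mult_right_mono) auto
  finally have pw: "Im \<mu> powr (- \<delta>) \<le> 2 * (\<bar>Im z\<bar> powr (- \<delta>) * norm z powr (\<delta> / 2))" .
  have "norm (weak_resolvent bc v z f x - weak_resolvent bc (\<lambda>x. 0) z f x) \<le> 200 * Lp_full_norm p v * Lp_full_norm a f * Im \<mu> powr (- \<delta>) / norm z"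
    using weak_resolvent_diff_estimate[OF m(2) i0 p a sm, of bc x] unfolding m(1) \<delta>(1) .
  also have "\<dots> \<le> 200 * Lp_full_norm p v * Lp_full_norm a f * (2 * (\<bar>Im z\<bar> powr (- \<delta>) * norm z powr (\<delta> / 2))) / norm z"
    using pw by (intro divide_right_mono mult_left_mono) (auto simp: Lp_full_norm_nonneg)
  also have "\<dots> = 400 * Lp_full_norm p v * Lp_full_norm a f * (\<bar>Im z\<bar> powr (- \<delta>) * (norm z powr (\<delta> / 2) * norm z powr (-1)))"
    using nz by (simp add: powr_minus_divide)
  also have "norm z powr (\<delta> / 2) * norm z powr (-1) = norm z powr (\<delta> / 2 - 1)"
    by (simp only: powr_add[symmetric]) (simp add: algebra_simps)
  finally show ?thesis .
qed

section \<open>Analyticity of the resolvent and operator-valued contour integrals\<close>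

lemma weak_resolvent_identity:
  assumes v: "L1 v" and z: "z \<in> resolvent_set bc v" and w: "w \<in> resolvent_set bc v" and f: "L1 f"
  shows "weak_resolvent bc v z f x - weak_resolvent bc v w f x = (w - z) * weak_resolvent bc v z (weak_resolvent bc v w f) x"
proof (cases "x \<in> {0..pi}")
  case True
  define u where "u = weak_resolvent bc v w f"
  obtain u1 where u: "solves_bvp bc v w f u u1" using weak_resolvent_is_sol[OF v w f] by (auto simp: u_def)
  have cu: "L1 u" using absolutely_integrable_continuous_real[OF solves_bvp_continuous[OF u]] .
  then have cu': "L1 (\<lambda>x. (z - w) * u x)" by simp
  have "solves_bvp bc v z (\<lambda>x. f x + (z - w) * u x) u u1"
    by (rule solves_bvp_change[OF u]) (simp add: algebra_simps)
  then have "weak_resolvent bc v z (\<lambda>x. f x + (z - w) * u x) x = u x" by (rule weak_resolvent_eq[OF z _ True])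
  then have "weak_resolvent bc v z f x + (z - w) * weak_resolvent bc v z u x = u x"
    using weak_resolvent_add[OF v z f cu', of x] weak_resolvent_cmult[OF v z cu, of "z - w" x] by simp
  then show ?thesis by (simp add: u_def algebra_simps)
next
  case False
  then show ?thesis unfolding weak_resolvent_def by (simp only: if_False) simp
qed

lemma weak_resolvent_absolutely_integrable:
  assumes "L1 v" "z \<in> resolvent_set bc v" "L1 f"
  shows "L1 (weak_resolvent bc v z f)"
  using absolutely_integrable_continuous_real[OF weak_resolvent_continuous[OF assms]] .

text \<open>
  A solution for z solves the problem for \<open>z0\<close> with right-hand side \<open>f + (z0 - z) u\<close>; for z
  close to \<open>z0\<close> the extra term is absorbed. With \<open>f = 0\<close> this also shows that z is no
  eigenvalue.
\<close>

lemma weak_resolvent_local_bound: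
  assumes v: "L1 v" and z0: "z0 \<in> resolvent_set bc v"
  obtains r M where "r > 0" "M \<ge> 0" "ball z0 r \<subseteq> resolvent_set bc v"
    "\<And>z f x. z \<in> ball z0 r \<Longrightarrow> L1 f \<Longrightarrow> norm (weak_resolvent bc v z f x) \<le> M * L1norm f"
proof -
  obtain M where M: "M \<ge> 0" "\<And>f x. L1 f \<Longrightarrow> norm (weak_resolvent bc v z0 f x) \<le> M * L1norm f"
    using weak_resolvent_bound[OF v z0] by metis
  \<comment> \<open>With this radius the absorbed term has at most half the size; pi is the length of the interval.\<close>
  define r where "r = 1 / (2 * pi * (M + 1))"
  have r: "r > 0" using M(1) by (simp add: r_def)
  have key: "norm (u x) \<le> 2 * M * L1norm f"
    if z: "z \<in> ball z0 r" and f: "L1 f" and u: "solves_bvp bc v z f u u1" and x: "x \<in> {0..pi}" for z f u u1 x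
  proof -
    have cu: "continuous_on {0..pi} u" using solves_bvp_continuous[OF u] .
    have "continuous_on {0..pi} (\<lambda>x. norm (u x))" using cu by (intro continuous_intros)
    then obtain x0 where x0: "x0 \<in> {0..pi}" "\<And>y. y \<in> {0..pi} \<Longrightarrow> norm (u y) \<le> norm (u x0)"
      using continuous_attains_sup[of "{0..pi}" "\<lambda>x. norm (u x)"] by auto
    define B where "B = norm (u x0)"
    have ui: "L1 (\<lambda>x. (z0 - z) * u x)" 
      using absolutely_integrable_continuous_real[OF cu] by simp
    have s: "solves_bvp bc v z0 (\<lambda>x. f x + (z0 - z) * u x) u u1"
      by (rule solves_bvp_change[OF u]) (simp add: algebra_simps)
    have Lu: "L1norm (\<lambda>x. (z0 - z) * u x) \<le> pi * (norm (z0 - z) * B)"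
    proof (rule L1norm_continuous_le)
      show "continuous_on {0..pi} (\<lambda>x. (z0 - z) * u x)" using cu by (intro continuous_intros)
      show "norm ((z0 - z) * u x) \<le> norm (z0 - z) * B" if "x \<in> {0..pi}" for x
        using x0(2)[OF that] by (simp add: norm_mult B_def mult_left_mono)
    qed
    have "B = norm (weak_resolvent bc v z0 (\<lambda>x. f x + (z0 - z) * u x) x0)" using weak_resolvent_eq[OF z0 s x0(1)] by (simp add: B_def)
    also have "\<dots> \<le> M * L1norm (\<lambda>x. f x + (z0 - z) * u x)" by (rule M(2)[OF set_integral_add(1)[OF f ui]])
    also have "\<dots> \<le> M * (L1norm f + pi * (norm (z0 - z) * B))"
      using L1norm_add_le[OF f ui] Lu by (intro mult_left_mono M(1)) linarith
    also have "\<dots> = M * L1norm f + (M * pi * norm (z0 - z)) * B" by (simp add: algebra_simps)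
    also have "\<dots> \<le> M * L1norm f + 1/2 * B"
    proof -
      have "M * pi * norm (z0 - z) \<le> (M + 1) * pi * r"
        using z M(1) by (intro mult_mono) (auto simp: dist_norm)
      also have "\<dots> = 1 / 2" using M(1) by (simp add: r_def)
      finally show ?thesis by (intro add_left_mono mult_right_mono) (auto simp: B_def)
    qed
    finally have "B \<le> 2 * M * L1norm f" by simp
    then show ?thesis using x0(2)[OF x] by (simp add: B_def)
  qed
  have sub: "ball z0 r \<subseteq> resolvent_set bc v"
  proof
    fix z assume z: "z \<in> ball z0 r"
    have "norm (y x) \<le> 2 * M * L1norm (\<lambda>x. 0)" if "solves_bvp bc v z (\<lambda>x. 0) y y1" "x \<in> {0..pi}" for y y1 x
      by (rule key[OF z _ that]) simp
    then show "z \<in> resolvent_set bc v" by (auto simp: resolvent_set_def L1norm_def)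
  qed
  have bd: "norm (weak_resolvent bc v z f x) \<le> 2 * M * L1norm f" if z: "z \<in> ball z0 r" and f: "L1 f" for z f x
  proof (cases "x \<in> {0..pi}")
    case True
    have zr: "z \<in> resolvent_set bc v" using sub z by auto
    obtain y1 where "solves_bvp bc v z f (weak_resolvent bc v z f) y1" using weak_resolvent_is_sol[OF v zr f] by blast
    then show ?thesis using key[OF z f _ True] by blast
  next
    case False
    then show ?thesis using M(1) L1norm_nonneg[of f] by (auto simp: weak_resolvent_def)
  qed
  show thesis by (rule that[OF r _ sub bd]) (use M(1) in auto)
qed

lemma open_resolvent_set:
  assumes "L1 v"
  shows "open (resolvent_set bc v)"
  unfolding open_contains_ball using weak_resolvent_local_bound[OF assms] by metis

text \<open>
  By the resolvent identity the difference quotient at \<open>z0\<close> is \<open>- R\<^sub>z (R\<^sub>z\<^sub>0 f)\<close>, and a second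
  use of the identity with the local bound gives its limit.
\<close>

lemma weak_resolvent_holomorphic:
  assumes v: "L1 v" and f: "L1 f"
  shows "(\<lambda>z. weak_resolvent bc v z f x) holomorphic_on resolvent_set bc v"
proof -
  have "\<exists>D. ((\<lambda>z. weak_resolvent bc v z f x) has_field_derivative D) (at z0)" if z0: "z0 \<in> resolvent_set bc v" for z0
  proof -
    obtain r M where r: "r > 0" "M \<ge> 0" "ball z0 r \<subseteq> resolvent_set bc v"
      "\<And>z f x. z \<in> ball z0 r \<Longrightarrow> L1 f \<Longrightarrow> norm (weak_resolvent bc v z f x) \<le> M * L1norm f"
      using weak_resolvent_local_bound[OF v z0] by metis
    define g where "g = weak_resolvent bc v z0 f"
    have g: "L1 g" unfolding g_def by (rule weak_resolvent_absolutely_integrable[OF v z0 f])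
    define h where "h = weak_resolvent bc v z0 g"
    have h: "L1 h" unfolding h_def by (rule weak_resolvent_absolutely_integrable[OF v z0 g])
    have ev: "\<forall>\<^sub>F z in at z0. z \<in> ball z0 r \<and> z \<noteq> z0"
      using r(1) by (simp add: eventually_at dist_commute) (auto intro!: exI[of _ r])
    have "((\<lambda>z. weak_resolvent bc v z g x) \<longlongrightarrow> weak_resolvent bc v z0 g x) (at z0)"
    proof (rule Lim_transform_bound[of "\<lambda>z. weak_resolvent bc v z g x - weak_resolvent bc v z0 g x", THEN LIM_zero_cancel])
      show "((\<lambda>z. norm (z0 - z) * (M * L1norm h)) \<longlongrightarrow> 0) (at z0)"
        by (auto intro!: tendsto_eq_intros)
      show "\<forall>\<^sub>F z in at z0. norm (weak_resolvent bc v z g x - weak_resolvent bc v z0 g x) \<le> norm (norm (z0 - z) * (M * L1norm h))"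
        using ev
      proof eventually_elim
        case (elim z)
        then have "z \<in> resolvent_set bc v" using r(3) by auto
        then have "norm (weak_resolvent bc v z g x - weak_resolvent bc v z0 g x) = norm (z0 - z) * norm (weak_resolvent bc v z h x)"
          using weak_resolvent_identity[OF v _ z0 g, of z x] by (simp add: h_def norm_mult)
        also have "\<dots> \<le> norm (z0 - z) * (M * L1norm h)" using r(4)[OF _ h] elim by (intro mult_left_mono) auto
        finally show ?case by simp
      qed
    qed
    then have "((\<lambda>z. - weak_resolvent bc v z g x) \<longlongrightarrow> - weak_resolvent bc v z0 g x) (at z0)" by (rule tendsto_minus)
    moreover have "\<forall>\<^sub>F z in at z0. - weak_resolvent bc v z g x = (weak_resolvent bc v z f x - weak_resolvent bc v z0 f x) / (z - z0)"
      using ev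
    proof eventually_elim
      case (elim z)
      then have "z \<in> resolvent_set bc v" using r(3) by auto
      then have "weak_resolvent bc v z f x - weak_resolvent bc v z0 f x = (z0 - z) * weak_resolvent bc v z g x"
        using weak_resolvent_identity[OF v _ z0 f, of z x] by (simp add: g_def)
      also have "\<dots> = - weak_resolvent bc v z g x * (z - z0)" by (simp add: algebra_simps)
      finally show ?case using elim by simp
    qed
    ultimately have "((\<lambda>z. (weak_resolvent bc v z f x - weak_resolvent bc v z0 f x) / (z - z0)) \<longlongrightarrow> - weak_resolvent bc v z0 g x) (at z0)"
      by (rule Lim_transform_eventually)
    then show ?thesis by (auto simp: has_field_derivative_iff)
  qed
  then show ?thesis using holomorphic_on_open[OF open_resolvent_set[OF v, of bc]] by blast
qed

lemma weak_resolvent_compact_bound: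
  assumes v: "L1 v" and S: "compact S" "S \<subseteq> resolvent_set bc v"
  obtains M where "M \<ge> 0" "\<And>z f x. z \<in> S \<Longrightarrow> L1 f \<Longrightarrow> norm (weak_resolvent bc v z f x) \<le> M * L1norm f"
proof -
  have "\<exists>r M. r > 0 \<and> M \<ge> 0 \<and> (\<forall>z f x. z \<in> ball z0 r \<longrightarrow> L1 f \<longrightarrow> norm (weak_resolvent bc v z f x) \<le> M * L1norm f)"
    if "z0 \<in> S" for z0
  proof -
    have "z0 \<in> resolvent_set bc v" using that S by auto
    then show ?thesis using weak_resolvent_local_bound[OF v, of z0 bc] by metis
  qed
  then obtain r m where rm: "\<And>z0. z0 \<in> S \<Longrightarrow> r z0 > 0 \<and> m z0 \<ge> 0"
    "\<And>z0 z f x. z0 \<in> S \<Longrightarrow> z \<in> ball z0 (r z0) \<Longrightarrow> L1 f \<Longrightarrow> norm (weak_resolvent bc v z f x) \<le> m z0 * L1norm f"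
    by metis
  obtain C where C: "C \<subseteq> S" "finite C" "S \<subseteq> (\<Union>c\<in>C. ball c (r c))"
    by (rule compactE_image[OF S(1), of S "\<lambda>c. ball c (r c)"]) (use rm in \<open>auto intro!: UN_I\<close>)
  define M where "M = (\<Sum>c\<in>C. m c)"
  have M: "m c \<le> M" if "c \<in> C" for c
    unfolding M_def using C rm(1) that by (intro member_le_sum) auto
  have "M \<ge> 0" unfolding M_def using C rm(1) by (intro sum_nonneg) auto
  moreover have "norm (weak_resolvent bc v z f x) \<le> M * L1norm f" if z: "z \<in> S" and f: "L1 f" for z f x
  proof -
    obtain c where c: "c \<in> C" "z \<in> ball c (r c)" using C z by auto
    have "norm (weak_resolvent bc v z f x) \<le> m c * L1norm f" using rm(2)[OF _ c(2) f] c(1) C(1) by auto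
    also have "\<dots> \<le> M * L1norm f" by (intro mult_right_mono M c L1norm_nonneg)
    finally show ?thesis .
  qed
  ultimately show thesis using that by blast
qed

lemma weak_resolvent_Lipschitz:
  assumes v: "L1 v" and S: "S \<subseteq> resolvent_set bc v"
    and M: "M \<ge> 0" "\<And>z f x. z \<in> S \<Longrightarrow> L1 f \<Longrightarrow> norm (weak_resolvent bc v z f x) \<le> M * L1norm f"
    and z: "z \<in> S" and w: "w \<in> S" and f: "L1 f"
  shows "norm (weak_resolvent bc v z f x - weak_resolvent bc v w f x) \<le> norm (z - w) * (M * pi * M * L1norm f)"
proof -
  have zr: "z \<in> resolvent_set bc v" and wr: "w \<in> resolvent_set bc v" using z w S by auto
  define g where "g = weak_resolvent bc v w f"
  have g: "L1 g" unfolding g_def by (rule weak_resolvent_absolutely_integrable[OF v wr f])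
  have Lg: "L1norm g \<le> pi * (M * L1norm f)"
    by (rule L1norm_continuous_le) (use weak_resolvent_continuous[OF v wr f] M(2)[OF w f] in \<open>auto simp: g_def\<close>)
  have "norm (weak_resolvent bc v z f x - weak_resolvent bc v w f x) = norm (z - w) * norm (weak_resolvent bc v z g x)"
    unfolding weak_resolvent_identity[OF v zr wr f] g_def by (simp add: norm_mult norm_minus_commute)
  also have "\<dots> \<le> norm (z - w) * (M * (pi * (M * L1norm f)))"
    using M(2)[OF z g] mult_left_mono[OF Lg M(1)] by (intro mult_left_mono) (auto intro: order_trans)
  finally show ?thesis by (simp add: mult.assoc)
qed

text \<open>
  Integrability of continuous functions is available for values in a Banach space. Convergence
  of the Riemann sums in operator norm is obtained from it by viewing the resolvents as bounded
  functions of the pair \<open>(f, x)\<close>.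
\<close>

instance bcontfun :: (metric_space, banach) banach ..

text \<open>
  The index type carries the discrete topology, which makes every bounded function on it an
  element of the Banach space of bounded continuous functions. Dividing by \<open>\<parallel>f\<parallel>\<^sub>1\<close> makes the
  supremum norm the operator norm from \<open>L\<^sup>1\<close> to the bounded functions; where \<open>\<parallel>f\<parallel>\<^sub>1 = 0\<close> the
  quotient is 0, as is the resolvent. The factor d stands for the derivative of the contour.
\<close>

definition resolvent_family :: "bc \<Rightarrow> (real \<Rightarrow> complex) \<Rightarrow> complex \<Rightarrow> complex \<Rightarrow> ((real \<Rightarrow> complex) \<times> real) discrete \<Rightarrow>\<^sub>C complex" where
  "resolvent_family bc v z d = Bcontfun (\<lambda>i. case of_discrete i of (f, x) \<Rightarrow>
     if L1 f then weak_resolvent bc v z f x * d / of_real (L1norm f) else 0)"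

lemma continuous_on_discrete_type: "continuous_on S (g :: 'a discrete \<Rightarrow> 'b::topological_space)"
proof -
  have "continuous_on UNIV g" by (simp add: continuous_on_open_vimage open_discrete)
  then show ?thesis by (rule continuous_on_subset) simp
qed

lemma resolvent_family_apply:
  assumes v: "L1 v" and z: "z \<in> resolvent_set bc v"
  shows "apply_bcontfun (resolvent_family bc v z d) i = (case of_discrete i of (f, x) \<Rightarrow>
     if L1 f then weak_resolvent bc v z f x * d / of_real (L1norm f) else 0)"
proof -
  obtain M where M: "M \<ge> 0" "\<And>f x. L1 f \<Longrightarrow> norm (weak_resolvent bc v z f x) \<le> M * L1norm f"
    using weak_resolvent_bound[OF v z] by metis
  have b: "norm (case i of (f, x) \<Rightarrow>
     if L1 f then weak_resolvent bc v z f x * d / of_real (L1norm f) else 0) \<le> M * norm d" for i :: "(real \<Rightarrow> complex) \<times> real"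
  proof (cases i)
    case (Pair f x)
    show ?thesis
    proof (cases "L1 f")
      case True
      show ?thesis
      proof (cases "L1norm f = 0")
        case False
        then have "L1norm f > 0" using L1norm_nonneg[of f] by simp
        moreover have "norm (weak_resolvent bc v z f x) * norm d \<le> M * L1norm f * norm d" using M(2)[OF True] by (rule mult_right_mono) simp
        ultimately show ?thesis using True Pair by (simp add: norm_mult norm_divide field_simps)
      qed (use Pair M(1) in simp)
    qed (use Pair M(1) in simp)
  qed
  have "(\<lambda>i. case of_discrete i of (f, x) \<Rightarrow>
     if L1 f then weak_resolvent bc v z f x * d / of_real (L1norm f) else 0) \<in> bcontfun"
    unfolding bcontfun_def
  proof (intro CollectI conjI continuous_on_discrete_type)
    show "bounded (range (\<lambda>i. case of_discrete i of (f, x) \<Rightarrow>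
     if L1 f then weak_resolvent bc v z f x * d / of_real (L1norm f) else 0))"
    proof (rule boundedI)
      fix y assume "y \<in> range (\<lambda>i. case of_discrete i of (f, x) \<Rightarrow>
     if L1 f then weak_resolvent bc v z f x * d / of_real (L1norm f) else 0)"
      then show "norm y \<le> M * norm d" using b by blast
    qed
  qed
  then show ?thesis by (simp add: resolvent_family_def Bcontfun_inverse)
qed

lemma resolvent_family_Lipschitz:
  assumes v: "L1 v" and S: "S \<subseteq> resolvent_set bc v"
    and M: "M \<ge> 0" "\<And>z f x. z \<in> S \<Longrightarrow> L1 f \<Longrightarrow> norm (weak_resolvent bc v z f x) \<le> M * L1norm f"
    and z: "z \<in> S" and w: "w \<in> S"
  shows "dist (resolvent_family bc v z d) (resolvent_family bc v w d) \<le> norm (z - w) * (M * pi * M) * norm d"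
proof (rule dist_bound)
  fix i :: "((real \<Rightarrow> complex) \<times> real) discrete"
  obtain f x where i: "of_discrete i = (f, x)" by (cases "of_discrete i")
  have zr: "z \<in> resolvent_set bc v" and wr: "w \<in> resolvent_set bc v" using z w S by auto
  show "dist (apply_bcontfun (resolvent_family bc v z d) i) (apply_bcontfun (resolvent_family bc v w d) i) \<le> norm (z - w) * (M * pi * M) * norm d"
  proof (cases "L1 f \<and> L1norm f \<noteq> 0")
    case True
    then have n: "L1norm f > 0" using L1norm_nonneg[of f] by simp
    have "dist (apply_bcontfun (resolvent_family bc v z d) i) (apply_bcontfun (resolvent_family bc v w d) i) =
       norm (weak_resolvent bc v z f x - weak_resolvent bc v w f x) * norm d / L1norm f"
      using True n unfolding resolvent_family_apply[OF v zr] resolvent_family_apply[OF v wr] i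
      by (simp add: dist_norm norm_mult[symmetric] norm_divide left_diff_distrib diff_divide_distrib[symmetric])
    also have "\<dots> \<le> (norm (z - w) * (M * pi * M * L1norm f)) * norm d / L1norm f"
      using weak_resolvent_Lipschitz[OF v S M z w, of f x] True n by (intro divide_right_mono mult_right_mono) auto
    also have "\<dots> = norm (z - w) * (M * pi * M) * norm d" using n by simp
    finally show ?thesis .
  next
    case False
    then show ?thesis unfolding resolvent_family_apply[OF v zr] resolvent_family_apply[OF v wr] i using M(1) by auto
  qed
qed

text \<open>
  On a piece where the contour is affine the integrand agrees, except at the endpoints, with a
  Lipschitz function; at the corners the derivative of the contour has no meaning.
\<close>

lemma resolvent_family_integrable_piece:
  assumes v: "L1 v" and S: "S \<subseteq> resolvent_set bc v"
    and M: "M \<ge> 0" "\<And>z f x. z \<in> S \<Longrightarrow> L1 f \<Longrightarrow> norm (weak_resolvent bc v z f x) \<le> M * L1norm f"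
    and st: "0 \<le> s" "s < t" "t \<le> 1"
    and g: "\<And>r. r \<in> {s..t} \<Longrightarrow> g r = \<alpha> + of_real r * \<beta>" "\<And>r. r \<in> {s..t} \<Longrightarrow> g r \<in> S"
  shows "(\<lambda>r. resolvent_family bc v (g r) (vector_derivative g (at r within {0..1}))) integrable_on {s..t}"
proof -
  define L where "L = norm \<beta> * (M * pi * M) * norm \<beta>"
  have L: "L \<ge> 0" using M(1) by (simp add: L_def)
  have "L-lipschitz_on {s..t} (\<lambda>r. resolvent_family bc v (\<alpha> + of_real r * \<beta>) \<beta>)"
  proof (rule lipschitz_onI[OF _ L])
    fix x y assume xy: "x \<in> {s..t}" "y \<in> {s..t}"
    have "dist (resolvent_family bc v (\<alpha> + of_real x * \<beta>) \<beta>) (resolvent_family bc v (\<alpha> + of_real y * \<beta>) \<beta>) \<le> norm ((\<alpha> + of_real x * \<beta>) - (\<alpha> + of_real y * \<beta>)) * (M * pi * M) * norm \<beta>"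
      by (rule resolvent_family_Lipschitz[OF v S M]) (use g xy in \<open>auto simp flip: g(1)\<close>)
    also have "(\<alpha> + of_real x * \<beta>) - (\<alpha> + of_real y * \<beta>) = of_real (x - y) * \<beta>" by (simp add: algebra_simps)
    finally show "dist (resolvent_family bc v (\<alpha> + of_real x * \<beta>) \<beta>) (resolvent_family bc v (\<alpha> + of_real y * \<beta>) \<beta>) \<le> L * dist x y"
      by (simp add: L_def norm_mult dist_norm mult_ac del: of_real_diff)
  qed
  then have "continuous_on {s..t} (\<lambda>r. resolvent_family bc v (\<alpha> + of_real r * \<beta>) \<beta>)" by (rule lipschitz_on_continuous_on)
  then have i: "(\<lambda>r. resolvent_family bc v (\<alpha> + of_real r * \<beta>) \<beta>) integrable_on {s..t}" by (rule integrable_continuous_real)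
  have vd: "vector_derivative g (at r within {0..1}) = \<beta>" if r: "r \<in> {s<..<t}" for r
  proof -
    have "((\<lambda>r. \<alpha> + of_real r * \<beta>) has_vector_derivative \<beta>) (at r)"
      by (auto intro!: derivative_eq_intros)
    then have "(g has_vector_derivative \<beta>) (at r)"
      by (rule has_vector_derivative_transform_within_open[of _ _ _ "{s<..<t}"]) (use r g(1) in auto)
    moreover have "at r within {0..1} = at r" by (rule at_within_Icc_at) (use r st in auto)
    ultimately show ?thesis by (simp add: vector_derivative_at)
  qed
  show ?thesis
    by (rule integrable_spike_finite[OF _ _ i, of "{s, t}"]) (use vd g(1) in auto)
qed

lemma resolvent_family_integrable:
  assumes v: "L1 v" and S: "path_image (rectpath a b) \<subseteq> resolvent_set bc v"
  shows "(\<lambda>r. resolvent_family bc v (rectpath a b r) (vector_derivative (rectpath a b) (at r within {0..1}))) integrable_on {0..1}"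
proof -
  let ?g = "rectpath a b"
  have cS: "compact (path_image ?g)" by (rule compact_path_image) simp
  obtain M where M: "M \<ge> 0" "\<And>z f x. z \<in> path_image ?g \<Longrightarrow> L1 f \<Longrightarrow> norm (weak_resolvent bc v z f x) \<le> M * L1norm f"
    using weak_resolvent_compact_bound[OF v cS S] by metis
  have gS: "?g r \<in> path_image ?g" if "r \<in> {0..1}" for r using that by (auto simp: path_image_def)
  define c d where "c = Complex (Re b) (Im a)" and "d = Complex (Re a) (Im b)"
  have rp: "?g = linepath a c +++ linepath c b +++ linepath b d +++ linepath d a"
    by (simp add: rectpath_def c_def d_def Let_def)
  note piece = resolvent_family_integrable_piece[OF v S M]
  have 1: "(\<lambda>r. resolvent_family bc v (?g r) (vector_derivative ?g (at r within {0..1}))) integrable_on {0..1/2}"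
  proof (rule piece[where \<alpha>=a and \<beta>="2 * (c - a)"])
    show "?g r = a + of_real r * (2 * (c - a))" if "r \<in> {0..1/2}" for r
      using that by (auto simp: rp joinpaths_def linepath_def scaleR_conv_of_real algebra_simps)
  qed (use gS in auto)
  have 2: "(\<lambda>r. resolvent_family bc v (?g r) (vector_derivative ?g (at r within {0..1}))) integrable_on {1/2..3/4}"
  proof (rule piece[where \<alpha>="3 * c - 2 * b" and \<beta>="4 * (b - c)"])
    show "?g r = 3 * c - 2 * b + of_real r * (4 * (b - c))" if "r \<in> {1/2..3/4}" for r
    proof (cases "r = 1/2")
      case True
      show ?thesis unfolding True by (simp add: rp joinpaths_def linepath_def scaleR_conv_of_real field_simps)
    next
      case False
      then show ?thesis using that by (auto simp: rp joinpaths_def linepath_def scaleR_conv_of_real algebra_simps)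
    qed
  qed (use gS in auto)
  have 3: "(\<lambda>r. resolvent_family bc v (?g r) (vector_derivative ?g (at r within {0..1}))) integrable_on {3/4..7/8}"
  proof (rule piece[where \<alpha>="7 * b - 6 * d" and \<beta>="8 * (d - b)"])
    show "?g r = 7 * b - 6 * d + of_real r * (8 * (d - b))" if "r \<in> {3/4..7/8}" for r
    proof (cases "r = 3/4")
      case True
      show ?thesis unfolding True by (simp add: rp joinpaths_def linepath_def scaleR_conv_of_real field_simps)
    next
      case False
      then show ?thesis using that by (auto simp: rp joinpaths_def linepath_def scaleR_conv_of_real algebra_simps)
    qed
  qed (use gS in auto)
  have 4: "(\<lambda>r. resolvent_family bc v (?g r) (vector_derivative ?g (at r within {0..1}))) integrable_on {7/8..1}"
  proof (rule piece[where \<alpha>="8 * d - 7 * a" and \<beta>="8 * (a - d)"])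
    show "?g r = 8 * d - 7 * a + of_real r * (8 * (a - d))" if "r \<in> {7/8..1}" for r
    proof (cases "r = 7/8")
      case True
      show ?thesis unfolding True by (simp add: rp joinpaths_def linepath_def scaleR_conv_of_real field_simps)
    next
      case False
      then show ?thesis using that by (auto simp: rp joinpaths_def linepath_def scaleR_conv_of_real algebra_simps)
    qed
  qed (use gS in auto)
  have 12: "(\<lambda>r. resolvent_family bc v (?g r) (vector_derivative ?g (at r within {0..1}))) integrable_on {0..3/4}"
    by (rule Henstock_Kurzweil_Integration.integrable_combine[OF _ _ 1 2]) auto
  have 13: "(\<lambda>r. resolvent_family bc v (?g r) (vector_derivative ?g (at r within {0..1}))) integrable_on {0..7/8}"
    by (rule Henstock_Kurzweil_Integration.integrable_combine[OF _ _ 12 3]) auto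
  show ?thesis
    by (rule Henstock_Kurzweil_Integration.integrable_combine[OF _ _ 13 4]) auto
qed

abbreviation riemann_sum :: "(real \<times> real set) set \<Rightarrow> (real \<Rightarrow> complex) \<Rightarrow> (complex \<Rightarrow> complex) \<Rightarrow> complex" where
  "riemann_sum p g F \<equiv> \<Sum>(t,k)\<in>p. measure lborel k *\<^sub>R (F (g t) * vector_derivative g (at t within {0..1}))"

text \<open>
  Being defined for all integrable f, this is already the extension required in the definition
  of the operator norm from \<open>L\<^sup>a\<close> to the continuous functions.
\<close>

definition spectral_op :: "bc \<Rightarrow> (real \<Rightarrow> complex) \<Rightarrow> (real \<Rightarrow> complex) \<Rightarrow> (real \<Rightarrow> complex) \<Rightarrow> real \<Rightarrow> complex" where
  "spectral_op bc v g f x = contour_integral g (\<lambda>z. weak_resolvent bc v z f x) / (2 * of_real pi * \<i>)"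

lemma weak_resolvent_contour_integrable:
  assumes v: "L1 v" and S: "path_image (rectpath a b) \<subseteq> resolvent_set bc v" and f: "L1 f"
  shows "(\<lambda>z. weak_resolvent bc v z f x) contour_integrable_on rectpath a b"
  by (rule contour_integrable_holomorphic_simple[OF weak_resolvent_holomorphic[OF v f] open_resolvent_set[OF v] _ S]) simp

text \<open>
  The integral of the Banach-space valued family, evaluated at \<open>(f, x)\<close>, is the pointwise
  contour integral; so the Riemann sums converge to it uniformly in x, and in f relative to
  \<open>\<parallel>f\<parallel>\<^sub>1\<close>.
\<close>

lemma spectral_op_approx:
  assumes v: "L1 v" and S: "path_image (rectpath a b) \<subseteq> resolvent_set bc v" and e: "e > 0"
  shows "eventually (\<lambda>p. p tagged_division_of {0..1} \<and> (\<forall>f x. L1 f \<longrightarrow>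
     norm (riemann_sum p (rectpath a b) (\<lambda>z. weak_resolvent bc v z f x)
        - 2 * of_real pi * \<i> * spectral_op bc v (rectpath a b) f x) \<le> e * L1norm f)) (division_filter {0..1::real})"
proof -
  let ?g = "rectpath a b"
  let ?\<Phi> = "\<lambda>r. resolvent_family bc v (?g r) (vector_derivative ?g (at r within {0..1}))"
  have gr: "?g t \<in> resolvent_set bc v" if "t \<in> {0..1}" for t using that S by (auto simp: path_image_def)
  obtain I where I: "(?\<Phi> has_integral I) {0..1}" using resolvent_family_integrable[OF v S] by blast
  have ev: "\<forall>\<^sub>F p in division_filter {0..1::real}. p tagged_division_of {0..1}"
    using eventually_division_filter_tagged_division[of "{0..1::real}"] .
  have lim: "((\<lambda>p. \<Sum>(x,k)\<in>p. measure lborel k *\<^sub>R ?\<Phi> x) \<longlongrightarrow> I) (division_filter {0..1})"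
    using I has_integral_cbox[of ?\<Phi> I 0 1] by simp
  have ev2: "\<forall>\<^sub>F p in division_filter {0..1::real}. dist (\<Sum>(x,k)\<in>p. measure lborel k *\<^sub>R ?\<Phi> x) I < e"
    by (rule tendstoD[OF lim e])
  have bl: "bounded_linear (\<lambda>F. apply_bcontfun F i)" for i :: "((real \<Rightarrow> complex) \<times> real) discrete"
    by (rule bounded_linear_intro[where K=1]) (auto simp: norm_bounded)
  have Iv: "2 * of_real pi * \<i> * spectral_op bc v ?g f x = apply_bcontfun I (discrete (f, x)) * of_real (L1norm f)"
    if f: "L1 f" for f x
  proof -
    have "((\<lambda>r. apply_bcontfun (?\<Phi> r) (discrete (f, x))) has_integral apply_bcontfun I (discrete (f, x))) {0..1}"
      using has_integral_linear[OF I bl[of "discrete (f, x)"]] by (simp add: comp_def)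
    then have "((\<lambda>r. apply_bcontfun (?\<Phi> r) (discrete (f, x)) * of_real (L1norm f)) has_integral apply_bcontfun I (discrete (f, x)) * of_real (L1norm f)) {0..1}"
      by (rule has_integral_mult_left)
    then have "((\<lambda>r. weak_resolvent bc v (?g r) f x * vector_derivative ?g (at r within {0..1})) has_integral apply_bcontfun I (discrete (f, x)) * of_real (L1norm f)) {0..1}"
    proof (rule has_integral_eq[rotated])
      fix r :: real assume r: "r \<in> {0..1}"
      have "weak_resolvent bc v (?g r) f x = 0" if "L1norm f = 0"
        using weak_resolvent_bound[OF v gr[OF r]] f that by (metis mult_zero_right norm_le_zero_iff)
      then show "apply_bcontfun (?\<Phi> r) (discrete (f, x)) * of_real (L1norm f) = weak_resolvent bc v (?g r) f x * vector_derivative ?g (at r within {0..1})"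
        using f by (auto simp: resolvent_family_apply[OF v gr[OF r]] discrete_inverse)
    qed
    then have "((\<lambda>z. weak_resolvent bc v z f x) has_contour_integral apply_bcontfun I (discrete (f, x)) * of_real (L1norm f)) ?g"
      by (simp add: has_contour_integral_def)
    then have "contour_integral ?g (\<lambda>z. weak_resolvent bc v z f x) = apply_bcontfun I (discrete (f, x)) * of_real (L1norm f)"
      by (rule contour_integral_unique)
    then show ?thesis by (simp add: spectral_op_def)
  qed
  from ev ev2 show ?thesis
  proof eventually_elim
    case (elim p)
    have fin: "finite p" using elim(1) by blast
    have "norm (riemann_sum p ?g (\<lambda>z. weak_resolvent bc v z f x)
        - 2 * of_real pi * \<i> * spectral_op bc v ?g f x) \<le> e * L1norm f" if f: "L1 f" for f x
    proof -
      let ?i = "discrete (f, x)"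
      have tr: "measure lborel k *\<^sub>R (weak_resolvent bc v (?g t) f x * vector_derivative ?g (at t within {0..1})) =
          measure lborel k *\<^sub>R apply_bcontfun (?\<Phi> t) ?i * of_real (L1norm f)" if "(t, k) \<in> p" for t k
      proof -
        have t: "t \<in> {0..1}" using tag_in_interval[OF elim(1)] that elim(1) by blast
        have "weak_resolvent bc v (?g t) f x = 0" if "L1norm f = 0"
          using weak_resolvent_bound[OF v gr[OF t]] f that by (metis mult_zero_right norm_le_zero_iff)
        then show ?thesis using f by (auto simp: resolvent_family_apply[OF v gr[OF t]] discrete_inverse)
      qed
      have ap: "apply_bcontfun (\<Sum>(x,k)\<in>p. measure lborel k *\<^sub>R ?\<Phi> x) ?i = (\<Sum>(x,k)\<in>p. measure lborel k *\<^sub>R apply_bcontfun (?\<Phi> x) ?i)"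
        using linear_sum[OF bounded_linear.linear[OF bl[of ?i]], of "\<lambda>(x,k). measure lborel k *\<^sub>R ?\<Phi> x" p]
        by (simp add: case_prod_unfold)
      have "riemann_sum p ?g (\<lambda>z. weak_resolvent bc v z f x) =
         (\<Sum>(t,k)\<in>p. measure lborel k *\<^sub>R apply_bcontfun (?\<Phi> t) ?i * of_real (L1norm f))"
        by (rule sum.cong[OF refl]) (use tr in auto)
      also have "\<dots> = apply_bcontfun (\<Sum>(x,k)\<in>p. measure lborel k *\<^sub>R ?\<Phi> x) ?i * of_real (L1norm f)"
        unfolding ap sum_distrib_right by (simp add: case_prod_unfold)
      finally have eq: "riemann_sum p ?g (\<lambda>z. weak_resolvent bc v z f x)
        - 2 * of_real pi * \<i> * spectral_op bc v ?g f x =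
        (apply_bcontfun (\<Sum>(x,k)\<in>p. measure lborel k *\<^sub>R ?\<Phi> x) ?i - apply_bcontfun I ?i) * of_real (L1norm f)"
        unfolding Iv[OF f] by (simp add: left_diff_distrib)
      have "norm (apply_bcontfun (\<Sum>(x,k)\<in>p. measure lborel k *\<^sub>R ?\<Phi> x) ?i - apply_bcontfun I ?i) \<le> e"
        using dist_bounded[of "\<Sum>(x,k)\<in>p. measure lborel k *\<^sub>R ?\<Phi> x" ?i I] elim(2) by (simp add: dist_norm)
      then show ?thesis unfolding eq norm_mult using L1norm_nonneg[of f] by (simp add: mult_right_mono)
    qed
    then show ?case using elim(1) by blast
  qed
qed

lemma spectral_op_continuous:
  assumes v: "L1 v" and S: "path_image (rectpath a b) \<subseteq> resolvent_set bc v" and f: "L1 f"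
  shows "continuous_on {0..pi} (spectral_op bc v (rectpath a b) f)"
proof -
  let ?g = "rectpath a b"
  let ?R = "\<lambda>p x. riemann_sum p ?g (\<lambda>z. weak_resolvent bc v z f x)"
  have gr: "?g t \<in> resolvent_set bc v" if "t \<in> {0..1}" for t using that S by (auto simp: path_image_def)
  have "continuous_on {0..pi} (\<lambda>x. 2 * of_real pi * \<i> * spectral_op bc v ?g f x)"
  proof (rule uniform_limit_theorem[where F="division_filter {0..1::real}" and f="?R"])
    show "\<forall>\<^sub>F p in division_filter {0..1}. continuous_on {0..pi} (?R p)"
      using spectral_op_approx[OF v S zero_less_one]
    proof eventually_elim
      case (elim p)
      then have p: "p tagged_division_of {0..1}" by blast
      have "continuous_on {0..pi} (\<lambda>x. measure lborel k *\<^sub>R (weak_resolvent bc v (?g t) f x * vector_derivative ?g (at t within {0..1})))"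
        if "(t, k) \<in> p" for t k
      proof -
        have "t \<in> {0..1}" using tag_in_interval[OF p] that p by blast
        then show ?thesis using weak_resolvent_continuous[OF v gr f] by (intro continuous_intros)
      qed
      then show ?case by (intro continuous_on_sum) auto
    qed
    show "uniform_limit {0..pi} ?R (\<lambda>x. 2 * of_real pi * \<i> * spectral_op bc v ?g f x) (division_filter {0..1})"
      unfolding uniform_limit_iff
    proof (intro allI impI)
      fix e :: real assume e: "e > 0"
      have n: "L1norm f + 1 > 0" using L1norm_nonneg[of f] by linarith
      then have e': "e / (L1norm f + 1) > 0" using e by simp
      show "\<forall>\<^sub>F p in division_filter {0..1}. \<forall>x\<in>{0..pi}. dist (?R p x) (2 * of_real pi * \<i> * spectral_op bc v ?g f x) < e"
        using spectral_op_approx[OF v S e']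
      proof eventually_elim
        case (elim p)
        have "e / (L1norm f + 1) * L1norm f < e" using e n by (simp add: field_simps)
        then show ?case using elim f by (auto simp: dist_norm intro: order.strict_trans1)
      qed
    qed
    show "division_filter {0..1::real} \<noteq> bot" using division_filter_not_empty[of 0 "1::real"] by simp
  qed
  then have "continuous_on {0..pi} (\<lambda>x. (2 * of_real pi * \<i> * spectral_op bc v ?g f x) / (2 * of_real pi * \<i>))"
    by (rule continuous_on_divide[OF _ continuous_on_const]) simp
  moreover have "(\<lambda>x. (2 * of_real pi * \<i> * spectral_op bc v ?g f x) / (2 * of_real pi * \<i>)) = spectral_op bc v ?g f"
    by (intro ext) simp
  ultimately show ?thesis by metis
qed

lemma Lp_norm_le_sup:
  assumes h: "continuous_on {0..pi} h" "\<And>x. x \<in> {0..pi} \<Longrightarrow> norm (h x) \<le> B" "B \<ge> 0"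
  shows "Lp_norm 2 h \<le> B"
proof -
  have h2: "h \<in> Lp 2" by (rule continuous_Lp2[OF h(1)])
  have i: "integrable M_pi (\<lambda>x. norm (h x) powr 2)" using h2 by (simp add: Lp_def)
  have e: "(LINT x|M_pi. norm (h x) powr 2) = integral {0..pi} (\<lambda>x. norm (h x) powr 2)"
    by (rule lebesgue_integral_eq_integral[OF i]) simp
  have hi: "(\<lambda>x. norm (h x) powr 2) integrable_on {0..pi}" using h2 by (auto simp: Lp_iff absolutely_integrable_on_def)
  have "integral {0..pi} (\<lambda>x. norm (h x) powr 2) \<le> integral {0..pi} (\<lambda>x. B powr 2)"
    by (rule integral_le[OF hi]) (use h in \<open>auto intro!: powr_mono2\<close>)
  then have "1 / pi * integral {0..pi} (\<lambda>x. norm (h x) powr 2) \<le> B powr 2" by (simp add: field_simps)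
  moreover have "0 \<le> 1 / pi * integral {0..pi} (\<lambda>x. norm (h x) powr 2)" using hi by (intro mult_nonneg_nonneg integral_nonneg) auto
  ultimately have "Lp_norm 2 h \<le> (B powr 2) powr (1/2)" unfolding Lp_norm_def e by (intro powr_mono2) auto
  then show ?thesis using h(3) by (simp add: powr_powr)
qed

lemma is_S_spectral_op:
  assumes v: "L1 v" and S: "path_image (Pi_boundary \<omega> h N) \<subseteq> resolvent_set bc v"
  shows "is_S bc v N \<omega> h (spectral_op bc v (Pi_boundary \<omega> h N))"
  unfolding is_S_def has_operator_contour_integral_def
proof (intro allI impI)
  fix e :: real assume e: "e > 0"
  then have e': "e / pi > 0" by simp
  obtain a b where g: "Pi_boundary \<omega> h N = rectpath a b" by (simp add: Pi_boundary_def)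
  let ?g = "rectpath a b"
  have S': "path_image ?g \<subseteq> resolvent_set bc v" using S g by simp
  have gr: "?g t \<in> resolvent_set bc v" if "t \<in> {0..1}" for t using that S' by (auto simp: path_image_def)
  show "\<forall>\<^sub>F p in division_filter {0..1}. L2_opnorm_le (\<lambda>f x. riemann_sum p (Pi_boundary \<omega> h N) (\<lambda>z. resolvent bc v z f x) -
        2 * of_real pi * \<i> * spectral_op bc v (Pi_boundary \<omega> h N) f x) e"
    unfolding g using spectral_op_approx[OF v S' e']
  proof eventually_elim
    case (elim p)
    then have p: "p tagged_division_of {0..1}" by blast
    show ?case unfolding L2_opnorm_le_def
    proof
      fix f assume f: "f \<in> Lp 2"
      have fa: "L1 f" using f by (simp add: Lp2_iff)
      have pt: "t \<in> {0..1}" if "(t, k) \<in> p" for t k using tag_in_interval[OF p] that p by blast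
      define R where "R x = riemann_sum p ?g (\<lambda>z. resolvent bc v z f x) - 2 * of_real pi * \<i> * spectral_op bc v ?g f x" for x
      have Rw: "R x = riemann_sum p ?g (\<lambda>z. weak_resolvent bc v z f x) - 2 * of_real pi * \<i> * spectral_op bc v ?g f x" for x
        unfolding R_def by (intro arg_cong2[where f="(-)"] sum.cong refl) (auto simp: resolvent_eq_weak_resolvent[OF v gr[OF pt] f])
      have cR: "continuous_on {0..pi} R"
        unfolding Rw
      proof (intro continuous_on_diff continuous_on_sum)
        fix q assume q: "q \<in> p"
        obtain t k where tk: "q = (t, k)" by (cases q)
        have "continuous_on {0..pi} (\<lambda>x. measure lborel k *\<^sub>R (weak_resolvent bc v (?g t) f x * vector_derivative ?g (at t within {0..1})))"
          using weak_resolvent_continuous[OF v gr[OF pt] fa] q tk by (intro continuous_intros) auto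
        then show "continuous_on {0..pi} (\<lambda>x. case q of (t, k) \<Rightarrow> measure lborel k *\<^sub>R (weak_resolvent bc v (?g t) f x * vector_derivative ?g (at t within {0..1})))"
          by (simp add: tk)
      qed (intro continuous_intros spectral_op_continuous[OF v S' fa])
      have bR: "norm (R x) \<le> e / pi * L1norm f" for x unfolding Rw using elim fa by blast
      have "Lp_norm 2 R \<le> e / pi * L1norm f"
        by (rule Lp_norm_le_sup[OF cR bR]) (use e L1norm_nonneg[of f] in auto)
      also have "\<dots> \<le> e / pi * (pi * Lp_norm 2 f)" using e L1norm_le_Lp_norm[OF f] by (intro mult_left_mono) auto
      also have "\<dots> = e * Lp_norm 2 f" by simp
      finally show "(\<lambda>x. riemann_sum p ?g (\<lambda>z. resolvent bc v z f x) - 2 * of_real pi * \<i> * spectral_op bc v ?g f x) \<in> Lp 2 \<and>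
         Lp_norm 2 (\<lambda>x. riemann_sum p ?g (\<lambda>z. resolvent bc v z f x) - 2 * of_real pi * \<i> * spectral_op bc v ?g f x) \<le> e * Lp_norm 2 f"
        using continuous_Lp2[OF cR] unfolding R_def[abs_def] by blast
    qed
  qed
qed

lemma spectral_op_add:
  assumes v: "L1 v" and S: "path_image (rectpath a b) \<subseteq> resolvent_set bc v"
    and f: "L1 f" and g: "L1 g"
  shows "spectral_op bc v (rectpath a b) (\<lambda>t. f t + g t) x = spectral_op bc v (rectpath a b) f x + spectral_op bc v (rectpath a b) g x"
proof -
  have "contour_integral (rectpath a b) (\<lambda>z. weak_resolvent bc v z (\<lambda>t. f t + g t) x) = contour_integral (rectpath a b) (\<lambda>z. weak_resolvent bc v z f x + weak_resolvent bc v z g x)"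
    using S by (intro contour_integral_eq weak_resolvent_add[OF v _ f g]) auto
  also have "\<dots> = contour_integral (rectpath a b) (\<lambda>z. weak_resolvent bc v z f x) + contour_integral (rectpath a b) (\<lambda>z. weak_resolvent bc v z g x)"
    by (intro contour_integral_add weak_resolvent_contour_integrable v S f g)
  finally show ?thesis by (simp add: spectral_op_def add_divide_distrib)
qed

lemma spectral_op_cmult:
  assumes v: "L1 v" and S: "path_image (rectpath a b) \<subseteq> resolvent_set bc v"
    and f: "L1 f"
  shows "spectral_op bc v (rectpath a b) (\<lambda>t. c * f t) x = c * spectral_op bc v (rectpath a b) f x"
proof -
  have "contour_integral (rectpath a b) (\<lambda>z. weak_resolvent bc v z (\<lambda>t. c * f t) x) = contour_integral (rectpath a b) (\<lambda>z. c * weak_resolvent bc v z f x)"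
    using S by (intro contour_integral_eq weak_resolvent_cmult[OF v _ f]) auto
  also have "\<dots> = c * contour_integral (rectpath a b) (\<lambda>z. weak_resolvent bc v z f x)"
    by (intro contour_integral_lmul weak_resolvent_contour_integrable v S f)
  finally show ?thesis by (simp add: spectral_op_def)
qed

section \<open>Deformation of the contour and the main estimate\<close>

lemma contour_integral_rectpath_sum:
  fixes p r :: complex
  assumes f: "continuous_on (path_image (rectpath p r)) f"
  defines "q \<equiv> Complex (Re r) (Im p)" and "s \<equiv> Complex (Re p) (Im r)"
  shows "contour_integral (rectpath p r) f = contour_integral (linepath p q) f + contour_integral (linepath q r) f
     + contour_integral (linepath r s) f + contour_integral (linepath s p) f"
proof -
  have rp: "rectpath p r = linepath p q +++ linepath q r +++ linepath r s +++ linepath s p"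
    by (simp add: rectpath_def q_def s_def Let_def)
  have pim: "path_image (rectpath p r) = closed_segment p q \<union> (closed_segment q r \<union> (closed_segment r s \<union> closed_segment s p))"
    unfolding rp by (simp add: path_image_join)
  have i: "f contour_integrable_on linepath p q" "f contour_integrable_on linepath q r" "f contour_integrable_on linepath r s" "f contour_integrable_on linepath s p"
    using f unfolding pim by (auto intro!: contour_integrable_continuous_linepath intro: continuous_on_subset)
  show ?thesis unfolding rp using i by (simp add: valid_path_join contour_integrable_joinI)
qed

lemma Cauchy_rectangle:
  fixes p r :: complex
  assumes f: "f holomorphic_on cbox p r" and le: "Re p \<le> Re r" "Im p \<le> Im r"
  defines "q \<equiv> Complex (Re r) (Im p)" and "s \<equiv> Complex (Re p) (Im r)"
  shows "contour_integral (linepath p q) f + contour_integral (linepath q r) f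
     + contour_integral (linepath r s) f + contour_integral (linepath s p) f = 0"
proof -
  have sub: "path_image (rectpath p r) \<subseteq> cbox p r" by (rule path_image_rectpath_subset_cbox[OF le])
  have "(f has_contour_integral 0) (rectpath p r)"
    by (rule Cauchy_theorem_convex_simple[OF f _ _ sub]) auto
  then have "contour_integral (rectpath p r) f = 0" by (rule contour_integral_unique)
  moreover have "continuous_on (path_image (rectpath p r)) f"
    using holomorphic_on_imp_continuous_on[OF f] sub by (rule continuous_on_subset)
  ultimately show ?thesis unfolding q_def s_def using contour_integral_rectpath_sum by metis
qed

text \<open>
  The right sides of the two boxes lie on the same line, so the region between the boxes
  consists of three rectangles, to the left, above and below the small one.
\<close>

lemma deform_rectangle:
  assumes f: "f holomorphic_on Q" and Q: "{z. Re z \<le> X \<and> (Re z \<le> - \<omega> \<or> X \<le> Re z \<or> h \<le> \<bar>Im z\<bar>)} \<subseteq> Q"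
    and R: "0 < h" "h < R" "0 < \<omega>" "\<omega> < R" "0 \<le> X"
  shows "contour_integral (rectpath (Complex (-\<omega>) (-h)) (Complex X h)) f = contour_integral (rectpath (Complex (-R) (-R)) (Complex X R)) f"
proof -
  define U where "U = {z. Re z \<le> X \<and> (Re z \<le> - \<omega> \<or> X \<le> Re z \<or> h \<le> \<bar>Im z\<bar>)}"
  have fU: "f holomorphic_on U" using f Q unfolding U_def by (rule holomorphic_on_subset)
  then have cU: "continuous_on U f" by (rule holomorphic_on_imp_continuous_on)
  define J where "J a b = contour_integral (linepath a b) f" for a b
  have rev: "J a b = - J b a" if "closed_segment a b \<subseteq> U" for a b
    unfolding J_def using continuous_on_subset[OF cU that] by (rule contour_integral_reverse_linepath)
  have split: "J a b = J a c + J c b" if "closed_segment a b \<subseteq> U" "c \<in> closed_segment a b" for a b c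
    unfolding J_def using continuous_on_subset[OF cU that(1)] that(2) by (rule contour_integral_split_linepath)
  define A B C E where "A = Complex (-R) (-R)" and "B = Complex X (-R)" and "C = Complex X R" and "E = Complex (-R) R"
  define a b c e where "a = Complex (-\<omega>) (-h)" and "b = Complex X (-h)" and "c = Complex X h" and "e = Complex (-\<omega>) h"
  define a1 e1 where "a1 = Complex (-\<omega>) (-R)" and "e1 = Complex (-\<omega>) R"
  note pts = A_def B_def C_def E_def a_def b_def c_def e_def a1_def e1_def
  note seg = closed_segment_same_Re closed_segment_same_Im closed_segment_eq_real_ivl
  have sU: "closed_segment A B \<subseteq> U" "closed_segment B C \<subseteq> U" "closed_segment C E \<subseteq> U" "closed_segment E A \<subseteq> U"
    "closed_segment a b \<subseteq> U" "closed_segment b c \<subseteq> U" "closed_segment c e \<subseteq> U" "closed_segment e a \<subseteq> U" "closed_segment a1 e1 \<subseteq> U"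
    using R by (auto simp: pts seg U_def)
  have outer: "contour_integral (rectpath A C) f = J A B + J B C + J C E + J E A"
  proof -
    have "path_image (rectpath A C) \<subseteq> U" using R by (subst path_image_rectpath) (auto simp: pts U_def)
    from contour_integral_rectpath_sum[OF continuous_on_subset[OF cU this]]
    show ?thesis by (simp add: J_def pts)
  qed
  have inner: "contour_integral (rectpath a c) f = J a b + J b c + J c e + J e a"
  proof -
    have "path_image (rectpath a c) \<subseteq> U" using R by (subst path_image_rectpath) (auto simp: pts U_def)
    from contour_integral_rectpath_sum[OF continuous_on_subset[OF cU this]]
    show ?thesis by (simp add: J_def pts)
  qed
  have left: "J A a1 + J a1 e1 + J e1 E + J E A = 0"
  proof -
    have "cbox A e1 \<subseteq> U" using R by (auto simp: pts in_cbox_complex_iff U_def)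
    from Cauchy_rectangle[OF holomorphic_on_subset[OF fU this]] show ?thesis using R by (simp add: J_def pts)
  qed
  have bottom: "J a1 B + J B b + J b a + J a a1 = 0"
  proof -
    have "cbox a1 b \<subseteq> U" using R by (auto simp: pts in_cbox_complex_iff U_def)
    from Cauchy_rectangle[OF holomorphic_on_subset[OF fU this]] show ?thesis using R by (simp add: J_def pts)
  qed
  have top: "J e c + J c C + J C e1 + J e1 e = 0"
  proof -
    have "cbox e C \<subseteq> U" using R by (auto simp: pts in_cbox_complex_iff U_def)
    from Cauchy_rectangle[OF holomorphic_on_subset[OF fU this]] show ?thesis using R by (simp add: J_def pts)
  qed
  have s1: "J A B = J A a1 + J a1 B" by (rule split[OF sU(1)]) (use R in \<open>auto simp: pts seg\<close>)
  have s2: "J B C = J B b + J b C" by (rule split[OF sU(2)]) (use R in \<open>auto simp: pts seg\<close>)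
  have s3: "J b C = J b c + J c C" by (rule split) (use R in \<open>auto simp: pts seg U_def\<close>)
  have s4: "J C E = J C e1 + J e1 E" by (rule split[OF sU(3)]) (use R in \<open>auto simp: pts seg\<close>)
  have s5: "J a1 e1 = J a1 a + J a e1" by (rule split[OF sU(9)]) (use R in \<open>auto simp: pts seg\<close>)
  have s6: "J a e1 = J a e + J e e1" by (rule split) (use R in \<open>auto simp: pts seg U_def\<close>)
  have r1: "J b a = - J a b" by (rule rev) (use R in \<open>auto simp: pts seg U_def\<close>)
  have r2: "J e c = - J c e" by (rule rev) (use R in \<open>auto simp: pts seg U_def\<close>)
  have r3: "J a e = - J e a" by (rule rev) (use R in \<open>auto simp: pts seg U_def\<close>)
  have r4: "J a a1 = - J a1 a" by (rule rev) (use R in \<open>auto simp: pts seg U_def\<close>)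
  have r5: "J e1 e = - J e e1" by (rule rev) (use R in \<open>auto simp: pts seg U_def\<close>)
  have l: "J A a1 + J e1 E + J E A = - J a1 a + J e a - J e e1"
    using left unfolding s5 s6 r3 by (simp add: algebra_simps eq_neg_iff_add_eq_0)
  have bt: "J a1 B + J B b = J a b + J a1 a" using bottom unfolding r1 r4 by (simp add: algebra_simps)
  have tp: "J c C + J C e1 = J c e + J e e1" using top unfolding r2 r5 by (simp add: algebra_simps)
  have "J A B + J B C + J C E + J E A = (J A a1 + J e1 E + J E A) + (J a1 B + J B b) + J b c + (J c C + J C e1)"
    unfolding s1 s2 s3 s4 by (simp add: algebra_simps)
  also have "\<dots> = J a b + J b c + J c e + J e a" unfolding l bt tp by (simp add: algebra_simps)
  finally show ?thesis using outer inner by (simp add: pts)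
qed

lemma path_image_rectpath_frame:
  assumes "0 < h" "0 < \<omega>" "0 \<le> X"
  shows "path_image (rectpath (Complex (-\<omega>) (-h)) (Complex X h)) \<subseteq> {z. Re z \<le> X \<and> (Re z \<le> - \<omega> \<or> X \<le> Re z \<or> h \<le> \<bar>Im z\<bar>)}"
  using assms by (subst path_image_rectpath) auto

text \<open>
  The two bounds meet at \<open>y = M\<close>. The first one is integrable at 0 as \<open>\<delta> < 1\<close>, the second one at
  infinity as \<open>\<delta> > 0\<close>; with \<open>M = N\<^sup>2\<close> both parts have the size \<open>N powr (- \<delta>)\<close>.
\<close>

lemma half_line_bound:
  fixes g :: "real \<Rightarrow> complex"
  assumes g: "continuous_on {0..R} g" and M: "0 < M" "M \<le> R" and \<delta>: "0 < \<delta>" "\<delta> < 1" and K: "K \<ge> 0"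
    and b1: "\<And>y. 0 < y \<Longrightarrow> y \<le> M \<Longrightarrow> norm (g y) \<le> K * (M powr (\<delta>/2 - 1) * y powr (- \<delta>))"
    and b2: "\<And>y. M \<le> y \<Longrightarrow> y \<le> R \<Longrightarrow> norm (g y) \<le> K * y powr (- 1 - \<delta>/2)"
  shows "norm (integral {0..R} g) \<le> K * M powr (- \<delta>/2) * (1 / (1 - \<delta>) + 2 / \<delta>)"
proof -
  have gi: "g integrable_on {0..R}" by (rule integrable_continuous_real[OF g])
  have s: "integral {0..M} g + integral {M..R} g = integral {0..R} g"
    by (rule Henstock_Kurzweil_Integration.integral_combine[OF _ _ gi]) (use M in auto)
  have 1: "norm (integral {0..M} g) \<le> K * M powr (- \<delta>/2) * (1 / (1 - \<delta>))"
  proof -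
    \<comment> \<open>At 0 the right-hand side of the first bound is 0 by convention, so g is changed there.\<close>
    define g0 where "g0 y = (if y = 0 then 0 else g y)" for y :: real
    have gM: "g integrable_on {0..M}" using gi by (rule integrable_subinterval_real) (use M in auto)
    have g0i: "g0 integrable_on {0..M}" by (rule integrable_spike_finite[OF _ _ gM, of "{0}"]) (auto simp: g0_def)
    have eq: "integral {0..M} g = integral {0..M} g0" by (rule integral_spike[of "{0}"]) (auto simp: g0_def)
    have p: "((\<lambda>y. y powr (- \<delta>)) has_integral (M powr (- \<delta> + 1) / (- \<delta> + 1))) {0..M}"
      by (rule has_integral_powr_from_0) (use \<delta> M in auto)
    then have p': "((\<lambda>y. K * (M powr (\<delta>/2 - 1) * y powr (- \<delta>))) has_integral K * (M powr (\<delta>/2 - 1) * (M powr (- \<delta> + 1) / (- \<delta> + 1)))) {0..M}"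
      by (intro has_integral_mult_right)
    have "norm (integral {0..M} g0) \<le> integral {0..M} (\<lambda>y. K * (M powr (\<delta>/2 - 1) * y powr (- \<delta>)))"
      by (rule integral_norm_bound_integral[OF g0i has_integral_integrable[OF p']]) (auto simp: g0_def b1)
    also have "\<dots> = K * (M powr (\<delta>/2 - 1) * (M powr (- \<delta> + 1) / (- \<delta> + 1)))" using p' by (rule integral_unique)
    also have "\<dots> = K * (M powr (\<delta>/2 - 1) * M powr (- \<delta> + 1)) * (1 / (1 - \<delta>))" by simp
    also have "M powr (\<delta>/2 - 1) * M powr (- \<delta> + 1) = M powr (- \<delta>/2)" by (simp add: powr_add[symmetric] field_simps)
    finally show ?thesis unfolding eq .
  qed
  have 2: "norm (integral {M..R} g) \<le> K * M powr (- \<delta>/2) * (2 / \<delta>)"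
  proof -
    have gM: "g integrable_on {M..R}" using gi by (rule integrable_subinterval_real) (use M in auto)
    have p: "((\<lambda>y. y powr (- 1 - \<delta>/2)) has_integral ((\<lambda>y. - (2 / \<delta>) * y powr (- \<delta>/2)) R - (\<lambda>y. - (2 / \<delta>) * y powr (- \<delta>/2)) M)) {M..R}"
    proof (rule fundamental_theorem_of_calculus[OF M(2)])
      fix y assume y: "y \<in> {M..R}"
      have "((\<lambda>y. - (2 / \<delta>) * y powr (- \<delta>/2)) has_real_derivative (- (2 / \<delta>) * ((- \<delta>/2) * y powr (- \<delta>/2 - 1)))) (at y within {M..R})"
        using y M by (auto intro!: derivative_eq_intros)
      also have "- \<delta>/2 - 1 = - 1 - \<delta>/2" by simp
      also have "- (2 / \<delta>) * ((- \<delta>/2) * y powr (- 1 - \<delta>/2)) = y powr (- 1 - \<delta>/2)"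
        using \<delta> by simp
      finally show "((\<lambda>y. - (2 / \<delta>) * y powr (- \<delta>/2)) has_vector_derivative y powr (- 1 - \<delta>/2)) (at y within {M..R})"
        by (simp add: has_real_derivative_iff_has_vector_derivative)
    qed
    then have p': "((\<lambda>y. K * y powr (- 1 - \<delta>/2)) has_integral K * ((2 / \<delta>) * (M powr (- \<delta>/2) - R powr (- \<delta>/2)))) {M..R}"
      by (intro has_integral_mult_right) (simp add: algebra_simps)
    have "norm (integral {M..R} g) \<le> integral {M..R} (\<lambda>y. K * y powr (- 1 - \<delta>/2))"
      by (rule integral_norm_bound_integral[OF gM has_integral_integrable[OF p']]) (auto simp: b2)
    also have "\<dots> = K * ((2 / \<delta>) * (M powr (- \<delta>/2) - R powr (- \<delta>/2)))" using p' by (rule integral_unique)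
    also have "\<dots> \<le> K * ((2 / \<delta>) * M powr (- \<delta>/2))" using K \<delta> by (intro mult_left_mono) auto
    finally show ?thesis by (simp add: mult_ac)
  qed
  show ?thesis unfolding s[symmetric]
    using norm_triangle_ineq[of "integral {0..M} g" "integral {M..R} g"] 1 2 by (simp only: distrib_left)
qed

lemma interior_Pi_box: "interior (Pi_box \<omega> h N) = box (Complex (-\<omega>) (-h)) (Complex (real N ^ 2 + real N) h)"
proof -
  have "Pi_box \<omega> h N = cbox (Complex (-\<omega>) (-h)) (Complex (real N ^ 2 + real N) h)"
    by (auto simp: Pi_box_def in_cbox_complex_iff)
  then show ?thesis by (simp add: interior_cbox)
qed

lemma admissible_in_resolvent_set:
  assumes v: "L1 v" and adm: "admissible bc v N \<omega> h"
    and z: "Re z \<le> real N ^ 2 + real N" "Re z \<le> - \<omega> \<or> real N ^ 2 + real N \<le> Re z \<or> h \<le> \<bar>Im z\<bar>"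
  shows "z \<in> resolvent_set bc v" "z \<in> resolvent_set bc (\<lambda>x. 0)"
proof -
  have "z \<notin> interior (Pi_box \<omega> h N)" using z unfolding interior_Pi_box in_box_complex_iff by auto
  then have "\<not> L_eigenvalue bc v z" "\<not> L_eigenvalue bc (\<lambda>x. 0) z" using adm z(1) unfolding admissible_def by blast+
  then show "z \<in> resolvent_set bc v" "z \<in> resolvent_set bc (\<lambda>x. 0)" using resolvent_set_iff[OF v] resolvent_set_iff[of "\<lambda>x. 0"] by auto
qed

lemma far_region:
  assumes "Re z \<le> - R \<or> R \<le> \<bar>Im z\<bar>" "Re z \<le> X" "X \<le> R" "0 \<le> R"
  shows "Re z \<le> \<bar>Im z\<bar>" "R \<le> norm z"
proof -
  show "Re z \<le> \<bar>Im z\<bar>" using assms by linarith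
  show "R \<le> norm z" using assms(1,4) abs_Re_le_cmod[of z] abs_Im_le_cmod[of z] by linarith
qed

text \<open>
  On the line the eigenvalues are excluded for large N; in the part of the half plane outside a
  large box, \<open>Re z \<le> \<bar>Im z\<bar>\<close> and \<open>\<bar>z\<bar>\<close> is large.
\<close>

lemma admissible_exists:
  assumes v: "L1 v" and N: "1 \<le> N" "10 * L1norm v \<le> real N"
  shows "\<exists>\<omega> h. admissible bc v N \<omega> h"
proof -
  define X where "X = real N ^ 2 + real N"
  define R where "R = X + 1"
  have X: "X \<ge> 0" by (simp add: X_def)
  have z0: "L1 (\<lambda>x. 0::complex)" by simp
  have L0: "L1norm (\<lambda>x. 0) = 0" by (simp add: L1norm_def)
  have "(10 * L1norm v)\<^sup>2 \<le> (real N)\<^sup>2" using N L1norm_nonneg[of v] by (intro power_mono) auto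
  also have "\<dots> \<le> R" by (simp add: R_def X_def)
  finally have vR: "(10 * L1norm v)\<^sup>2 \<le> R" .
  have "z \<in> box (Complex (-R) (-R)) (Complex X R)" if e: "L_eigenvalue bc v z \<or> L_eigenvalue bc (\<lambda>x. 0) z" and Re: "Re z \<le> X" for z
  proof (rule ccontr)
    assume "z \<notin> box (Complex (-R) (-R)) (Complex X R)"
    then consider "Re z = X" | "Re z \<le> - R \<or> R \<le> \<bar>Im z\<bar>" using Re unfolding in_box_complex_iff by fastforce
    then have "z \<in> resolvent_set bc v \<and> z \<in> resolvent_set bc (\<lambda>x. 0)"
    proof cases
      case 1
      then show ?thesis using line_in_resolvent_set[of z N v bc] line_in_resolvent_set[of z N "\<lambda>x. 0" bc] N v z0 L0 by (simp add: X_def)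
    next
      case 2
      have "Re z \<le> \<bar>Im z\<bar>" "R \<le> norm z" using far_region[OF 2 Re] X by (auto simp: R_def)
      moreover have "1 \<le> R" using X by (simp add: R_def)
      ultimately show ?thesis using far_in_resolvent_set[of z v bc] far_in_resolvent_set[of z "\<lambda>x. 0" bc] v z0 L0 vR by simp
    qed
    then show False using e resolvent_set_iff[OF v] resolvent_set_iff[OF z0] by blast
  qed
  then have "admissible bc v N R R"
    unfolding admissible_def interior_Pi_box using X by (auto simp: X_def[symmetric] R_def)
  then show ?thesis by blast
qed

text \<open>
  On the box with \<open>- R\<close>, \<open>R\<close> in place of \<open>- \<omega>\<close>, \<open>h\<close>, the three sides off the line have length at
  most \<open>2 R\<close> and the integrand there is of size \<open>R powr (- 1 - \<delta>/2)\<close>; as \<open>R \<ge> N\<^sup>2\<close>, they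
  contribute at most a multiple of \<open>N powr (- \<delta>)\<close>. The line itself is handled by
  \<open>half_line_bound\<close>, once for each half.
\<close>

lemma spectral_op_diff_estimate:
  assumes p: "1 \<le> p" "v \<in> Lp p" and a: "1 \<le> a" "f \<in> Lp a" and \<delta>: "\<delta> = (1 - 1/p) + (1 - 1/a)" "0 < \<delta>" "\<delta> < 1"
    and N: "1 \<le> N" "10 * L1norm v \<le> real N" and adm: "admissible bc v N \<omega> h"
  shows "norm (spectral_op bc v (Pi_boundary \<omega> h N) f x - spectral_op bc (\<lambda>x. 0) (Pi_boundary \<omega> h N) f x)
    \<le> Lp_full_norm p v * Lp_full_norm a f * (3600 + 800 * (1 / (1 - \<delta>) + 2 / \<delta>)) * real N powr (- \<delta>)"
proof -
  define X where "X = real N ^ 2 + real N"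
  define M where "M = (real N)\<^sup>2"
  define VF where "VF = Lp_full_norm p v * Lp_full_norm a f"
  have VF: "VF \<ge> 0" by (simp add: VF_def Lp_full_norm_nonneg)
  have v: "L1 v" and f: "L1 f"
    using Lp_absolutely_integrable p a by auto
  have z0: "L1 (\<lambda>x. 0::complex)" by simp
  have wh: "\<omega> > 0" "h > 0" using adm by (auto simp: admissible_def)
  define D where "D z = weak_resolvent bc v z f x - weak_resolvent bc (\<lambda>x. 0) z f x" for z
  define Q where "Q = resolvent_set bc v \<inter> resolvent_set bc (\<lambda>x. 0)"
  have D: "D holomorphic_on Q"
    unfolding D_def Q_def
    by (intro holomorphic_on_diff holomorphic_on_subset[OF weak_resolvent_holomorphic[OF v f]] holomorphic_on_subset[OF weak_resolvent_holomorphic[OF z0 f]]) auto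
  have UQ: "{z. Re z \<le> X \<and> (Re z \<le> - \<omega> \<or> X \<le> Re z \<or> h \<le> \<bar>Im z\<bar>)} \<subseteq> Q"
    using admissible_in_resolvent_set[OF v adm] by (auto simp: Q_def X_def)
  have N1: "real N \<ge> 1" using N(1) by simp
  have M1: "M \<ge> 1" using N1 by (simp add: M_def)
  have MX: "M \<le> X" by (simp add: M_def X_def)
  define R where "R = X + \<omega> + h"
  have R: "h < R" "\<omega> < R" "X \<le> R" "M \<le> R" "R > 0" "R \<ge> 1" using wh M1 MX by (auto simp: R_def)
  have Nd: "M powr (- \<delta>/2) = real N powr (- \<delta>)"
  proof -
    have "M = real N powr 2" using N1 by (simp add: M_def powr_numeral)
    then show ?thesis by (simp only: powr_powr) simp
  qed
  have Rd: "R powr (- \<delta>/2) \<le> real N powr (- \<delta>)" unfolding Nd[symmetric] using R M1 \<delta> by (intro powr_mono2') auto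
  have small: "(10 * L1norm v)\<^sup>2 \<le> M" unfolding M_def using N L1norm_nonneg[of v] by (intro power_mono) auto
  have far: "norm (D z) \<le> 600 * VF * R powr (- 1 - \<delta>/2)" if z: "Re z \<le> - R \<or> R \<le> \<bar>Im z\<bar>" "Re z \<le> X" for z
  proof -
    have fr: "Re z \<le> \<bar>Im z\<bar>" "R \<le> norm z" using far_region[OF z R(3)] R by auto
    have "norm (D z) \<le> 600 * Lp_full_norm p v * Lp_full_norm a f * norm z powr (- 1 - \<delta> / 2)"
      unfolding D_def using fr R small \<delta> by (intro far_diff_estimate p a) auto
    also have "\<dots> = 600 * VF * norm z powr (- 1 - \<delta> / 2)" by (simp add: VF_def)
    also have "\<dots> \<le> 600 * VF * R powr (- 1 - \<delta> / 2)"
      using fr R \<delta> VF by (intro mult_left_mono powr_mono2') auto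
    finally show ?thesis .
  qed
  have line: "norm (D (Complex X y)) \<le> 400 * VF * (\<bar>y\<bar> powr (- \<delta>) * norm (Complex X y) powr (\<delta>/2 - 1))" if "y \<noteq> 0" for y
    unfolding D_def VF_def using line_diff_estimate[OF _ N(1) _ p a N(2) \<delta>(1), of "Complex X y" bc x] that \<delta> by (simp add: X_def mult.assoc)
  have nX: "M \<le> norm (Complex X y)" "\<bar>y\<bar> \<le> norm (Complex X y)" for y
    using abs_Re_le_cmod[of "Complex X y"] abs_Im_le_cmod[of "Complex X y"] MX M1 by auto
  have lb1: "norm (D (Complex X y)) \<le> 400 * VF * (M powr (\<delta>/2 - 1) * \<bar>y\<bar> powr (- \<delta>))" if "y \<noteq> 0" for y
  proof -
    have "norm (Complex X y) powr (\<delta>/2 - 1) \<le> M powr (\<delta>/2 - 1)" using nX(1)[of y] M1 \<delta> by (intro powr_mono2') auto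
    then have "400 * VF * (\<bar>y\<bar> powr (- \<delta>) * norm (Complex X y) powr (\<delta>/2 - 1)) \<le> 400 * VF * (\<bar>y\<bar> powr (- \<delta>) * M powr (\<delta>/2 - 1))"
      using VF by (intro mult_left_mono) auto
    then show ?thesis using line[OF that] by (simp add: mult.commute)
  qed
  have lb2: "norm (D (Complex X y)) \<le> 400 * VF * \<bar>y\<bar> powr (- 1 - \<delta>/2)" if "y \<noteq> 0" for y
  proof -
    have "norm (Complex X y) powr (\<delta>/2 - 1) \<le> \<bar>y\<bar> powr (\<delta>/2 - 1)" using nX(2)[of y] that \<delta> by (intro powr_mono2') auto
    then have "400 * VF * (\<bar>y\<bar> powr (- \<delta>) * norm (Complex X y) powr (\<delta>/2 - 1)) \<le> 400 * VF * (\<bar>y\<bar> powr (- \<delta>) * \<bar>y\<bar> powr (\<delta>/2 - 1))"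
      using VF by (intro mult_left_mono) auto
    also have "\<bar>y\<bar> powr (- \<delta>) * \<bar>y\<bar> powr (\<delta>/2 - 1) = \<bar>y\<bar> powr (- 1 - \<delta>/2)"
      unfolding powr_add[symmetric] by (rule arg_cong[where f="\<lambda>c. \<bar>y\<bar> powr c"]) (simp add: field_simps)
    finally show ?thesis using line[OF that] by simp
  qed
  have DQ: "continuous_on S D" if "S \<subseteq> Q" for S
    using holomorphic_on_imp_continuous_on[OF D] that by (rule continuous_on_subset)
  define K where "K = 400 * VF * real N powr (- \<delta>) * (1 / (1 - \<delta>) + 2 / \<delta>)"
  have cX: "continuous_on {-R..R} (\<lambda>y. D (Complex X y))"
  proof (rule continuous_on_compose2[OF DQ[OF UQ]])
    show "continuous_on {-R..R} (Complex X)" by (intro continuous_intros)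
  qed auto
  have half: "norm (integral {0..R} (\<lambda>y. D (Complex X y))) \<le> K" "norm (integral {0..R} (\<lambda>y. D (Complex X (-y)))) \<le> K"
  proof -
    have c1: "continuous_on {0..R} (\<lambda>y. D (Complex X y))" by (rule continuous_on_subset[OF cX]) (use R in auto)
    have c2: "continuous_on {0..R} (\<lambda>y. D (Complex X (-y)))"
      by (rule continuous_on_compose2[OF cX]) (use R in \<open>auto intro!: continuous_intros\<close>)
    have Keq: "K = 400 * VF * M powr (- \<delta>/2) * (1 / (1 - \<delta>) + 2 / \<delta>)" by (simp only: K_def Nd)
    show "norm (integral {0..R} (\<lambda>y. D (Complex X y))) \<le> K"
      unfolding Keq
    proof (rule half_line_bound[OF c1])
      show "norm (D (Complex X y)) \<le> 400 * VF * (M powr (\<delta>/2 - 1) * y powr (- \<delta>))" if "0 < y" "y \<le> M" for y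
        using lb1[of y] that by simp
      show "norm (D (Complex X y)) \<le> 400 * VF * y powr (- 1 - \<delta>/2)" if "M \<le> y" "y \<le> R" for y
        using lb2[of y] that M1 by simp
    qed (use M1 R \<delta> VF in auto)
    show "norm (integral {0..R} (\<lambda>y. D (Complex X (-y)))) \<le> K"
      unfolding Keq
    proof (rule half_line_bound[OF c2])
      show "norm (D (Complex X (-y))) \<le> 400 * VF * (M powr (\<delta>/2 - 1) * y powr (- \<delta>))" if "0 < y" "y \<le> M" for y
        using lb1[of "-y"] that by simp
      show "norm (D (Complex X (-y))) \<le> 400 * VF * y powr (- 1 - \<delta>/2)" if "M \<le> y" "y \<le> R" for y
        using lb2[of "-y"] that M1 by simp
    qed (use M1 R \<delta> VF in auto)
  qed
  have right: "norm (contour_integral (linepath (Complex X (-R)) (Complex X R)) D) \<le> 2 * K"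
  proof -
    have i: "(\<lambda>y. D (Complex X y)) integrable_on {-R..R}" by (rule integrable_continuous_real[OF cX])
    have "contour_integral (linepath (Complex X (-R)) (Complex X R)) D = \<i> * integral {-R..R} (\<lambda>y. D (Complex X y))"
      by (rule contour_integral_linepath_same_Re) (use R in auto)
    also have "integral {-R..R} (\<lambda>y. D (Complex X y)) = integral {-R..0} (\<lambda>y. D (Complex X y)) + integral {0..R} (\<lambda>y. D (Complex X y))"
      by (rule Henstock_Kurzweil_Integration.integral_combine[OF _ _ i, symmetric]) (use R in auto)
    also have "integral {-R..0} (\<lambda>y. D (Complex X y)) = integral {0..R} (\<lambda>y. D (Complex X (-y)))"
      using Henstock_Kurzweil_Integration.integral_reflect_real[of R 0 "\<lambda>y. D (Complex X (-y))"] by simp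
    finally show ?thesis using half norm_triangle_ineq[of "integral {0..R} (\<lambda>y. D (Complex X (-y)))" "integral {0..R} (\<lambda>y. D (Complex X y))"]
      by (simp add: norm_mult)
  qed
  have side: "norm (contour_integral (linepath b c) D) \<le> 1200 * VF * real N powr (- \<delta>)"
    if s: "\<And>z. z \<in> closed_segment b c \<Longrightarrow> (Re z \<le> - R \<or> R \<le> \<bar>Im z\<bar>) \<and> Re z \<le> X" and l: "norm (c - b) \<le> 2 * R" for b c
  proof -
    have "closed_segment b c \<subseteq> Q"
    proof
      fix z assume "z \<in> closed_segment b c"
      from s[OF this] show "z \<in> Q" using UQ R by fastforce
    qed
    then have "D contour_integrable_on linepath b c" by (intro contour_integrable_continuous_linepath DQ)
    then have "norm (contour_integral (linepath b c) D) \<le> 600 * VF * R powr (- 1 - \<delta>/2) * norm (c - b)"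
      by (rule contour_integral_bound_linepath) (use s far VF in auto)
    also have "\<dots> \<le> 600 * VF * R powr (- 1 - \<delta>/2) * (2 * R)" using l VF by (intro mult_left_mono) auto
    also have "\<dots> = 1200 * VF * (R powr (- 1 - \<delta>/2) * R powr 1)" using R by simp
    also have "R powr (- 1 - \<delta>/2) * R powr 1 = R powr (- \<delta>/2)"
      unfolding powr_add[symmetric] by simp
    also have "1200 * VF * R powr (- \<delta>/2) \<le> 1200 * VF * real N powr (- \<delta>)" using Rd VF by (intro mult_left_mono) auto
    finally show ?thesis .
  qed
  note seg = closed_segment_same_Re closed_segment_same_Im closed_segment_eq_real_ivl
  have X0: "X \<ge> 0" by (simp add: X_def)
  have nh: "norm (Complex c e - Complex b e) \<le> 2 * R" if "\<bar>c - b\<bar> \<le> 2 * R" for b c e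
    using that by (simp add: cmod_def)
  have nv: "norm (Complex e c - Complex e b) \<le> 2 * R" if "\<bar>c - b\<bar> \<le> 2 * R" for b c e
    using that by (simp add: cmod_def)
  have bot: "norm (contour_integral (linepath (Complex (-R) (-R)) (Complex X (-R))) D) \<le> 1200 * VF * real N powr (- \<delta>)"
    by (rule side) (use R X0 in \<open>auto simp: seg intro!: nh\<close>)
  have top: "norm (contour_integral (linepath (Complex X R) (Complex (-R) R)) D) \<le> 1200 * VF * real N powr (- \<delta>)"
    by (rule side) (use R X0 in \<open>auto simp: seg intro!: nh\<close>)
  have left: "norm (contour_integral (linepath (Complex (-R) R) (Complex (-R) (-R))) D) \<le> 1200 * VF * real N powr (- \<delta>)"
    by (rule side) (use R X0 in \<open>auto simp: seg intro!: nv\<close>)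
  let ?in = "rectpath (Complex (-\<omega>) (-h)) (Complex X h)"
  let ?out = "rectpath (Complex (-R) (-R)) (Complex X R)"
  have pin: "path_image ?in \<subseteq> Q" by (rule order_trans[OF path_image_rectpath_frame[OF wh(2,1) X0] UQ])
  have pout: "path_image ?out \<subseteq> Q"
  proof -
    have "path_image ?out \<subseteq> {z. Re z \<le> X \<and> (Re z \<le> - \<omega> \<or> X \<le> Re z \<or> h \<le> \<bar>Im z\<bar>)}"
      using wh X0 R by (subst path_image_rectpath) auto
    then show ?thesis using UQ by auto
  qed
  have "contour_integral ?in D = contour_integral ?out D"
    by (rule deform_rectangle[OF D UQ]) (use wh R X0 in auto)
  also have "\<dots> = contour_integral (linepath (Complex (-R) (-R)) (Complex X (-R))) D + contour_integral (linepath (Complex X (-R)) (Complex X R)) D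
     + contour_integral (linepath (Complex X R) (Complex (-R) R)) D + contour_integral (linepath (Complex (-R) R) (Complex (-R) (-R))) D"
    using contour_integral_rectpath_sum[OF DQ[OF pout]] by simp
  finally have "norm (contour_integral ?in D) \<le> norm (contour_integral (linepath (Complex (-R) (-R)) (Complex X (-R))) D) + norm (contour_integral (linepath (Complex X (-R)) (Complex X R)) D)
     + norm (contour_integral (linepath (Complex X R) (Complex (-R) R)) D) + norm (contour_integral (linepath (Complex (-R) R) (Complex (-R) (-R))) D)"
    by (simp only:) (intro order_trans[OF norm_triangle_ineq] add_mono order_refl)
  also have "\<dots> \<le> 3600 * VF * real N powr (- \<delta>) + 2 * K" using bot top left right by linarith
  also have "\<dots> = VF * (3600 + 800 * (1 / (1 - \<delta>) + 2 / \<delta>)) * real N powr (- \<delta>)" by (simp add: K_def algebra_simps)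
  finally have I: "norm (contour_integral ?in D) \<le> VF * (3600 + 800 * (1 / (1 - \<delta>) + 2 / \<delta>)) * real N powr (- \<delta>)" .
  have Pb: "Pi_boundary \<omega> h N = ?in" by (simp add: Pi_boundary_def X_def)
  have "contour_integral ?in D = contour_integral ?in (\<lambda>z. weak_resolvent bc v z f x) - contour_integral ?in (\<lambda>z. weak_resolvent bc (\<lambda>x. 0) z f x)"
    unfolding D_def using pin by (intro contour_integral_diff weak_resolvent_contour_integrable v z0 f) (auto simp: Q_def)
  then have "spectral_op bc v ?in f x - spectral_op bc (\<lambda>x. 0) ?in f x = contour_integral ?in D / (2 * of_real pi * \<i>)"
    by (simp add: spectral_op_def diff_divide_distrib)
  then have "norm (spectral_op bc v ?in f x - spectral_op bc (\<lambda>x. 0) ?in f x) = norm (contour_integral ?in D) / (2 * pi)"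
    by (simp add: norm_divide norm_mult)
  also have "\<dots> \<le> norm (contour_integral ?in D)"
    using pi_gt3 by (simp add: divide_le_eq mult_left_le_one_le) (smt (verit) mult_le_cancel_left1 norm_ge_zero)
  finally show ?thesis using I unfolding Pb VF_def by linarith
qed

theorem corollary6:
  fixes p a r \<delta> :: real and bc :: bc
  assumes "1 \<le> p" and "p < 2" and "1 < a" and "a \<le> 2"
    and "1 / r = 1 / 2 * (1 / p + 1 / a)"
    and "\<delta> = (1 - 1 / p) + (1 - 1 / a)"
  shows "1 / r > 1 / 2 \<and>
    (\<exists>Nstar :: real \<Rightarrow> nat. \<forall>v\<in>Lp p. \<exists>C>0. \<forall>N\<ge>Nstar (Lp_norm p v).
       (\<exists>\<omega> h. admissible bc v N \<omega> h) \<and>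
       (\<forall>\<omega> h. admissible bc v N \<omega> h \<longrightarrow>
          (\<exists>S S0. is_S bc v N \<omega> h S \<and> is_S bc (\<lambda>x. 0) N \<omega> h S0 \<and>
             La_C_norm_le a (\<lambda>f x. S f x - S0 f x) (C * real N powr (- \<delta>)))))"
proof -
  have ap: "1 / p > 1 / 2" "1 / p \<le> 1" "1 / a \<ge> 1 / 2" "1 / a < 1" using assms(1-4) by (auto simp: field_simps)
  have r: "1 / r > 1 / 2" using assms(5) ap by simp
  have \<delta>: "0 < \<delta>" "\<delta> < 1" using assms(6) ap by linarith+
  \<comment> \<open>The factor pi compares the norm in \<open>L\<^sup>1\<close> with the normalized norm in \<open>L\<^sup>p\<close>.\<close>
  define Nstar :: "real \<Rightarrow> nat" where "Nstar s = nat \<lceil>10 * pi * s\<rceil> + 1" for s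
  have z0: "L1 (\<lambda>x. 0::complex)" by simp
  have main: "\<exists>C>0. \<forall>N\<ge>Nstar (Lp_norm p v).
       (\<exists>\<omega> h. admissible bc v N \<omega> h) \<and>
       (\<forall>\<omega> h. admissible bc v N \<omega> h \<longrightarrow>
          (\<exists>S S0. is_S bc v N \<omega> h S \<and> is_S bc (\<lambda>x. 0) N \<omega> h S0 \<and>
             La_C_norm_le a (\<lambda>f x. S f x - S0 f x) (C * real N powr (- \<delta>))))" if v: "v \<in> Lp p" for v
  proof -
    have vi: "L1 v" by (rule Lp_absolutely_integrable[OF v assms(1)])
    define k where "k = 3600 + 800 * (1 / (1 - \<delta>) + 2 / \<delta>)"
    have k: "k > 0" using \<delta> by (simp add: k_def add_pos_pos)
    define C where "C = Lp_full_norm p v * pi * k + 1"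
    have C: "C > 0" using k by (simp add: C_def Lp_full_norm_nonneg add_nonneg_pos)
    have "(\<exists>\<omega> h. admissible bc v N \<omega> h) \<and>
       (\<forall>\<omega> h. admissible bc v N \<omega> h \<longrightarrow>
          (\<exists>S S0. is_S bc v N \<omega> h S \<and> is_S bc (\<lambda>x. 0) N \<omega> h S0 \<and>
             La_C_norm_le a (\<lambda>f x. S f x - S0 f x) (C * real N powr (- \<delta>))))" if N: "N \<ge> Nstar (Lp_norm p v)" for N
    proof -
      have N1: "1 \<le> N" using N by (simp add: Nstar_def)
      have "10 * L1norm v \<le> 10 * pi * Lp_norm p v" using L1norm_le_Lp_norm[OF v assms(1)] by simp
      also have "\<dots> \<le> real N" using N unfolding Nstar_def by linarith
      finally have Nv: "10 * L1norm v \<le> real N" .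
      have "\<exists>S S0. is_S bc v N \<omega> h S \<and> is_S bc (\<lambda>x. 0) N \<omega> h S0 \<and>
             La_C_norm_le a (\<lambda>f x. S f x - S0 f x) (C * real N powr (- \<delta>))" if adm: "admissible bc v N \<omega> h" for \<omega> h
      proof -
        define g where "g = Pi_boundary \<omega> h N"
        obtain b c where bc: "g = rectpath b c" by (simp add: g_def Pi_boundary_def)
        have wh: "\<omega> > 0" "h > 0" using adm by (auto simp: admissible_def)
        have pU: "path_image g \<subseteq> {z. Re z \<le> real N ^ 2 + real N \<and> (Re z \<le> - \<omega> \<or> real N ^ 2 + real N \<le> Re z \<or> h \<le> \<bar>Im z\<bar>)}"
          unfolding g_def Pi_boundary_def by (rule path_image_rectpath_frame[OF wh(2,1)]) simp
        have P: "path_image g \<subseteq> resolvent_set bc v" "path_image g \<subseteq> resolvent_set bc (\<lambda>x. 0)"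
          using pU admissible_in_resolvent_set[OF vi adm] by auto
        note P' = P[unfolded bc]
        define T where "T f x = spectral_op bc v g f x - spectral_op bc (\<lambda>x. 0) g f x" for f x
        have la: "L1 f" if "f \<in> Lp a" for f
          using Lp_absolutely_integrable[OF that] assms(3) by simp
        have bound: "C_norm (T f) \<le> C * real N powr (- \<delta>) * Lp_norm a f" if f: "f \<in> Lp a" for f
        proof -
          have "norm (T f x) \<le> C * real N powr (- \<delta>) * Lp_norm a f" for x
          proof -
            have "norm (T f x) \<le> Lp_full_norm p v * Lp_full_norm a f * k * real N powr (- \<delta>)"
              unfolding T_def g_def k_def
              by (rule spectral_op_diff_estimate[OF assms(1) v _ f assms(6) \<delta> N1 Nv adm]) (use assms(3) in simp)
            also have "\<dots> \<le> Lp_full_norm p v * (pi * Lp_norm a f) * k * real N powr (- \<delta>)"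
            proof -
              have "pi powr (1 / a) \<le> pi powr 1" using ap pi_gt3 by (intro powr_mono) auto
              then have "Lp_full_norm a f \<le> pi * Lp_norm a f"
                unfolding Lp_full_norm_def by (intro mult_right_mono Lp_norm_nonneg) simp
              then show ?thesis using k by (intro mult_right_mono mult_left_mono Lp_full_norm_nonneg) auto
            qed
            also have "\<dots> = (C - 1) * (real N powr (- \<delta>) * Lp_norm a f)" by (simp add: C_def)
            also have "\<dots> \<le> C * (real N powr (- \<delta>) * Lp_norm a f)" by (intro mult_right_mono) (auto simp: Lp_norm_nonneg)
            finally show ?thesis by (simp add: mult.assoc)
          qed
          then show ?thesis unfolding C_norm_def by (intro cSUP_least) auto
        qed
        have "La_C_norm_le a T (C * real N powr (- \<delta>))"
          unfolding La_C_norm_le_def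
        proof (intro exI[of _ T] conjI ballI allI)
          show "T (\<lambda>t. f t + w t) x = T f x + T w x" if "f \<in> Lp a" "w \<in> Lp a" for f w x
            unfolding T_def bc using that la by (simp add: spectral_op_add[OF vi P'(1)] spectral_op_add[OF z0 P'(2)])
          show "T (\<lambda>t. d * f t) x = d * T f x" if "f \<in> Lp a" for d f x
            unfolding T_def bc using that la by (simp add: spectral_op_cmult[OF vi P'(1)] spectral_op_cmult[OF z0 P'(2)] right_diff_distrib)
          show "continuous_on {0..pi} (T f)" if "f \<in> Lp a" for f
            unfolding T_def[abs_def] bc using that la
            by (intro continuous_on_diff spectral_op_continuous[OF vi P'(1)] spectral_op_continuous[OF z0 P'(2)]) auto
        qed (use bound in auto)
        then show ?thesis
          using is_S_spectral_op[OF vi P(1)[unfolded g_def]] is_S_spectral_op[OF z0 P(2)[unfolded g_def]]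
          unfolding T_def[abs_def] g_def by blast
      qed
      then show ?thesis using admissible_exists[OF vi N1 Nv] by blast
    qed
    then show ?thesis using C by blast
  qed
  show ?thesis using r main by blast
qed

end
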